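(* Let $G$ be a Polish locally compact group acting ergodically and in a Borel measure-preserving manner on a standard probability space $(X,\mu)$. Then we have the following dichotomy: (1) either $\mathcal R_G$ is a countable pmp equivalence relation, (2) or the set of aperiodic elements is dense in $[\mathcal R_G]$, for the topology of convergence in measure.
   Context: A standard probability space is a standard Borel space equipped with a non-atomic Borel probability measure. $\mathrm{Aut}(X,\mu)$ is the group of measure-preserving Borel bijections of $(X,\mu)$, identified when equal almost everywhere. A Borel action means that the action map $G\times X\to X$ is Borel. $\mathcal R_G$ is the orbit equivalence relation of the action, and the orbit full group is $[\mathcal R_G]=\{T\in\mathrm{Aut}(X,\mu): T(x)\in G\cdot x \text{ for all (equivalently, almost all) } x\in X\}$. A countable pmp (probability measure preserving) equivalence relation is the orbit equivalence relation of a measure-preserving action of a countable group on $(X,\mu)$. $T\in\mathrm{Aut}(X,\mu)$ is aperiodic if (almost) all its orbits are infinite. For a Polish space $Y$, $\mathrm L^0(X,\mu,Y)$ is the space of ($\mu$-)measurable maps $X\to Y$ up to equality a.e., with the topology of convergence in measure, induced by $\tilde d(f,g)=\int_X d(f(x),g(x))\,d\mu(x)$ for any compatible bounded metric $d$ on $Y$. Define $\Phi:\mathrm L^0(X,\mu,G)\to \mathrm L^0(X,\mu,X)$ by $\Phi(f)(x)=f(x)\cdot x$ and put $\widetilde{[\mathcal R_G]}:=\Phi^{-1}(\mathrm{Aut}(X,\mu))$. Then $\Phi(\widetilde{[\mathcal R_G]})=[\mathcal R_G]$, and the topology of convergence in measure on $[\mathcal R_G]$ is the quotient topology induced by $\Phi:\widetilde{[\mathcal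 R_G]}\to[\mathcal R_G]$, where $\widetilde{[\mathcal R_G]}$ has the subspace topology from $\mathrm L^0(X,\mu,G)$; it makes $[\mathcal R_G]$ a Polish group.
   Formalization: Case (1) is read up to a null set: for almost every x, the class of x under R_G equals its class under a countable pmp equivalence relation; read at every point the claim fails, since uncountable orbits may lie in an invariant null set. *)

theory Defs
  imports "HOL-Probability.Probability" "HOL-Algebra.Group_Action"
begin

text \<open>
  The acting group is a type of class \<open>topological_group_add\<close>: it is written additively,
  but \<open>group_add\<close> does not assume commutativity. A standard Borel space is a type of class
  \<open>polish_space\<close> with its Borel sets; only the Borel sets of that topology are ever used.
\<close>

definition standard_probability_space :: "'x::polish_space measure \<Rightarrow> bool" where
  "standard_probability_space M \<longleftrightarrow>
     prob_space M \<and> sets M = sets borel \<and>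
     (\<forall>A\<in>sets M. measure M A > 0 \<longrightarrow>
        (\<exists>B\<in>sets M. B \<subseteq> A \<and> 0 < measure M B \<and> measure M B < measure M A))"

definition pmp_bij :: "'x::topological_space measure \<Rightarrow> ('x \<Rightarrow> 'x) \<Rightarrow> bool" where
  "pmp_bij M T \<longleftrightarrow>
     bij T \<and> T \<in> borel_measurable borel \<and> inv_into UNIV T \<in> borel_measurable borel \<and> distr M M T = M"

definition borel_pmp_action ::
    "'x::polish_space measure \<Rightarrow> ('g::{polish_space, topological_group_add} \<Rightarrow> 'x \<Rightarrow> 'x) \<Rightarrow> bool"
  where
  "borel_pmp_action M act \<longleftrightarrow>
     (\<lambda>(g, x). act g x) \<in> borel_measurable (borel \<Otimes>\<^sub>M borel) \<and>
     (\<forall>x. act 0 x = x) \<and>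
     (\<forall>g h x. act (g + h) x = act g (act h x)) \<and>
     (\<forall>g. distr M M (act g) = M)"

definition ergodic_action :: "'x measure \<Rightarrow> ('g \<Rightarrow> 'x \<Rightarrow> 'x) \<Rightarrow> bool" where
  "ergodic_action M act \<longleftrightarrow>
     (\<forall>A\<in>sets M. (\<forall>g. act g ` A = A) \<longrightarrow> measure M A = 0 \<or> measure M A = 1)"

definition orbit_rel :: "('g \<Rightarrow> 'x \<Rightarrow> 'x) \<Rightarrow> 'x rel" where
  "orbit_rel act = {(x, y). \<exists>g. y = act g x}"

text \<open>
  Taking the carrier of the countable group inside \<open>nat\<close> loses no generality, and makes the
  group automatically countable.
\<close>

definition countable_pmp_equivalence :: "'x::topological_space measure \<Rightarrow> 'x rel \<Rightarrow> bool" where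
  "countable_pmp_equivalence M R \<longleftrightarrow>
     (\<exists>(\<Gamma> :: nat monoid) \<phi>. group_action \<Gamma> UNIV \<phi> \<and> (\<forall>\<gamma>\<in>carrier \<Gamma>. pmp_bij M (\<phi> \<gamma>)) \<and>
        R = {(x, y). y \<in> orbit \<Gamma> \<phi> x})"

text \<open>
  Equivalence relations on a probability space are identified when they have the same classes at
  almost every point. This cannot be avoided below: a Borel action may have uncountable orbits
  inside an invariant null set only, and such orbits affect neither ergodicity nor the full group.
\<close>

definition ae_countable_pmp_equivalence :: "'x::topological_space measure \<Rightarrow> 'x rel \<Rightarrow> bool" where
  "ae_countable_pmp_equivalence M R \<longleftrightarrow>
     (\<exists>S. countable_pmp_equivalence M S \<and> (AE x in M. R `` {x} = S `` {x}))"

definition ae_eq :: "'x measure \<Rightarrow> ('x \<Rightarrow> 'y::topological_space) rel" where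
  "ae_eq M = {(f, g). f \<in> borel_measurable M \<and> g \<in> borel_measurable M \<and> (AE x in M. f x = g x)}"

definition L0 :: "'x measure \<Rightarrow> ('x \<Rightarrow> 'y::topological_space) set set" where
  "L0 M = borel_measurable M // ae_eq M"

text \<open>
  The metric of convergence in measure for the compatible bounded metric \<open>min 1 (dist a b)\<close>.
  The integral does not depend on the choice of representatives.
\<close>

definition L0_dist :: "'x measure \<Rightarrow> ('x \<Rightarrow> 'y::metric_space) set \<Rightarrow> ('x \<Rightarrow> 'y) set \<Rightarrow> real" where
  "L0_dist M A B = 
     (\<integral>x. min 1 (dist ((SOME f. f \<in> A) x) ((SOME g. g \<in> B) x)) \<partial>M)"

definition L0_topology :: "'x measure \<Rightarrow> ('x \<Rightarrow> 'y::metric_space) set topology" where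
  "L0_topology M = Metric_space.mtopology (L0 M) (L0_dist M)"

definition Aut :: "'x::topological_space measure \<Rightarrow> ('x \<Rightarrow> 'x) set set" where
  "Aut M = {A \<in> L0 M. \<exists>T\<in>A. pmp_bij M T}"

definition full_group ::
    "'x::topological_space measure \<Rightarrow> ('g \<Rightarrow> 'x \<Rightarrow> 'x) \<Rightarrow> ('x \<Rightarrow> 'x) set set" where
  "full_group M act = {A \<in> Aut M. \<exists>T\<in>A. AE x in M. (x, T x) \<in> orbit_rel act}"

text \<open>
  On a class of maps into the group, the union below is a single class: all its members coincide.
\<close>

definition Phi ::
    "'x::topological_space measure \<Rightarrow> ('g \<Rightarrow> 'x \<Rightarrow> 'x) \<Rightarrow> ('x \<Rightarrow> 'g) set \<Rightarrow> ('x \<Rightarrow> 'x) set" where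
  "Phi M act A = (\<Union>f\<in>A. ae_eq M `` {\<lambda>x. act (f x) x})"

definition lifted_full_group ::
    "'x::topological_space measure \<Rightarrow> ('g::topological_space \<Rightarrow> 'x \<Rightarrow> 'x) \<Rightarrow> ('x \<Rightarrow> 'g) set set" where
  "lifted_full_group M act = {A \<in> L0 M. Phi M act A \<in> Aut M}"

text \<open>
  The topology of convergence in measure: the quotient topology along \<open>Phi\<close> of the subspace
  topology on \<open>lifted_full_group\<close>.
\<close>

definition full_group_topology ::
    "'x::topological_space measure \<Rightarrow> ('g::metric_space \<Rightarrow> 'x \<Rightarrow> 'x) \<Rightarrow> ('x \<Rightarrow> 'x) set topology" where
  "full_group_topology M act = topology (\<lambda>U. U \<subseteq> full_group M act \<and>
     openin (subtopology (L0_topology M) (lifted_full_group M act))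
       {A \<in> lifted_full_group M act. Phi M act A \<in> U})"

definition aperiodic :: "'x::topological_space measure \<Rightarrow> ('x \<Rightarrow> 'x) set \<Rightarrow> bool" where
  "aperiodic M A \<longleftrightarrow> (\<exists>T\<in>A. pmp_bij M T \<and>
     (AE x in M. infinite {y. \<exists>n. y = (T ^^ n) x \<or> x = (T ^^ n) y}))"

lemma openin_full_group_topology:
  "openin (full_group_topology M act) U \<longleftrightarrow> U \<subseteq> full_group M act \<and>
     openin (subtopology (L0_topology M) (lifted_full_group M act))
       {A \<in> lifted_full_group M act. Phi M act A \<in> U}"
proof -
  let ?L = "lifted_full_group M act" and ?X = "subtopology (L0_topology M) (lifted_full_group M act)"
  have "istopology (\<lambda>U. U \<subseteq> full_group M act \<and> openin ?X {A \<in> ?L. Phi M act A \<in> U})"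
    unfolding istopology_def
  proof (intro conjI allI impI)
    fix S T assume S: "S \<subseteq> full_group M act \<and> openin ?X {A \<in> ?L. Phi M act A \<in> S}"
      and T: "T \<subseteq> full_group M act \<and> openin ?X {A \<in> ?L. Phi M act A \<in> T}"
    show "S \<inter> T \<subseteq> full_group M act" using S by blast
    have "{A \<in> ?L. Phi M act A \<in> S \<inter> T} = {A \<in> ?L. Phi M act A \<in> S} \<inter> {A \<in> ?L. Phi M act A \<in> T}"
      by blast
    moreover have "openin ?X ({A \<in> ?L. Phi M act A \<in> S} \<inter> {A \<in> ?L. Phi M act A \<in> T})"
      using S T by (blast intro: openin_Int)
    ultimately show "openin ?X {A \<in> ?L. Phi M act A \<in> S \<inter> T}" by (simp only:)
  next
    fix K assume K: "\<forall>S\<in>K. S \<subseteq> full_group M act \<and> openin ?X {A \<in> ?L. Phi M act A \<in> S}"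
    show "\<Union>K \<subseteq> full_group M act" using K by blast
    have "{A \<in> ?L. Phi M act A \<in> \<Union>K} = (\<Union>S\<in>K. {A \<in> ?L. Phi M act A \<in> S})" by blast
    moreover have "openin ?X (\<Union>S\<in>K. {A \<in> ?L. Phi M act A \<in> S})"
      using K by (intro openin_Union) blast
    ultimately show "openin ?X {A \<in> ?L. Phi M act A \<in> \<Union>K}" by (simp only:)
  qed
  then show ?thesis unfolding full_group_topology_def by (simp only: topology_inverse')
qed

lemma equiv_ae_eq: "equiv (borel_measurable M) (ae_eq M)"
proof (rule equivI)
  show "ae_eq M \<subseteq> borel_measurable M \<times> borel_measurable M" "refl_on (borel_measurable M) (ae_eq M)"
    by (auto simp: ae_eq_def refl_on_def)
  show "sym (ae_eq M)" by (auto simp: ae_eq_def sym_def eq_commute)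
  show "trans (ae_eq M)"
  proof (rule transI)
    fix f g h assume "(f, g) \<in> ae_eq M" "(g, h) \<in> ae_eq M"
    then have m: "f \<in> borel_measurable M" "h \<in> borel_measurable M"
      and ae: "AE x in M. f x = g x" "AE x in M. g x = h x" unfolding ae_eq_def by auto
    from ae have "AE x in M. f x = h x" by eventually_elim simp
    with m show "(f, h) \<in> ae_eq M" unfolding ae_eq_def by simp
  qed
qed

lemma ae_eqD:
  assumes "A \<in> L0 M" "f \<in> A" "g \<in> A"
  shows "f \<in> borel_measurable M" "g \<in> borel_measurable M" "AE x in M. f x = g x"
proof -
  have "(f, g) \<in> ae_eq M"
    using quotient_eq_iff[OF equiv_ae_eq, of A M A f g] assms unfolding L0_def by blast
  then show "f \<in> borel_measurable M" "g \<in> borel_measurable M" "AE x in M. f x = g x"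
    unfolding ae_eq_def by blast+
qed

lemma L0_dist_eq:
  fixes f g :: "'x \<Rightarrow> 'y::{metric_space, second_countable_topology}"
  assumes A: "A \<in> L0 M" "f \<in> A" and B: "B \<in> L0 M" "g \<in> B"
  shows "L0_dist M A B = (\<integral>x. min 1 (dist (f x) (g x)) \<partial>M)"
  unfolding L0_dist_def
proof (rule integral_cong_AE)
  let ?f = "SOME f. f \<in> A" and ?g = "SOME g. g \<in> B"
  have f': "?f \<in> A" and g': "?g \<in> B" using someI[of "\<lambda>f. f \<in> A", OF A(2)] someI[of "\<lambda>g. g \<in> B", OF B(2)] .
  note [measurable] = ae_eqD(1,2)[OF A(1) f' A(2)] ae_eqD(1,2)[OF B(1) g' B(2)]
  show "(\<lambda>x. min 1 (dist (?f x) (?g x))) \<in> borel_measurable M"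
    and "(\<lambda>x. min 1 (dist (f x) (g x))) \<in> borel_measurable M" by measurable
  show "AE x in M. min 1 (dist (?f x) (?g x)) = min 1 (dist (f x) (g x))"
    using ae_eqD(3)[OF A(1) f' A(2)] ae_eqD(3)[OF B(1) g' B(2)] by eventually_elim simp
qed

lemma Metric_space_L0:
  assumes "prob_space M"
  shows "Metric_space (L0 M :: ('x \<Rightarrow> 'y::{metric_space, second_countable_topology}) set set)
    (L0_dist M)"
proof -
  interpret prob_space M by fact
  have rep: "\<exists>f. f \<in> A" if "A \<in> L0 M" for A :: "('x \<Rightarrow> 'y) set"
    using in_quotient_imp_non_empty[OF equiv_ae_eq, of A] that unfolding L0_def by blast
  have int: "integrable M (\<lambda>x. min 1 (dist (f x) (g x)))"
    if [measurable]: "f \<in> borel_measurable M" "g \<in> borel_measurable M" for f g :: "'x \<Rightarrow> 'y"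
    by (rule integrable_const_bound[of _ 1]) auto
  have zero: "L0_dist M A B = 0 \<longleftrightarrow> A = B" if AB: "A \<in> L0 M" "B \<in> L0 M" for A B :: "('x \<Rightarrow> 'y) set"
  proof -
    obtain f g where fg: "f \<in> A" "g \<in> B" using rep AB by blast
    have m: "f \<in> borel_measurable M" "g \<in> borel_measurable M" using ae_eqD(1) AB fg by blast+
    have "L0_dist M A B = 0 \<longleftrightarrow> (AE x in M. min 1 (dist (f x) (g x)) = 0)"
      unfolding L0_dist_eq[OF AB(1) fg(1) AB(2) fg(2)]
      by (rule integral_nonneg_eq_0_iff_AE[OF int[OF m]]) auto
    also have "\<dots> \<longleftrightarrow> (AE x in M. f x = g x)"
      by (rule AE_cong) (auto simp: min_def)
    also have "\<dots> \<longleftrightarrow> A = B"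
      using quotient_eq_iff[OF equiv_ae_eq, of A M B f g] AB fg m unfolding L0_def ae_eq_def by auto
    finally show ?thesis .
  qed
  have tri: "L0_dist M A C \<le> L0_dist M A B + L0_dist M B C"
    if ABC: "A \<in> L0 M" "B \<in> L0 M" "C \<in> L0 M" for A B C :: "('x \<Rightarrow> 'y) set"
  proof -
    obtain f g h where fgh: "f \<in> A" "g \<in> B" "h \<in> C" using rep ABC by meson
    have m: "f \<in> borel_measurable M" "g \<in> borel_measurable M" "h \<in> borel_measurable M"
      using ae_eqD(1) ABC fgh by blast+
    have "(\<integral>x. min 1 (dist (f x) (h x)) \<partial>M)
        \<le> (\<integral>x. min 1 (dist (f x) (g x)) + min 1 (dist (g x) (h x)) \<partial>M)"
    proof (rule integral_mono)
      fix x
      show "min 1 (dist (f x) (h x)) \<le> min 1 (dist (f x) (g x)) + min 1 (dist (g x) (h x))"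
        using dist_triangle[of "f x" "h x" "g x"] zero_le_dist[of "f x" "g x"]
          zero_le_dist[of "g x" "h x"] by linarith
    qed (use int m in auto)
    then show ?thesis using int m fgh ABC by (simp add: L0_dist_eq)
  qed
  show ?thesis
  proof
    fix A B C :: "('x \<Rightarrow> 'y) set"
    show "0 \<le> L0_dist M A B" unfolding L0_dist_def by (rule integral_nonneg_AE) simp
    show "L0_dist M A B = L0_dist M B A" unfolding L0_dist_def by (simp add: dist_commute)
  qed (fact zero tri)+
qed

end

theory Submission
  imports Defs
begin

text \<open>
  By Miller's theorem stabilizers are closed, and by ergodicity they are either almost all open or almost
  all not open. If they are open, a countable dense subgroup \<open>D\<close> of the group has the same orbits almost
  everywhere, and \<open>act g x\<close> is locally constant in \<open>g\<close>, so an element close to the identity fixes most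
  points. If they are not open, the elements of \<open>D\<close> in any neighbourhood of \<open>0\<close> move almost every point
  to infinitely many points. Hence every set carries small fixed-point free involutions along \<open>D\<close>, which
  are assembled into a small aperiodic map by the odometer construction. Composing an element \<open>T\<close> of the
  full group with such a map, supported on a transversal of the periodic part of \<open>T\<close>, yields an aperiodic
  element close to \<open>T\<close>.
\<close>

section \<open>Baire category and closed stabilizers\<close>

text \<open>Density is tested in a quotient topology, so closeness to \<open>T\<close> has to be
  achieved between lifts, as maps into the group. If \<open>f\<close> lifts \<open>T\<close> and
  \<open>U\<close> moves \<open>x\<close> by \<open>v x\<close>, then \<open>T\<close> after
  \<open>U\<close> is lifted by \<open>f (U x) + v x\<close>. Two things can push this away from
  \<open>f x\<close>: \<open>f\<close> may differ at \<open>x\<close> and \<open>U x\<close>, and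
  the metric of the group need not be translation invariant, so a small \<open>v x\<close> may
  change a sum a lot. Both are met by countably many cells on which \<open>f\<close> is nearly
  constant (the colour \<open>c\<close>): \<open>U\<close> preserves every cell, and the cell
  dictates how small \<open>v\<close> must be.

  All displacements \<open>v\<close> are taken from the countable \<open>D\<close>. The resulting
  maps are countably many group elements glued on Borel pieces, and null sets stay null under
  saturation. Closed stabilizers are what makes \<open>D\<close> sufficient: if some element near
  the identity moves \<open>x\<close>, an open set of such elements does, and \<open>D\<close> meets
  it.

  An orbitwise map has a measurable lift only after a measurable choice of group elements; Suslin
  sets serve this choice.\<close>

definition comeager_in :: "'a::topological_space set \<Rightarrow> 'a set \<Rightarrow> bool" where
  "comeager_in F C \<longleftrightarrow> (\<exists>\<W>. countable \<W> \<and> (\<forall>W\<in>\<W>. open W \<and> F \<subseteq> closure (F \<inter> W)) \<and> F \<inter> \<Inter>\<W> \<subseteq> C)"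

lemma comeager_in_open_dense:
  assumes "open W" "F \<subseteq> closure (F \<inter> W)"
  shows "comeager_in F W"
  unfolding comeager_in_def using assms by (intro exI[of _ "{W}"]) auto

lemma comeager_in_mono: "comeager_in F C \<Longrightarrow> C \<subseteq> C' \<Longrightarrow> comeager_in F C'"
  unfolding comeager_in_def by (meson subset_trans)

lemma comeager_in_UNIV: "comeager_in F UNIV"
  by (rule comeager_in_open_dense) (auto simp: closure_subset)

lemma comeager_in_INT:
  fixes C :: "nat \<Rightarrow> 'a::topological_space set"
  assumes "\<And>n. comeager_in F (C n)"
  shows "comeager_in F (\<Inter>n. C n)"
proof -
  obtain \<W> where W: "\<And>n. countable (\<W> n)" "\<And>n. \<forall>W\<in>\<W> n. open W \<and> F \<subseteq> closure (F \<inter> W)"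
      "\<And>n. F \<inter> \<Inter>(\<W> n) \<subseteq> C n"
    using assms unfolding comeager_in_def by metis
  show ?thesis unfolding comeager_in_def
  proof (intro exI conjI)
    show "countable (\<Union>n. \<W> n)" using W(1) by auto
    show "\<forall>W\<in>\<Union>n. \<W> n. open W \<and> F \<subseteq> closure (F \<inter> W)" using W(2) by auto
    show "F \<inter> \<Inter> (\<Union>n. \<W> n) \<subseteq> (\<Inter>n. C n)" using W(3) by blast
  qed
qed

lemma comeager_in_Int:
  assumes "comeager_in F A" "comeager_in F B"
  shows "comeager_in F (A \<inter> B)"
proof -
  have "comeager_in F (\<Inter>n::nat. if n = 0 then A else B)"
    by (rule comeager_in_INT) (use assms in auto)
  then show ?thesis by (rule comeager_in_mono) (auto split: if_splits)
qed

text \<open>This is the Baire category theorem in the closed set \<open>F\<close>, itself completely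
  metrizable. Relative comeagreness is phrased with open sets of the ambient space, so the proof
  passes to the subspace only here.\<close>

lemma comeager_in_meets_open:
  fixes F :: "'a::complete_space set"
  assumes F: "closed F" and C: "comeager_in F C" and Q: "open Q" "F \<inter> Q \<noteq> {}"
  shows "F \<inter> Q \<inter> C \<noteq> {}"
proof -
  obtain \<W> where W: "countable \<W>" "\<forall>W\<in>\<W>. open W \<and> F \<subseteq> closure (F \<inter> W)" "F \<inter> \<Inter>\<W> \<subseteq> C"
    using C unfolding comeager_in_def by auto
  let ?X = "top_of_set F" and ?G = "insert F ((\<inter>) F ` \<W>)"
  have cm: "completely_metrizable_space ?X"
    using F by (simp add: completely_metrizable_space_closedin completely_metrizable_space_euclidean)
  have "?X closure_of \<Inter>?G = topspace ?X"
  proof (rule Baire_category)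
    show "countable ?G" using W(1) by auto
    fix T assume "T \<in> ?G"
    then consider "T = F" | W where "W \<in> \<W>" "T = F \<inter> W" by auto
    then show "openin ?X T \<and> ?X closure_of T = topspace ?X"
    proof cases
      case 1 then show ?thesis by (metis closure_of_topspace openin_topspace topspace_euclidean_subtopology)
    next
      case 2
      then have "open W" "F \<subseteq> closure (F \<inter> W)" using W(2) by auto
      then show ?thesis unfolding 2
        by (auto simp: closure_of_subtopology openin_open)
    qed
  qed (use cm in auto)
  then have "F \<inter> closure (F \<inter> \<Inter>?G) = F"
    unfolding closure_of_subtopology by (simp del: Inter_insert INT_insert)
  then have "F \<subseteq> closure (F \<inter> \<Inter>?G)" by blast
  moreover have "F \<inter> \<Inter>?G \<subseteq> F \<inter> C" using W(3) by auto
  ultimately have "F \<subseteq> closure (F \<inter> C)" using closure_mono by blast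
  then show ?thesis using Q open_Int_closure_eq_empty[OF Q(1), of "F \<inter> C"] by blast
qed

text \<open>The Baire property of Borel sets relative to \<open>F\<close>, by induction on the
  generation of the sigma-algebra. Countable unions are immediate; complements cost a relative
  boundary.\<close>

lemma borel_set_eq_open_on_comeager:
  assumes "A \<in> sets borel"
  shows "\<exists>U C. open U \<and> comeager_in F C \<and> A \<inter> F \<inter> C = U \<inter> F \<inter> C"
proof -
  have "A \<in> sigma_sets UNIV {S. open S}" using assms by (simp add: borel_def)
  then show ?thesis
  proof (induction A rule: sigma_sets.induct)
    case (Basic A) then show ?case using comeager_in_UNIV by auto
  next
    case Empty then show ?case using comeager_in_UNIV by (intro exI[of _ "{}"] exI[of _ UNIV]) auto
  next
    case (Compl A)
    then obtain U C where U: "open U" "comeager_in F C" "A \<inter> F \<inter> C = U \<inter> F \<inter> C" by auto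
    \<comment> \<open>The complement of a relatively open set differs from the exterior only on the
      boundary, and the set together with its exterior is open and dense in
      \<open>F\<close>.\<close>
    let ?U' = "- closure (U \<inter> F)"
    have "comeager_in F (U \<union> ?U')"
    proof (rule comeager_in_open_dense)
      show "F \<subseteq> closure (F \<inter> (U \<union> ?U'))"
      proof
        fix x assume x: "x \<in> F"
        show "x \<in> closure (F \<inter> (U \<union> ?U'))"
        proof (cases "x \<in> closure (U \<inter> F)")
          case True
          moreover have "U \<inter> F \<subseteq> F \<inter> (U \<union> ?U')" by auto
          ultimately show ?thesis using closure_mono by blast
        next
          case False then show ?thesis using x closure_subset by fast
        qed
      qed
    qed (use U in auto)
    then have c: "comeager_in F (C \<inter> (U \<union> ?U'))" using U by (intro comeager_in_Int)
    have "(UNIV - A) \<inter> F \<inter> (C \<inter> (U \<union> ?U')) = ?U' \<inter> F \<inter> (C \<inter> (U \<union> ?U'))"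
    proof (rule Set.set_eqI)
      fix x
      have "x \<in> U \<inter> F \<Longrightarrow> x \<in> closure (U \<inter> F)" using closure_subset[of "U \<inter> F"] by auto
      moreover have "x \<in> A \<inter> F \<inter> C \<longleftrightarrow> x \<in> U \<inter> F \<inter> C" using U(3) by simp
      ultimately show "x \<in> (UNIV - A) \<inter> F \<inter> (C \<inter> (U \<union> ?U')) \<longleftrightarrow> x \<in> ?U' \<inter> F \<inter> (C \<inter> (U \<union> ?U'))"
        by auto
    qed
    then show ?case using c open_Compl[OF closed_closure] by metis
  next
    case (Union A)
    then obtain U C where U: "\<And>n. open (U n)" "\<And>n. comeager_in F (C n)"
        "\<And>n. A n \<inter> F \<inter> C n = U n \<inter> F \<inter> C n" by metis
    have "(\<Union>n. A n) \<inter> F \<inter> (\<Inter>n. C n) = (\<Union>n. U n) \<inter> F \<inter> (\<Inter>n. C n)"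
      using U(3) by blast
    then show ?case using U(1,2) by (intro exI[of _ "\<Union>n. U n"] exI[of _ "\<Inter>n. C n"]) (auto intro: comeager_in_INT)
  qed
qed

section \<open>Translations and subgroups of a topological group\<close>

lemma open_translate_right:
  fixes U :: "'g::topological_group_add set"
  assumes "open U"
  shows "open {x. x + c \<in> U}"
  using open_vimage[OF assms, of "\<lambda>x. x + c"] by (simp add: vimage_def continuous_intros)

lemma open_translate_left:
  fixes U :: "'g::topological_group_add set"
  assumes "open U"
  shows "open {x. c + x \<in> U}"
  using open_vimage[OF assms, of "\<lambda>x. c + x"] by (simp add: vimage_def continuous_intros)

lemma closed_translate_left:
  fixes U :: "'g::topological_group_add set"
  assumes "closed U"
  shows "closed {x. c + x \<in> U}"
  using closed_vimage[OF assms, of "\<lambda>x. c + x"] by (simp add: vimage_def continuous_intros)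

locale add_subgroup =
  fixes H :: "'g::group_add set"
  assumes zero: "0 \<in> H" and add: "a \<in> H \<Longrightarrow> b \<in> H \<Longrightarrow> a + b \<in> H"
    and minus: "a \<in> H \<Longrightarrow> - a \<in> H"
begin

lemma diff: "a \<in> H \<Longrightarrow> b \<in> H \<Longrightarrow> a - b \<in> H"
  using add[of a "- b"] minus by simp

lemma add_iff_left: "a \<in> H \<Longrightarrow> a + b \<in> H \<longleftrightarrow> b \<in> H"
  by (metis add minus minus_add_cancel)

lemma add_iff_right: "b \<in> H \<Longrightarrow> a + b \<in> H \<longleftrightarrow> a \<in> H"
  by (metis add minus add.assoc add.right_inverse add_0_right)

end

text \<open>Sums are handled one variable at a time: a summand in \<open>H\<close> is fixed while
  the other runs through the closure, then the roles are exchanged.\<close>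

lemma add_subgroup_closure:
  fixes H :: "'g::topological_group_add set"
  assumes "add_subgroup H"
  shows "add_subgroup (closure H)"
proof -
  interpret add_subgroup H by fact
  have left: "a + b \<in> closure H" if "a \<in> H" "b \<in> closure H" for a b
  proof -
    have "closure H \<subseteq> {x. a + x \<in> closure H}"
      by (rule closure_minimal) (use add that closure_subset in \<open>auto intro!: closed_translate_left\<close>)
    then show ?thesis using that by auto
  qed
  have cl: "closed {x. x + b \<in> closure H}" for b
    using closed_vimage[of "closure H" "\<lambda>x. x + b"] by (simp add: vimage_def continuous_intros)
  have both: "a + b \<in> closure H" if "a \<in> closure H" "b \<in> closure H" for a b
  proof -
    have "closure H \<subseteq> {x. x + b \<in> closure H}"
      by (rule closure_minimal) (use left that cl in auto)
    then show ?thesis using that by auto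
  qed
  have cl': "closed {x::'g. - x \<in> closure H}"
    using closed_vimage[of "closure H" "\<lambda>x. - x"] by (simp add: vimage_def continuous_intros)
  have "closure H \<subseteq> {x. - x \<in> closure H}"
    by (rule closure_minimal) (use minus closure_subset cl' in auto)
  moreover have "0 \<in> closure H" using zero closure_subset by blast
  ultimately show ?thesis using both by unfold_locales auto
qed

text \<open>Right translation by \<open>k\<close> is a homeomorphism that maps \<open>F\<close> onto
  itself, so it carries relatively dense open sets to such sets.\<close>

lemma comeager_in_translate_right:
  fixes F :: "'g::topological_group_add set"
  assumes F: "\<And>x. x + k \<in> F \<longleftrightarrow> x \<in> F" and C: "comeager_in F C"
  shows "comeager_in F {x. x + k \<in> C}"
proof -
  obtain \<W> where W: "countable \<W>" "\<forall>W\<in>\<W>. open W \<and> F \<subseteq> closure (F \<inter> W)" "F \<inter> \<Inter>\<W> \<subseteq> C"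
    using C unfolding comeager_in_def by auto
  let ?t = "\<lambda>W. {x. x + k \<in> W}"
  have "F \<subseteq> closure (F \<inter> ?t W)" if "W \<in> \<W>" for W
  proof
    fix x assume x: "x \<in> F"
    show "x \<in> closure (F \<inter> ?t W)"
      unfolding closure_iff_nhds_not_empty
    proof (intro allI impI)
      fix A S assume S: "S \<subseteq> A" "open S" "x \<in> S"
      have o: "open {y. y - k \<in> S}" using open_translate_right[OF S(2), of "-k"] by simp
      have "x + k \<in> closure (F \<inter> W)" using F x W(2) that by auto
      moreover have "x + k \<in> {y. y - k \<in> S}" using S by simp
      ultimately obtain y where y: "y \<in> F" "y \<in> W" "y - k \<in> S"
        using o open_Int_closure_eq_empty[OF o, of "F \<inter> W"] by blast
      then have "y - k \<in> (F \<inter> ?t W) \<inter> A" using F[of "y - k"] S by auto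
      then show "(F \<inter> ?t W) \<inter> A \<noteq> {}" by blast
    qed
  qed
  moreover have "F \<inter> \<Inter>(?t ` \<W>) \<subseteq> ?t C" using W(3) F by blast
  ultimately show ?thesis unfolding comeager_in_def
    using W by (intro exI[of _ "?t ` \<W>"]) (auto intro!: open_translate_right)
qed

text \<open>
  Miller's theorem: a Borel map \<open>f\<close> on a Polish group whose fibres are the left cosets of \<open>H\<close> forces
  \<open>H\<close> to be closed. On a comeager part of the closure of \<open>H\<close> the map is continuous, and right
  translation by the dense subgroup \<open>H\<close> does not change its values, so it is constant there.
\<close>

lemma closed_fibre_subgroup:
  fixes f :: "'g::{polish_space, topological_group_add} \<Rightarrow> 'x::{second_countable_topology, t2_space}"
  assumes f: "f \<in> borel_measurable borel" and H: "add_subgroup H"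
    and fib: "\<And>g h. f g = f h \<longleftrightarrow> - g + h \<in> H"
  shows "closed H"
proof -
  interpret H: add_subgroup H by fact
  define F where "F = closure H"
  interpret F: add_subgroup F unfolding F_def by (rule add_subgroup_closure) fact
  have HF: "H \<subseteq> F" unfolding F_def by (rule closure_subset)
  have clF: "closed F" unfolding F_def by simp
  obtain B :: "'x set set" where B: "countable B" "topological_basis B"
    using ex_countable_basis by blast
  have B_ne: "B \<noteq> {}" using B(2) unfolding topological_basis_def by (metis Union_empty empty_iff open_UNIV subset_empty UNIV_I)
  define b where "b = from_nat_into B"
  have rb: "range b = B" unfolding b_def by (rule range_from_nat_into[OF B_ne B(1)])
  have ob: "open (b n)" for n using B(2) rb topological_basis_open by blast
  have "\<exists>U C. open U \<and> comeager_in F C \<and> (f -` b n) \<inter> F \<inter> C = U \<inter> F \<inter> C" for n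
    by (rule borel_set_eq_open_on_comeager) (use measurable_sets[OF f, of "b n"] ob in auto)
  then obtain U C where U: "\<And>n. open (U n)" and C: "\<And>n. comeager_in F (C n)"
    and UC: "\<And>n. (f -` b n) \<inter> F \<inter> C n = U n \<inter> F \<inter> C n" by metis
  \<comment> \<open>On \<open>F\<close> inside \<open>K\<close> every preimage of a basic set
    \<open>b n\<close> is relatively open, so \<open>f\<close> is continuous there.\<close>
  define K where "K = (\<Inter>n. C n)"
  have K: "comeager_in F K" unfolding K_def by (rule comeager_in_INT) (rule C)
  have UK: "f g \<in> b n \<longleftrightarrow> g \<in> U n" if "g \<in> F" "g \<in> K" for g n
    using UC[of n] that unfolding K_def by blast
  have const: "f g = f g'" if g: "g \<in> F" "g \<in> K" and g': "g' \<in> F" "g' \<in> K" for g g'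
  proof (rule ccontr)
    assume "f g \<noteq> f g'"
    then obtain S1 S2 where S: "open S1" "open S2" "f g \<in> S1" "f g' \<in> S2" "S1 \<inter> S2 = {}"
      using hausdorff by metis
    obtain B1 where B1: "B1 \<in> B" "f g \<in> B1" "B1 \<subseteq> S1"
      using topological_basisE[OF B(2) S(1,3)] by blast
    obtain B2 where B2: "B2 \<in> B" "f g' \<in> B2" "B2 \<subseteq> S2"
      using topological_basisE[OF B(2) S(2,4)] by blast
    obtain i j where "b i = B1" "b j = B2" using B1(1) B2(1) unfolding rb[symmetric] by blast
    then have ij: "f g \<in> b i" "f g' \<in> b j" "b i \<inter> b j = {}" using B1 B2 S(5) by auto
    have gi: "g \<in> U i" "g' \<in> U j" using UK g g' ij by auto
    have mem: "- g + g' \<in> closure H" using F.minus F.add g g' unfolding F_def by auto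
    have o: "open {h. g + h \<in> U j}" by (rule open_translate_left[OF U])
    have "- g + g' \<in> {h. g + h \<in> U j}" using gi by simp
    then obtain h where h: "h \<in> H" "g + h \<in> U j"
      using mem open_Int_closure_eq_empty[OF o, of H] by blast
    \<comment> \<open>Near \<open>g + h\<close> both conditions hold: going back by \<open>h\<close>
      leads into \<open>U i\<close>, staying put is in \<open>U j\<close>. A point of
      \<open>W\<close> where \<open>y\<close> and \<open>y - h\<close> lie in \<open>K\<close> has
      its single value \<open>f y = f (y - h)\<close> in two disjoint sets.\<close>
    define W where "W = {x. x - h \<in> U i} \<inter> U j"
    have "open {x. x - h \<in> U i}" using open_translate_right[OF U, of "-h"] by simp
    then have "open W" unfolding W_def using U by auto
    moreover have "g + h \<in> F \<inter> W" unfolding W_def using h HF gi g F.add by auto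
    moreover have "comeager_in F (K \<inter> {x. x + - h \<in> K})"
      by (intro comeager_in_Int K comeager_in_translate_right F.add_iff_right F.minus) (use h HF in auto)
    ultimately obtain y where y: "y \<in> F" "y \<in> W" "y \<in> K" "y - h \<in> K"
      using comeager_in_meets_open[OF clF, of "K \<inter> {x. x + - h \<in> K}" W] by auto
    have "y - h \<in> F" using y h HF F.diff by auto
    then have "f (y - h) \<in> b i" "f y \<in> b j" using UK y unfolding W_def by auto
    moreover have "f (y - h) = f y"
      unfolding fib using h by simp
    ultimately show False using ij by auto
  qed
  have "F \<subseteq> H"
  proof
    fix k assume k: "k \<in> F"
    \<comment> \<open>Some \<open>y\<close> has both \<open>y\<close> and \<open>y + k\<close> in
      \<open>K\<close>; as \<open>f\<close> is constant there, the fibre condition puts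
      \<open>k\<close> into \<open>H\<close>.\<close>
    have "comeager_in F (K \<inter> {x. x + k \<in> K})"
      by (intro comeager_in_Int K comeager_in_translate_right F.add_iff_right k)
    then obtain y where y: "y \<in> F" "y \<in> K" "y + k \<in> K"
      using comeager_in_meets_open[OF clF, of _ UNIV] F.zero by blast
    have "f y = f (y + k)" by (rule const) (use y k F.add in auto)
    then show "k \<in> H" unfolding fib by simp
  qed
  then have "F = H" using HF by blast
  then show ?thesis using clF by simp
qed

text \<open>The set in the hypothesis is the coset \<open>- c + H\<close>; an interior point of one
  coset can be translated to every point of the subgroup.\<close>

lemma open_subgroupI:
  fixes H :: "'g::topological_group_add set"
  assumes "add_subgroup H" and "interior {g. c + g \<in> H} \<noteq> {}"
  shows "open H"
proof -
  interpret add_subgroup H by fact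
  obtain Q g where Q: "open Q" "g \<in> Q" "Q \<subseteq> {g. c + g \<in> H}"
    using assms(2) by (auto simp: interior_def)
  have "\<exists>T. open T \<and> h \<in> T \<and> T \<subseteq> H" if h: "h \<in> H" for h
  proof (intro exI conjI subsetI)
    \<comment> \<open>The translate of \<open>Q\<close> that carries \<open>g\<close> to
      \<open>h\<close>.\<close>
    let ?T = "{x. (g - h) + x \<in> Q}"
    show "open ?T" by (rule open_translate_left[OF Q(1)])
    show "h \<in> ?T" using Q(2) by simp
    fix x assume "x \<in> ?T"
    then have "c + ((g - h) + x) \<in> H" using Q(3) by auto
    then have "(c + g) + (- h + x) \<in> H" by (simp add: add.assoc diff_conv_add_uminus del: add_uminus_conv_diff)
    moreover have "c + g \<in> H" using Q by auto
    ultimately have "- h + x \<in> H" using add_iff_left by blast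
    then show "x \<in> H" using h add_iff_left minus by blast
  qed
  then show ?thesis using Topological_Spaces.openI[of H] by blast
qed

lemma open_subgroupI_ball:
  fixes H :: "'g::topological_group_add set"
  assumes "add_subgroup H" and "open V" "0 \<in> V" "V \<subseteq> H"
  shows "open H"
  by (rule open_subgroupI[OF assms(1), of 0]) (use assms interiorI[of V 0 H] in auto)

lemma interior_countable_Union_closed:
  fixes F :: "'a::complete_space set set"
  assumes "countable \<F>" "\<And>T. T \<in> \<F> \<Longrightarrow> closed T \<and> interior T = {}"
  shows "interior (\<Union>\<F>) = ({} :: 'a set)"
  using Baire_category_alt[OF disjI1[OF completely_metrizable_space_euclidean], of \<F>] assms
  by simp

section \<open>Suslin sets and measurable selection\<close>

text \<open>Analytic sets. A closed domain in Baire space, instead of the whole space, covers the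
  empty set without an exception and makes intersections with closed conditions easy.\<close>

definition suslin :: "'a::topological_space set \<Rightarrow> bool" where
  "suslin A \<longleftrightarrow> (\<exists>C (\<phi> :: (nat \<Rightarrow> nat) \<Rightarrow> 'a). closed C \<and> continuous_on C \<phi> \<and> A = \<phi> ` C)"

lemma tendsto_fun_iff:
  "(f \<longlongrightarrow> l) F \<longleftrightarrow> (\<forall>i. ((\<lambda>x. f x i) \<longlongrightarrow> (l i :: 'b::topological_space)) F)"
  using limitin_componentwise[of "\<lambda>_. euclidean" UNIV f l F]
  by (simp add: euclidean_product_topology)

lemma continuous_on_fun_of_coordinate:
  fixes f :: "'a::discrete_topology \<Rightarrow> 'b::topological_space"
  shows "continuous_on S (\<lambda>z :: 'i \<Rightarrow> 'a. f (z i))"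
  by (rule continuous_on_compose2[OF Topological_Spaces.continuous_on_discrete[of UNIV f]
        continuous_on_subset[OF continuous_on_product_coordinates subset_UNIV]]) auto

text \<open>Points are coded by rapidly convergent sequences from a countable dense set. The bounds
  are non-strict, so the codes form a closed set, and summable, so convergence is uniform and the
  limit is continuous in the code.\<close>

lemma suslin_UNIV: "suslin (UNIV :: 'a::{complete_space, second_countable_topology} set)"
proof -
  obtain D :: "'a set" where D: "countable D" "\<And>X. open X \<Longrightarrow> X \<noteq> {} \<Longrightarrow> \<exists>d\<in>D. d \<in> X"
    using countable_dense_setE by blast
  have "D \<noteq> {}" using D(2)[OF open_UNIV] by auto
  then have y: "range (from_nat_into D) = D" using D(1) by (rule range_from_nat_into)
  define y where "y = from_nat_into D"
  note y = y[folded y_def]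
  define C :: "(nat \<Rightarrow> nat) set"
    where "C = {z. \<forall>k. dist (y (z k)) (y (z (Suc k))) \<le> (1/2) ^ k}"
  define \<phi> where "\<phi> z = lim (\<lambda>k. y (z k))" for z
  have closedC: "closed C"
    unfolding C_def
    by (intro closed_Collect_all closed_Collect_le continuous_intros continuous_on_fun_of_coordinate)
  have tele: "dist (y (z k)) (y (z (k + n))) \<le> 2 * (1/2) ^ k - 2 * (1/2) ^ (k + n)" if "z \<in> C" for z k n
  proof (induction n)
    case (Suc n)
    have "dist (y (z k)) (y (z (k + Suc n))) \<le> dist (y (z k)) (y (z (k + n))) + dist (y (z (k + n))) (y (z (Suc (k + n))))"
      using dist_triangle by simp
    also have "\<dots> \<le> 2 * (1/2) ^ k - 2 * (1/2) ^ (k + n) + (1/2) ^ (k + n)"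
      using Suc that unfolding C_def by (intro add_mono) auto
    finally show ?case by simp
  qed simp
  have tele': "dist (y (z k)) (y (z l)) \<le> 2 * (1/2) ^ k" if z: "z \<in> C" and l: "k \<le> l" for z k l
  proof -
    have "0 \<le> 2 * (1/2::real) ^ (k + (l - k))" by simp
    then show ?thesis using tele[OF z, of k "l - k"] l le_add_diff_inverse by (simp only: le_add_diff_inverse)
  qed
  have null: "(\<lambda>k. 2 * (1/2::real) ^ k) \<longlonglongrightarrow> 0"
    by (rule tendsto_eq_intros LIMSEQ_realpow_zero | simp)+
  have lim: "(\<lambda>k. y (z k)) \<longlonglongrightarrow> \<phi> z" if z: "z \<in> C" for z
  proof -
    have "Cauchy (\<lambda>k. y (z k))"
    proof (rule metric_CauchyI)
      fix e :: real assume "0 < e"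
      then obtain N where N: "2 * (1/2) ^ N < e / 2"
        using order_tendstoD(2)[OF null, of "e / 2"] by (auto simp: eventually_sequentially)
      have "dist (y (z m)) (y (z n)) < e" if "m \<ge> N" "n \<ge> N" for m n
        using tele'[OF z that(1)] tele'[OF z that(2)] dist_triangle3[of "y (z m)" "y (z n)" "y (z N)"] N
        by linarith
      then show "\<exists>M. \<forall>m\<ge>M. \<forall>n\<ge>M. dist (y (z m)) (y (z n)) < e" by blast
    qed
    then show ?thesis unfolding \<phi>_def by (simp add: Cauchy_convergent convergent_LIMSEQ_iff[symmetric])
  qed
  have bd: "dist (y (z k)) (\<phi> z) \<le> 2 * (1/2) ^ k" if z: "z \<in> C" for z k
    by (rule tendsto_upperbound[OF tendsto_dist[OF tendsto_const lim[OF z]]])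
       (use tele'[OF z] in \<open>auto simp: eventually_sequentially\<close>)
  have "uniform_limit C (\<lambda>k z. y (z k)) \<phi> sequentially"
    unfolding uniform_limit_iff
  proof (intro allI impI)
    fix e :: real assume "0 < e"
    then have "\<forall>\<^sub>F k in sequentially. 2 * (1/2::real) ^ k < e" using order_tendstoD(2)[OF null] by blast
    then show "\<forall>\<^sub>F k in sequentially. \<forall>z\<in>C. dist (y (z k)) (\<phi> z) < e"
      by eventually_elim (use bd in \<open>auto intro: le_less_trans\<close>)
  qed
  then have contC: "continuous_on C \<phi>"
    by (intro uniform_limit_theorem[where f = "\<lambda>k z. y (z k)" and F = sequentially])
       (auto intro!: always_eventually continuous_on_fun_of_coordinate)
  have "x \<in> \<phi> ` C" for x
  proof -
    have "\<exists>n. dist (y n) x < (1/2) ^ k / 2" for k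
    proof -
      have "0 < (1/2::real) ^ k / 2" by simp
      then have "x \<in> ball x ((1/2) ^ k / 2)" by (simp only: centre_in_ball)
      then have "\<exists>d\<in>D. d \<in> ball x ((1/2) ^ k / 2)" using D(2)[OF open_ball] by blast
      then show ?thesis using y by (auto simp: dist_commute)
    qed
    then obtain z where z: "\<And>k. dist (y (z k)) x < (1/2) ^ k / 2" by metis
    \<comment> \<open>The approximation error was halved in advance: the errors at stages
      \<open>k\<close> and \<open>Suc k\<close> together stay below
      \<open>(1/2) ^ k\<close>.\<close>
    have "dist (y (z k)) (y (z (Suc k))) \<le> (1/2) ^ k" for k
    proof -
      have "(1/2) ^ Suc k \<le> (1/2::real) ^ k" by simp
      then show ?thesis
        using z[of k] z[of "Suc k"] dist_triangle2[of "y (z k)" "y (z (Suc k))" x] by linarith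
    qed
    then have zC: "z \<in> C" unfolding C_def by simp
    have "(\<lambda>k. y (z k)) \<longlonglongrightarrow> x"
    proof (rule tendstoI)
      fix e :: real assume "0 < e"
      then have "\<forall>\<^sub>F k in sequentially. 2 * (1/2::real) ^ k < e" using order_tendstoD(2)[OF null] by blast
      then show "\<forall>\<^sub>F k in sequentially. dist (y (z k)) x < e"
      proof eventually_elim
        case (elim k)
        have "(0::real) \<le> (1/2)^k" by simp
        then show ?case using z[of k] elim by linarith
      qed
    qed
    then have "\<phi> z = x" using lim[OF zC] LIMSEQ_unique by blast
    then show ?thesis using zC by blast
  qed
  then have "UNIV = \<phi> ` C" by blast
  then show ?thesis unfolding suslin_def using closedC contC by blast
qed

lemma suslin_closed_Int:
  assumes "suslin A" "closed F"
  shows "suslin (A \<inter> F)"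
proof -
  obtain C and \<phi> :: "(nat \<Rightarrow> nat) \<Rightarrow> 'a" where C: "closed C" "continuous_on C \<phi>" "A = \<phi> ` C"
    using assms(1) unfolding suslin_def by blast
  have "closed (\<phi> -` F \<inter> C)" using C assms(2) by (simp add: continuous_on_closed_vimage)
  moreover have "continuous_on (\<phi> -` F \<inter> C) \<phi>" using C(2) by (rule continuous_on_subset) auto
  moreover have "A \<inter> F = \<phi> ` (\<phi> -` F \<inter> C)" using C(3) by auto
  ultimately show ?thesis unfolding suslin_def by blast
qed

lemma suslin_closed:
  fixes F :: "'a::{complete_space, second_countable_topology} set"
  assumes "closed F" shows "suslin F"
  using suslin_closed_Int[OF suslin_UNIV assms] by simp

text \<open>Coordinate 0 of a code names the set and the shifted sequence is a code inside it.
  Fixing coordinate 0 is an open condition, so closedness and continuity may be checked for each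
  index alone.\<close>

lemma suslin_UN:
  fixes A :: "nat \<Rightarrow> 'a::topological_space set"
  assumes "\<And>n. suslin (A n)"
  shows "suslin (\<Union>n. A n)"
proof -
  obtain C and \<phi> :: "nat \<Rightarrow> (nat \<Rightarrow> nat) \<Rightarrow> 'a" where
    C: "\<And>n. closed (C n)" "\<And>n. continuous_on (C n) (\<phi> n)" "\<And>n. A n = \<phi> n ` C n"
    using assms unfolding suslin_def by metis
  let ?sh = "\<lambda>z :: nat \<Rightarrow> nat. \<lambda>k. z (Suc k)"
  have sh: "continuous_on S ?sh" for S
    by (intro continuous_on_coordinatewise_then_product continuous_on_fun_of_coordinate)
  let ?N = "\<lambda>n::nat. {z :: nat \<Rightarrow> nat. z 0 = n}"
  have oN: "open (?N n)" for n
    using open_vimage[OF discrete_topology_class.open_discrete continuous_on_product_coordinates[of 0], of "{n}"]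
    by (simp add: vimage_def)
  define K where "K = {z. ?sh z \<in> C (z 0)}"
  define \<psi> where "\<psi> z = \<phi> (z 0) (?sh z)" for z
  have "- K = (\<Union>n. ?N n \<inter> ?sh -` (- C n))" unfolding K_def by auto
  moreover have "open (?sh -` (- C n))" for n
    by (rule open_vimage) (use C(1) sh in auto)
  ultimately have "open (- K)" by (simp only:) (intro open_UN ballI open_Int oN)
  then have "closed K" by (simp add: closed_def)
  moreover have "continuous_on K \<psi>"
    unfolding continuous_on_def
  proof
    fix z assume z: "z \<in> K"
    let ?n = "z 0"
    have "continuous_on (K \<inter> ?N ?n) (\<lambda>z. \<phi> ?n (?sh z))"
      by (rule continuous_on_compose2[OF C(2) sh]) (auto simp: K_def)
    then have "((\<lambda>z. \<phi> ?n (?sh z)) \<longlongrightarrow> \<phi> ?n (?sh z)) (at z within K \<inter> ?N ?n)"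
      using z unfolding continuous_on_def by auto
    also have "at z within K \<inter> ?N ?n = at z within K"
      by (rule at_within_nhd[of _ "?N ?n"]) (use oN in auto)
    finally have "((\<lambda>z. \<phi> ?n (?sh z)) \<longlongrightarrow> \<psi> z) (at z within K)" unfolding \<psi>_def .
    moreover have "\<forall>\<^sub>F w in at z within K. \<phi> ?n (?sh w) = \<psi> w"
      unfolding eventually_at_topological using oN by (intro exI[of _ "?N ?n"]) (auto simp: \<psi>_def)
    ultimately show "(\<psi> \<longlongrightarrow> \<psi> z) (at z within K)" using tendsto_cong by force
  qed
  moreover have "(\<Union>n. A n) = \<psi> ` K"
  proof (intro equalityI subsetI)
    fix a assume "a \<in> (\<Union>n. A n)"
    then obtain n z where z: "z \<in> C n" "a = \<phi> n z" using C(3) by blast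
    let ?w = "case_nat n z"
    have "?w \<in> K" "\<psi> ?w = a" using z by (auto simp: K_def \<psi>_def)
    then show "a \<in> \<psi> ` K" by blast
  next
    fix a assume "a \<in> \<psi> ` K"
    then show "a \<in> (\<Union>n. A n)" using C(3) by (auto simp: K_def \<psi>_def)
  qed
  ultimately show ?thesis unfolding suslin_def by blast
qed

text \<open>One sequence is split by pairing into countably many codes, one for each set; requiring
  that all of them code the same point is a closed condition.\<close>

lemma suslin_INT:
  fixes A :: "nat \<Rightarrow> 'a::metric_space set"
  assumes "\<And>n. suslin (A n)"
  shows "suslin (\<Inter>n. A n)"
proof -
  obtain C and \<phi> :: "nat \<Rightarrow> (nat \<Rightarrow> nat) \<Rightarrow> 'a" where
    C: "\<And>n. closed (C n)" "\<And>n. continuous_on (C n) (\<phi> n)" "\<And>n. A n = \<phi> n ` C n"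
    using assms unfolding suslin_def by metis
  let ?c = "\<lambda>(i::nat) (z :: nat \<Rightarrow> nat) k. z (prod_encode (i, k))"
  have cc: "continuous_on S (?c i)" for S i
    by (intro continuous_on_coordinatewise_then_product continuous_on_fun_of_coordinate)
  define K' where "K' = (\<Inter>i. ?c i -` C i)"
  define K where "K = {z \<in> K'. \<forall>i. \<phi> i (?c i z) = \<phi> 0 (?c 0 z)}"
  have K': "closed K'" unfolding K'_def
    by (intro closed_INT ballI closed_vimage C cc)
  have cont: "continuous_on K' (\<lambda>z. \<phi> i (?c i z))" for i
    by (rule continuous_on_compose2[OF C(2) cc]) (auto simp: K'_def)
  have "closed ((\<lambda>z. dist (\<phi> i (?c i z)) (\<phi> 0 (?c 0 z))) -` {0} \<inter> K')" for i
  proof -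
    have "continuous_on K' (\<lambda>z. dist (\<phi> i (?c i z)) (\<phi> 0 (?c 0 z)))" by (intro continuous_intros cont)
    then show ?thesis using continuous_on_closed_vimage[OF K'] closed_singleton by blast
  qed
  then have "closed (\<Inter>i. (\<lambda>z. dist (\<phi> i (?c i z)) (\<phi> 0 (?c 0 z))) -` {0} \<inter> K')" by blast
  also have "(\<Inter>i. (\<lambda>z. dist (\<phi> i (?c i z)) (\<phi> 0 (?c 0 z))) -` {0} \<inter> K') = K" unfolding K_def by auto
  finally have "closed K" .
  moreover have "continuous_on K (\<lambda>z. \<phi> 0 (?c 0 z))"
    by (rule continuous_on_subset[OF cont]) (auto simp: K_def)
  moreover have "(\<Inter>n. A n) = (\<lambda>z. \<phi> 0 (?c 0 z)) ` K"
  proof (intro equalityI subsetI)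
    fix a assume "a \<in> (\<Inter>n. A n)"
    then have "\<forall>n. \<exists>z\<in>C n. a = \<phi> n z" using C(3) by blast
    then obtain z where z: "\<And>n. z n \<in> C n" "\<And>n. a = \<phi> n (z n)" by metis
    define w where "w m = (case prod_decode m of (i, k) \<Rightarrow> z i k)" for m
    have "?c i w = z i" for i by (simp add: w_def)
    then have "w \<in> K" "a = \<phi> 0 (?c 0 w)" using z by (auto simp: K_def K'_def) 
    then show "a \<in> (\<lambda>z. \<phi> 0 (?c 0 z)) ` K" by blast
  next
    fix a assume "a \<in> (\<lambda>z. \<phi> 0 (?c 0 z)) ` K"
    then obtain z where z: "z \<in> K" "a = \<phi> 0 (?c 0 z)" by blast
    have "a \<in> A i" for i
    proof -
      have "\<phi> i (?c i z) = \<phi> 0 (?c 0 z)" "?c i z \<in> C i" using z(1) unfolding K_def K'_def by blast+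
      then have "a = \<phi> i (?c i z)" "?c i z \<in> C i" using z(2) by (simp_all only:)
      then show ?thesis using C(3) by blast
    qed
    then show "a \<in> (\<Inter>n. A n)" by blast
  qed
  ultimately show ?thesis unfolding suslin_def by blast
qed

lemma suslin_open:
  fixes U :: "'a::{complete_space, second_countable_topology} set"
  assumes U: "open U"
  shows "suslin U"
proof -
  let ?F = "\<lambda>n::nat. \<Inter>y\<in>-U. {x. 1 / Suc n \<le> dist x y}"
  have "closed (?F n)" for n
    by (intro closed_INT ballI closed_Collect_le continuous_intros)
  then have "suslin (\<Union>n. ?F n)" by (intro suslin_UN suslin_closed)
  also have "(\<Union>n. ?F n) = U"
  proof (intro equalityI subsetI)
    fix x assume "x \<in> U"
    then obtain e where e: "0 < e" "ball x e \<subseteq> U" using U open_contains_ball by blast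
    then obtain n where n: "1 / Suc n < e" using nat_approx_posE by blast
    have "1 / Suc n \<le> dist x z" if "z \<notin> U" for z
    proof -
      have "z \<notin> ball x e" using e(2) that by blast
      then show ?thesis using n by simp
    qed
    then have "x \<in> ?F n" by simp
    then show "x \<in> (\<Union>n. ?F n)" by blast
  next
    fix x assume "x \<in> (\<Union>n. ?F n)"
    then obtain n where n: "x \<in> ?F n" by blast
    show "x \<in> U"
    proof (rule ccontr)
      assume "x \<notin> U"
      then have "1 / Suc n \<le> dist x x" using n by blast
      then show False by simp
    qed
  qed
  finally show ?thesis .
qed

text \<open>Suslin sets are not closed under complement, so the induction carries a set and its
  complement together.\<close>

lemma suslin_borel:
  fixes A :: "'a::{complete_space, second_countable_topology} set"
  assumes "A \<in> sets borel"
  shows "suslin A"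
proof -
  have "A \<in> sigma_sets UNIV {S. open S}" using assms by (simp add: borel_def)
  then have "suslin A \<and> suslin (- A)"
  proof (induction A rule: sigma_sets.induct)
    case (Basic A) then show ?case by (auto intro: suslin_open suslin_closed)
  next
    case Empty then show ?case by (auto intro: suslin_open suslin_UNIV)
  next
    case (Compl A) then show ?case by (simp add: Compl_eq_Diff_UNIV[symmetric])
  next
    case (Union A) then show ?case by (auto intro: suslin_UN suslin_INT simp: Compl_UN)
  qed
  then show ?thesis ..
qed

section \<open>Inner approximation by compact sets, Borel sections and measurable selection\<close>

lemma compact_bounded_seqs:
  fixes m :: "nat \<Rightarrow> nat"
  shows "compact {z. \<forall>i. z i \<le> m i}"
proof -
  have "compactin (product_topology (\<lambda>_. euclidean) UNIV) (PiE UNIV (\<lambda>i. {..m i}))"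
    unfolding compactin_PiE by (auto intro: finite_imp_compact)
  moreover have "PiE UNIV (\<lambda>i. {..m i}) = {z. \<forall>i. z i \<le> m i}" by (auto simp: PiE_def Pi_def)
  ultimately show ?thesis by (simp add: euclidean_product_topology)
qed

text \<open>Capacitability of analytic sets. Outer measure is continuous along increasing sequences
  of arbitrary sets, so the coordinates of the codes can be bounded one after another while the
  outer measure of the image stays above \<open>a\<close>. Codes with all coordinates bounded form a
  compact set.\<close>

lemma continuous_image_compact_inner:
  fixes p :: "(nat \<Rightarrow> nat) \<Rightarrow> 'x::metric_space"
  assumes M: "finite_measure M" "sets M = sets borel"
    and C: "closed C" and p: "continuous_on C p"
    and a: "a < outer_measure_of M (p ` C)"
  shows "\<exists>K\<subseteq>C. closed K \<and> compact K \<and> a \<le> emeasure M (p ` K)"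
proof -
  interpret finite_measure M by (rule M(1))
  have sp: "space M = UNIV" using sets_eq_imp_space_eq[OF M(2)] by simp
  \<comment> \<open>Only the first \<open>k\<close> values of \<open>m\<close> matter, so at each
    stage just one new bound is chosen.\<close>
  define Cm where "Cm k m = {z \<in> C. \<forall>i<k. z i \<le> m i}" for k and m :: "nat \<Rightarrow> nat"
  have "\<exists>m. \<forall>k. a < outer_measure_of M (p ` Cm k (m k)) \<and> (\<forall>i<k. m (Suc k) i = m k i)"
  proof (rule dependent_nat_choice)
    show "\<exists>m. a < outer_measure_of M (p ` Cm 0 m)" using a by (simp add: Cm_def)
  next
    fix m k assume *: "a < outer_measure_of M (p ` Cm k m)"
    have "(\<Union>n. p ` Cm (Suc k) (m(k := n))) = p ` Cm k m"
    proof (intro equalityI subsetI)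
      fix x assume "x \<in> p ` Cm k m"
      then obtain z where z: "z \<in> Cm k m" "x = p z" by blast
      then have "z \<in> Cm (Suc k) (m(k := z k))" by (auto simp: Cm_def less_Suc_eq)
      then show "x \<in> (\<Union>n. p ` Cm (Suc k) (m(k := n)))" using z by blast
    qed (auto simp: Cm_def less_Suc_eq image_iff)
    moreover have "incseq (\<lambda>n. p ` Cm (Suc k) (m(k := n)))"
      by (intro monoI image_mono) (auto simp: Cm_def less_Suc_eq)
    ultimately have "(SUP n. outer_measure_of M (p ` Cm (Suc k) (m(k := n)))) = outer_measure_of M (p ` Cm k m)"
      using SUP_outer_measure_of_incseq[of "\<lambda>n. p ` Cm (Suc k) (m(k := n))" M] sp by simp
    then have "a < (SUP n. outer_measure_of M (p ` Cm (Suc k) (m(k := n))))" using * by simp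
    then obtain n where "a < outer_measure_of M (p ` Cm (Suc k) (m(k := n)))"
      unfolding less_SUP_iff by blast
    then show "\<exists>m'. a < outer_measure_of M (p ` Cm (Suc k) m') \<and> (\<forall>i<k. m' i = m i)"
      by (intro exI[of _ "m(k := n)"]) auto
  qed
  then obtain m where m: "\<And>k. a < outer_measure_of M (p ` Cm k (m k))"
    and ms: "\<And>k i. i < k \<Longrightarrow> m (Suc k) i = m k i" by metis
  \<comment> \<open>The diagonal: coordinate \<open>i\<close> receives its final bound at stage
    \<open>Suc i\<close>.\<close>
  define b where "b i = m (Suc i) i" for i
  have mb: "m k i = b i" if "i < k" for k i
    using that by (induction k) (auto simp: b_def ms less_Suc_eq)
  have Cb: "Cm k (m k) = Cm k b" for k unfolding Cm_def using mb by auto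
  define K where "K = {z \<in> C. \<forall>i. z i \<le> b i}"
  have "K = {z. \<forall>i. z i \<le> b i} \<inter> C" unfolding K_def by auto
  then have K: "compact K" using compact_Int_closed[OF compact_bounded_seqs C] by simp
  have clK: "closed K" unfolding K_def
    by (intro closed_Collect_conj closed_Collect_all closed_Collect_le continuous_on_product_coordinates
        continuous_on_const) (use C in auto)
  have pK: "compact (p ` K)"
    by (rule compact_continuous_image[OF continuous_on_subset[OF p] K]) (auto simp: K_def)
  have sub: "(\<Inter>k. closure (p ` Cm k b)) \<subseteq> p ` K"
  proof
    fix x assume x: "x \<in> (\<Inter>k. closure (p ` Cm k b))"
    have "\<exists>z\<in>Cm k b. dist (p z) x < 1 / Suc k" for k
    proof -
      have "x \<in> closure (p ` Cm k b)" "0 < 1 / real (Suc k)" using x by auto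
      then show ?thesis unfolding closure_approachable by blast
    qed
    then have "\<forall>k. \<exists>z. z \<in> Cm k b \<and> dist (p z) x < 1 / Suc k" by blast
    from choice[OF this] obtain z where z: "\<And>k. z k \<in> Cm k b" "\<And>k. dist (p (z k)) x < 1 / Suc k" by blast
    \<comment> \<open>The points \<open>z k\<close> obey the bound only in their first
      \<open>k\<close> coordinates. Truncation puts them into a compact set and changes no fixed
      coordinate from some index on, so a convergent subsequence of \<open>w\<close> gives one of
      \<open>z\<close>.\<close>
    define w where "w k i = min (z k i) (b i)" for k i
    have "seq_compact {z. \<forall>i. z i \<le> b i}" by (intro compact_imp_seq_compact compact_bounded_seqs)
    moreover have "\<forall>k. w k \<in> {z. \<forall>i. z i \<le> b i}" by (auto simp: w_def)
    ultimately obtain l r where l: "l \<in> {z. \<forall>i. z i \<le> b i}" "strict_mono (r :: nat \<Rightarrow> nat)" "(w \<circ> r) \<longlonglongrightarrow> l"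
      by (rule seq_compactE)
    have zr: "(\<lambda>k. z (r k)) \<longlonglongrightarrow> l"
      unfolding tendsto_fun_iff
    proof
      fix i
      have "(\<lambda>k. w (r k) i) \<longlonglongrightarrow> l i" using l(3) unfolding tendsto_fun_iff comp_def by blast
      moreover have "\<forall>\<^sub>F k in sequentially. w (r k) i = z (r k) i"
        using eventually_gt_at_top[of i]
      proof eventually_elim
        case (elim k)
        then have "i < r k" using seq_suble[OF l(2), of k] by linarith
        then have "z (r k) i \<le> b i" using z(1)[of "r k"] by (auto simp: Cm_def)
        then show ?case by (simp add: w_def)
      qed
      ultimately show "(\<lambda>k. z (r k) i) \<longlonglongrightarrow> l i" by (rule Lim_transform_eventually)
    qed
    have zC: "z (r k) \<in> C" for k using z(1) by (auto simp: Cm_def)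
    then have lC: "l \<in> C" using C zr by (meson closed_sequentially)
    have "(\<lambda>k. p (z (r k))) \<longlonglongrightarrow> p l"
      by (rule continuous_on_tendsto_compose[OF p zr lC]) (use zC in auto)
    moreover have "(\<lambda>k. p (z (r k))) \<longlonglongrightarrow> x"
    proof -
      have "(\<lambda>k. p (z k)) \<longlonglongrightarrow> x"
        unfolding tendsto_dist_iff[of _ x]
      proof (rule tendsto_sandwich[OF _ _ tendsto_const])
        show "\<forall>\<^sub>F n in sequentially. dist (p (z n)) x \<le> 1 / real (Suc n)"
          using z(2) by (auto intro: less_imp_le always_eventually)
        show "(\<lambda>n. 1 / real (Suc n)) \<longlonglongrightarrow> 0"
          using LIMSEQ_inverse_real_of_nat by (simp add: inverse_eq_divide)
      qed auto
      then show ?thesis using LIMSEQ_subseq_LIMSEQ[OF _ l(2)] by (auto simp: comp_def)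
    qed
    ultimately have "x = p l" using LIMSEQ_unique by blast
    then show "x \<in> p ` K" using l(1) lC by (auto simp: K_def)
  qed
  have "a \<le> emeasure M (closure (p ` Cm k b))" for k
  proof -
    have "a < outer_measure_of M (p ` Cm k b)" using m[of k] unfolding Cb .
    also have "\<dots> \<le> outer_measure_of M (closure (p ` Cm k b))"
      by (rule outer_measure_of_mono) (rule closure_subset)
    also have "\<dots> = emeasure M (closure (p ` Cm k b))"
      by (rule outer_measure_of_eq) (simp add: M(2))
    finally show ?thesis by simp
  qed
  then have "a \<le> (INF k. emeasure M (closure (p ` Cm k b)))" by (auto intro: INF_greatest)
  also have "\<dots> = emeasure M (\<Inter>k. closure (p ` Cm k b))"
    by (rule INF_emeasure_decseq) (auto simp: M(2) decseq_def Cm_def emeasure_eq_measure intro!: closure_mono image_mono)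
  also have "\<dots> \<le> emeasure M (p ` K)"
    by (rule emeasure_mono[OF sub]) (use pK in \<open>auto simp: M(2) compact_imp_closed\<close>)
  finally show ?thesis using K clK by (intro exI[of _ K]) (auto simp: K_def)
qed

text \<open>The section picks the lexicographically least point of each fibre.\<close>

lemma compact_borel_section:
  fixes p :: "(nat \<Rightarrow> nat) \<Rightarrow> 'x::t2_space"
  assumes K: "compact K" and cl: "closed K" and p: "continuous_on K p"
  shows "\<exists>s\<in>borel_measurable borel. \<forall>x\<in>p ` K. s x \<in> K \<and> p (s x) = x"
proof -
  define N where "N w = {z :: nat \<Rightarrow> nat. \<forall>i<length w. z i = w ! i}" for w
  define B where "B w = p ` (K \<inter> N w)" for w
  have clN: "closed (N w)" for w
    unfolding N_def by (intro closed_Collect_all closed_Collect_imp open_Collect_const closed_Collect_eq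
       continuous_on_const continuous_on_product_coordinates)
  have "compact (B w)" for w unfolding B_def
    by (intro compact_continuous_image continuous_on_subset[OF p] compact_Int_closed K clN) auto
  then have Bm[measurable]: "B w \<in> sets borel" for w by (simp add: borel_compact)
  \<comment> \<open>The code of \<open>x\<close> is found digit by digit: the next digit is the
    least one whose cylinder still contains a preimage of \<open>x\<close>. Images of cylinders are
    compact, hence Borel, so each digit depends measurably on \<open>x\<close>.\<close>
  define sel where "sel = rec_nat (\<lambda>x. []) (\<lambda>_ s x. s x @ [LEAST n. x \<in> B (s x @ [n])])"
  have sel_0: "sel 0 x = []" and sel_Suc: "sel (Suc k) x = sel k x @ [LEAST n. x \<in> B (sel k x @ [n])]" for k x
    by (simp_all add: sel_def)
  have len: "length (sel k x) = k" for k x by (induction k) (simp_all add: sel_0 sel_Suc)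
  have meas: "sel k \<in> measurable borel (count_space UNIV)" for k
  proof (induction k)
    case 0
    have "sel 0 = (\<lambda>_. [])" by (rule ext) (rule sel_0)
    then show ?case by simp
  next
    case (Suc k)
    note [measurable] = Suc
    have "(\<lambda>x. LEAST n. x \<in> B (w @ [n])) \<in> measurable borel (count_space UNIV)" for w
      by measurable
    then have "(\<lambda>x. w @ [LEAST n. x \<in> B (w @ [n])]) \<in> measurable borel (count_space UNIV)" for w
      by (rule measurable_compose) simp
    then have "(\<lambda>x. (\<lambda>w x. w @ [LEAST n. x \<in> B (w @ [n])]) (sel k x) x) \<in> measurable borel (count_space UNIV)"
      by (rule measurable_compose_countable[OF _ Suc])
    moreover have "sel (Suc k) = (\<lambda>x. sel k x @ [LEAST n. x \<in> B (sel k x @ [n])])"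
      by (rule ext) (rule sel_Suc)
    ultimately show ?case by simp
  qed
  define s where "s x i = sel (Suc i) x ! i" for x i
  have sel_nth: "sel k x ! i = s x i" if "i < k" for k x i
    using that
  proof (induction k)
    case (Suc k)
    then show ?case
      by (cases "i = k") (auto simp: s_def sel_Suc nth_append len)
  qed simp
  have "s \<in> borel_measurable borel"
  proof (rule measurable_coordinatewise_then_product)
    fix i
    have "(\<lambda>x. (\<lambda>w. w ! i) (sel (Suc i) x)) \<in> borel_measurable borel"
      by (rule measurable_compose[OF meas]) simp
    then show "(\<lambda>x. s x i) \<in> borel_measurable borel" by (simp add: s_def)
  qed
  moreover have "s x \<in> K \<and> p (s x) = x" if x: "x \<in> p ` K" for x
  proof -
    have inB: "x \<in> B (sel k x)" for k
    proof (induction k)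
      case 0 then show ?case using x by (simp add: sel_0 B_def N_def)
    next
      case (Suc k)
      then obtain z where z: "z \<in> K" "z \<in> N (sel k x)" "x = p z" unfolding B_def by blast
      have "z \<in> N (sel k x @ [z k])" using z(2) by (auto simp: N_def nth_append len less_Suc_eq)
      then have "x \<in> B (sel k x @ [z k])" using z unfolding B_def by blast
      then show ?case unfolding sel_Suc by (rule LeastI)
    qed
    then have "\<forall>k. \<exists>z. z \<in> K \<and> z \<in> N (sel k x) \<and> x = p z" unfolding B_def by blast
    from choice[OF this] obtain z
      where z: "\<And>k. z k \<in> K" "\<And>k. z k \<in> N (sel k x)" "\<And>k. x = p (z k)" by blast
    have zs: "z \<longlonglongrightarrow> s x"
      unfolding tendsto_fun_iff tendsto_discrete
    proof
      fix i
      show "\<forall>\<^sub>F k in sequentially. z k i = s x i"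
        using eventually_gt_at_top[of i]
        by eventually_elim (use z(2) sel_nth in \<open>auto simp: N_def len\<close>)
    qed
    have sK: "s x \<in> K" using z(1) cl zs by (meson closed_sequentially)
    have "(\<lambda>k. p (z k)) \<longlonglongrightarrow> p (s x)"
      by (rule continuous_on_tendsto_compose[OF p zs sK]) (use z(1) in auto)
    then have "(\<lambda>k. x) \<longlonglongrightarrow> p (s x)" using z(3) by simp
    then have "p (s x) = x" by (simp add: LIMSEQ_const_iff)
    then show ?thesis using sK by simp
  qed
  ultimately show ?thesis by blast
qed

text \<open>Compact sets of codes for \<open>P\<close> project onto all but \<open>1 / Suc n\<close>
  of the space and carry Borel sections. At \<open>x\<close> the section of the first piece whose
  projection contains \<open>x\<close> is used.\<close>

lemma measurable_selection:
  fixes P :: "('x::polish_space \<times> 'y::polish_space) set"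
  assumes M: "prob_space M" "sets M = sets borel" and P: "P \<in> sets borel"
    and ex: "AE x in M. \<exists>y. (x, y) \<in> P"
  shows "\<exists>f\<in>borel_measurable M. AE x in M. (x, f x) \<in> P"
proof -
  interpret prob_space M by fact
  have sp: "space M = UNIV" using sets_eq_imp_space_eq[OF M(2)] by simp
  obtain C and \<phi> :: "(nat \<Rightarrow> nat) \<Rightarrow> 'x \<times> 'y" where C: "closed C" "continuous_on C \<phi>" "P = \<phi> ` C"
    using suslin_borel[OF P] unfolding suslin_def by blast
  define p where "p = fst \<circ> \<phi>"
  have p: "continuous_on C p" unfolding p_def by (intro continuous_on_compose C continuous_intros)
  have pC: "p ` C = {x. \<exists>y. (x, y) \<in> P}" unfolding p_def image_comp[symmetric] C(3)[symmetric] by force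
  \<comment> \<open>The projection of \<open>P\<close> is only known to be analytic, so its size is
    read off from its measurable supersets, all of measure 1.\<close>
  have "1 \<le> outer_measure_of M (p ` C)"
    unfolding outer_measure_of_def
  proof (rule INF_greatest)
    fix B assume "B \<in> {B \<in> sets M. p ` C \<subseteq> B}"
    then have B: "B \<in> sets M" "p ` C \<subseteq> B" by auto
    have "AE x in M. x \<in> B" using ex by eventually_elim (use B pC in auto)
    then have "emeasure M B = 1" using B(1) by (simp add: emeasure_eq_measure prob_eq_1)
    then show "1 \<le> emeasure M B" by simp
  qed
  have "\<exists>K\<subseteq>C. closed K \<and> compact K \<and> ennreal (1 - 1 / Suc n) \<le> emeasure M (p ` K)" for n
  proof (rule continuous_image_compact_inner)
    have "ennreal (1 - 1 / Suc n) < ennreal 1" by (rule ennreal_lessI) auto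
    also have "\<dots> \<le> outer_measure_of M (p ` C)" using \<open>1 \<le> _\<close> by simp
    finally show "ennreal (1 - 1 / Suc n) < outer_measure_of M (p ` C)" .
  qed (use M C p finite_measure_axioms in auto)
  then obtain K where K: "\<And>n. K n \<subseteq> C" "\<And>n. compact (K n)"
      and clK: "\<And>n. closed (K n)" and Kge: "\<And>n. ennreal (1 - 1 / Suc n) \<le> emeasure M (p ` K n)" by metis
  have pK: "p ` K n \<in> sets borel" for n
    by (intro borel_compact compact_continuous_image continuous_on_subset[OF p] K)
  have "\<exists>s\<in>borel_measurable borel. \<forall>x\<in>p ` K n. s x \<in> K n \<and> p (s x) = x" for n
    by (rule compact_borel_section[OF K(2) clK continuous_on_subset[OF p K(1)]])
  then obtain s where s: "\<And>n. s n \<in> borel_measurable borel"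
      "\<And>n x. x \<in> p ` K n \<Longrightarrow> s n x \<in> K n" "\<And>n x. x \<in> p ` K n \<Longrightarrow> p (s n x) = x" by metis
  define h where "h n z = (if z \<in> K n then snd (\<phi> z) else undefined)" for n z
  have h: "h n \<in> borel_measurable borel" for n
  proof -
    have "continuous_on (K n) (\<lambda>z. snd (\<phi> z))"
      by (intro continuous_on_snd continuous_on_subset[OF C(2) K(1)])
    then show ?thesis unfolding h_def
      by (intro borel_measurable_continuous_on_if) (use clK in auto)
  qed
  define f where "f x = h (LEAST n. x \<in> p ` K n) (s (LEAST n. x \<in> p ` K n) x)" for x
  have "f \<in> borel_measurable M"
  proof -
    have 1: "(\<lambda>x. LEAST n. x \<in> p ` K n) \<in> measurable M (count_space UNIV)"
      using pK M(2) by (intro measurable_Least) (auto simp: sp pred_def)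
    have 2: "(\<lambda>x. h n (s n x)) \<in> borel_measurable M" for n
      using measurable_compose[OF s(1) h] measurable_cong_sets[OF M(2) refl] by blast
    show ?thesis unfolding f_def by (rule measurable_compose_countable[OF 2 1])
  qed
  moreover have "AE x in M. x \<in> (\<Union>n. p ` K n)"
  proof -
    have sets: "(\<Union>n. p ` K n) \<in> sets M" using pK M(2) by auto
    have "1 - 1 / Suc n \<le> prob (\<Union>n. p ` K n)" for n
    proof -
      have "ennreal (1 - 1 / Suc n) \<le> ennreal (prob (p ` K n))" using Kge by (simp add: emeasure_eq_measure)
      then have "1 - 1 / Suc n \<le> prob (p ` K n)" by (simp add: ennreal_le_iff)
      also have "\<dots> \<le> prob (\<Union>n. p ` K n)" by (rule finite_measure_mono) (use sets in auto)
      finally show ?thesis .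
    qed
    moreover have "(\<lambda>n. 1 - 1 / real (Suc n)) \<longlonglongrightarrow> 1 - 0"
      by (intro tendsto_diff tendsto_const) (use LIMSEQ_inverse_real_of_nat in \<open>simp add: inverse_eq_divide\<close>)
    ultimately have "1 \<le> prob (\<Union>n. p ` K n)"
      by (intro LIMSEQ_le_const2[of "\<lambda>n. 1 - 1 / real (Suc n)" 1]) auto
    then have "prob (\<Union>n. p ` K n) = 1" using prob_le_1 by (intro antisym)
    then show ?thesis using sets prob_eq_1 by blast
  qed
  then have "AE x in M. (x, f x) \<in> P"
  proof eventually_elim
    case (elim x)
    then obtain n where n: "x \<in> p ` K n" by blast
    let ?n = "LEAST n. x \<in> p ` K n"
    have *: "x \<in> p ` K ?n" using n by (rule LeastI)
    have z: "s ?n x \<in> K ?n" "p (s ?n x) = x" using s(2,3)[OF *] by auto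
    have "f x = snd (\<phi> (s ?n x))" using z unfolding f_def h_def by simp
    then have "(x, f x) = \<phi> (s ?n x)" using z(2) unfolding p_def by (simp add: prod_eq_iff)
    then show ?case using z(1) K(1) C(3) by blast
  qed
  ultimately show ?thesis by blast
qed

section \<open>Borel actions and open stabilizers\<close>

lemma countable_dense_subgroup:
  "\<exists>D :: 'g::{second_countable_topology, topological_group_add} set.
     countable D \<and> add_subgroup D \<and> (\<forall>U. open U \<longrightarrow> U \<noteq> {} \<longrightarrow> (\<exists>d\<in>D. d \<in> U))"
proof -
  obtain E :: "'g set" where E: "countable E" "\<And>X. open X \<Longrightarrow> X \<noteq> {} \<Longrightarrow> \<exists>d\<in>E. d \<in> X"
    using countable_dense_setE by blast
  let ?S = "E \<union> uminus ` E"
  define D where "D = sum_list ` lists ?S"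
  have "add_subgroup D"
  proof
    have "sum_list [] \<in> D" unfolding D_def by (intro imageI) auto
    then show "0 \<in> D" by simp
  next
    fix a b assume "a \<in> D" "b \<in> D"
    then obtain xs ys where "xs \<in> lists ?S" "ys \<in> lists ?S" "a = sum_list xs" "b = sum_list ys"
      unfolding D_def by blast
    then have "a + b = sum_list (xs @ ys)" "xs @ ys \<in> lists ?S" by auto
    then show "a + b \<in> D" unfolding D_def by blast
  next
    fix a assume "a \<in> D"
    then obtain xs where "xs \<in> lists ?S" "a = sum_list xs" unfolding D_def by blast
    then show "- a \<in> D"
    proof (induction xs arbitrary: a rule: list.induct)
      case Nil
      have "sum_list [] \<in> D" unfolding D_def by (intro imageI) auto
      then show ?case using Nil by simp
    next
      case (Cons x xs)
      then have "xs \<in> lists ?S" by simp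
      then have "- sum_list xs \<in> D" by (rule Cons.IH) (rule refl)
      then obtain ys where ys: "ys \<in> lists ?S" "- sum_list xs = sum_list ys" unfolding D_def by (rule imageE)
      have "- a = - sum_list xs + - x" using Cons.prems(2) by (simp only: sum_list.Cons minus_add)
      then have a: "- a = sum_list (ys @ [- x])" using ys(2) by simp
      have "x \<in> ?S" using Cons.prems(1) by simp
      then have "- x \<in> ?S" by (auto simp: image_iff)
      then have "ys @ [- x] \<in> lists ?S" using ys(1) by simp
      then show ?case unfolding D_def a by (rule imageI)
    qed
  qed
  moreover have "countable D" unfolding D_def using E(1) by (intro countable_image countable_lists) auto
  moreover have "E \<subseteq> D"
  proof
    fix e assume "e \<in> E"
    then show "e \<in> D" unfolding D_def by (intro image_eqI[of _ _ "[e]"]) auto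
  qed
  ultimately show ?thesis using E(2) by (intro exI[of _ D] conjI allI impI) (assumption | blast)+
qed

locale borel_pmp_system = prob_space M + D: add_subgroup D
  for M :: "'x::polish_space measure" and D :: "'g::{polish_space, topological_group_add} set" +
  fixes act :: "'g \<Rightarrow> 'x \<Rightarrow> 'x"
  assumes sets_M: "sets M = sets borel" and action: "borel_pmp_action M act"
    and countable_D: "countable D" and dense_D: "\<And>U. open U \<Longrightarrow> U \<noteq> {} \<Longrightarrow> \<exists>d\<in>D. d \<in> U"
begin

lemma space_M: "space M = UNIV"
  using sets_eq_imp_space_eq[OF sets_M] by simp

lemma measurable_M: "measurable M N = measurable borel N"
  by (rule measurable_cong_sets[OF sets_M refl])

lemma act_0 [simp]: "act 0 x = x"
  and act_add: "act (g + h) x = act g (act h x)"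
  and distr_act: "distr M M (act g) = M"
  using action unfolding borel_pmp_action_def by auto

lemma act_minus_act [simp]: "act (- g) (act g x) = x" and act_act_minus [simp]: "act g (act (- g) x) = x"
  by (simp_all flip: act_add)

lemma act_eq_iff: "act g x = act g y \<longleftrightarrow> x = y"
  by (metis act_minus_act)

lemma bij_act: "bij (act g)"
  by (rule o_bij[of "act (- g)"]) auto

lemma act_image: "act g ` A = {x. act (- g) x \<in> A}"
  by (auto simp: image_iff) (metis act_act_minus)

lemma measurable_act [measurable (raw)]:
  assumes "f \<in> borel_measurable N" "h \<in> borel_measurable N"
  shows "(\<lambda>x. act (f x) (h x)) \<in> borel_measurable N"
proof -
  have "(\<lambda>(g, x). act g x) \<in> borel_measurable (borel \<Otimes>\<^sub>M borel)"
    using action unfolding borel_pmp_action_def by auto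
  from measurable_compose[OF measurable_Pair[OF assms] this] show ?thesis by simp
qed

lemma sets_act_vimage: "A \<in> sets borel \<Longrightarrow> {x. act g x \<in> A} \<in> sets borel"
  using measurable_sets[of "act g" borel borel A] measurable_act[of "\<lambda>_. g" borel "\<lambda>x. x"]
  by (simp add: vimage_def)

lemma sets_act_image: "A \<in> sets borel \<Longrightarrow> act g ` A \<in> sets borel"
  unfolding act_image by (rule sets_act_vimage)

lemma measure_act_vimage:
  assumes "A \<in> sets borel" shows "measure M {x. act g x \<in> A} = measure M A"
proof -
  have "measure (distr M M (act g)) A = measure M {x. act g x \<in> A}"
    using assms measurable_act[of "\<lambda>_. g" M "\<lambda>x. x"]
    by (subst measure_distr) (auto simp: sets_M space_M measurable_M vimage_def cong: measurable_cong_sets)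
  then show ?thesis by (simp add: distr_act)
qed

lemma measure_act_image: "A \<in> sets borel \<Longrightarrow> measure M (act g ` A) = measure M A"
  unfolding act_image by (rule measure_act_vimage)

lemma null_setsI: "A \<in> sets borel \<Longrightarrow> measure M A = 0 \<Longrightarrow> A \<in> null_sets M"
  by (simp add: null_sets_def sets_M emeasure_eq_measure)

lemma null_sets_act_vimage: "A \<in> null_sets M \<Longrightarrow> {x. act g x \<in> A} \<in> null_sets M"
  by (rule null_setsI) (auto simp: null_sets_def sets_M emeasure_eq_measure sets_act_vimage measure_act_vimage)

text \<open>With this an exceptional null set can be made \<open>D\<close>-invariant, after which
  maps with displacements in \<open>D\<close> preserve its complement.\<close>

lemma null_sets_D_saturation:
  assumes "A \<in> null_sets M"
  shows "{x. \<exists>d\<in>D. act d x \<in> A} \<in> null_sets M"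
proof -
  have "{x. \<exists>d\<in>D. act d x \<in> A} = (\<Union>d\<in>D. {x. act d x \<in> A})" by auto
  then show ?thesis using null_sets_act_vimage[OF assms] countable_D by (auto intro: null_sets_UN')
qed

section \<open>Stabilizers: closedness, measurability and openness\<close>

definition stab :: "'x \<Rightarrow> 'g set" where "stab x = {g. act g x = x}"

lemma add_subgroup_stab: "add_subgroup (stab x)"
proof
  fix a assume "a \<in> stab x"
  then show "- a \<in> stab x" unfolding stab_def by (metis act_minus_act mem_Collect_eq)
qed (auto simp: stab_def act_add)

lemma act_eq_act_iff: "act g x = act h x \<longleftrightarrow> - g + h \<in> stab x"
proof -
  have "act g x = act h x \<longleftrightarrow> act (- g) (act g x) = act (- g) (act h x)" by (simp only: act_eq_iff)
  then show ?thesis by (auto simp: stab_def act_add)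
qed

text \<open>The fibres of the Borel orbit map at \<open>x\<close> are exactly the left cosets of the
  stabilizer.\<close>

lemma closed_stab: "closed (stab x)"
  by (rule closed_fibre_subgroup[of "\<lambda>g. act g x"])
     (auto simp: act_eq_act_iff intro: add_subgroup_stab measurable_act)

lemma closed_act_eq: "closed {g. act g x = act h x}"
proof -
  have "{g. act g x = act h x} = {g. - h + g \<in> stab x}" by (metis act_eq_act_iff)
  then show ?thesis using closed_translate_left[OF closed_stab] by simp
qed

text \<open>Openness becomes a countable condition, hence measurable in \<open>x\<close>: since the
  stabilizer is closed, a ball not contained in it contains an open set of elements moving
  \<open>x\<close>, and \<open>D\<close> meets that set.\<close>

lemma open_stab_iff: "open (stab x) \<longleftrightarrow> (\<exists>k. \<forall>d\<in>D. dist 0 d < 1 / Suc k \<longrightarrow> act d x = x)"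
proof
  assume "open (stab x)"
  moreover have "0 \<in> stab x" by (simp add: stab_def)
  ultimately obtain e where e: "0 < e" "ball 0 e \<subseteq> stab x" using open_contains_ball by blast
  then obtain k where "1 / Suc k < e" using nat_approx_posE by blast
  then have "act d x = x" if "dist 0 d < 1 / Suc k" for d using e that by (force simp: stab_def subset_iff)
  then show "\<exists>k. \<forall>d\<in>D. dist 0 d < 1 / Suc k \<longrightarrow> act d x = x" by blast
next
  assume "\<exists>k. \<forall>d\<in>D. dist 0 d < 1 / Suc k \<longrightarrow> act d x = x"
  then obtain k where k: "\<And>d. d \<in> D \<Longrightarrow> dist 0 d < 1 / Suc k \<Longrightarrow> act d x = x" by blast
  have "ball 0 (1 / Suc k) \<inter> - stab x = {}"
  proof (rule ccontr)
    assume "ball 0 (1 / Suc k) \<inter> - stab x \<noteq> {}"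
    then obtain d where "d \<in> D" "d \<in> ball 0 (1 / Suc k) \<inter> - stab x"
      using dense_D[of "ball 0 (1 / Suc k) \<inter> - stab x"] closed_stab by blast
    then show False using k[of d] by (auto simp: stab_def)
  qed
  then show "open (stab x)"
    by (intro open_subgroupI_ball[OF add_subgroup_stab, of "ball 0 (1 / Suc k)"]) auto
qed

lemma sets_open_stab: "{x. open (stab x)} \<in> sets M"
proof -
  have "{x. act d x = x} \<in> sets borel" for d
    using measurable_act[of "\<lambda>_. d" borel "\<lambda>x. x"] by measurable
  then have "{x. \<exists>k::nat. \<forall>d\<in>D. dist 0 d < 1 / Suc k \<longrightarrow> act d x = x} \<in> sets borel"
    using countable_D by measurable
  then show ?thesis by (simp only: open_stab_iff sets_M)
qed

lemma open_stab_act: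
  assumes "open (stab x)" shows "open (stab (act g x))"
proof -
  have "stab (act g x) = {h. - g + (h + g) \<in> stab x}"
    unfolding act_eq_act_iff[symmetric] by (auto simp: stab_def act_add)
  also have "\<dots> = {h. (h + g) \<in> {k. - g + k \<in> stab x}}" by simp
  finally show ?thesis
    using open_translate_right[OF open_translate_left[OF assms, of "- g"], of g] by (simp only:)
qed

lemma open_stab_invariant: "act g ` {x. open (stab x)} = {x. open (stab x)}"
  unfolding act_image by (auto dest: open_stab_act[of _ "- g"]) (metis open_stab_act act_act_minus)

text \<open>The sets in the cover are empty or closed cosets of the stabilizer. If the stabilizer is
  not open they have empty interior, and countably many of them cannot fill a nonempty open
  set.\<close>

lemma open_stabI:
  assumes Y: "countable Y" and cov: "open V" "V \<noteq> {}" "V \<subseteq> (\<Union>y\<in>Y. {g. act g x = y})"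
  shows "open (stab x)"
proof (rule ccontr)
  assume no: "\<not> open (stab x)"
  have "closed {g. act g x = y} \<and> interior {g. act g x = y} = {}" for y
  proof (cases "\<exists>h. y = act h x")
    case True
    then obtain h where h: "y = act h x" by blast
    have "{g. act g x = y} = {g. - h + g \<in> stab x}" unfolding h by (metis act_eq_act_iff)
    then show ?thesis using no open_subgroupI[OF add_subgroup_stab] closed_act_eq[of x h] h by metis
  next
    case False
    then have "{g. act g x = y} = {}" by auto
    then show ?thesis by simp
  qed
  then have "interior (\<Union>((\<lambda>y. {g. act g x = y}) ` Y)) = {}"
    using Y by (intro interior_countable_Union_closed) auto
  then show False using cov interior_maximal[OF cov(3,1)] by simp
qed

lemma open_stab_of_countable_orbit:
  assumes "countable {act g x | g. True}" shows "open (stab x)"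
  by (rule open_stabI[OF assms, of UNIV]) auto

text \<open>Having its image in a finite set is a closed condition on \<open>g\<close>; if it holds
  on the dense part \<open>D\<close> of \<open>V\<close> it holds on all of \<open>V\<close>, and
  \<open>V\<close> is covered by finitely many cosets.\<close>

lemma infinite_D_orbit:
  assumes "\<not> open (stab x)" "open V" "0 \<in> V"
  shows "infinite ((\<lambda>d. act d x) ` (D \<inter> V))"
proof
  let ?Y = "(\<lambda>d. act d x) ` (D \<inter> V)"
  assume fin: "finite ?Y"
  have "closed {g. act g x \<in> ?Y}"
  proof -
    have "{g. act g x \<in> ?Y} = (\<Union>y\<in>?Y. {g. act g x = y})" by auto
    moreover have "closed (\<Union>y\<in>?Y. {g. act g x = y})"
      using fin by (intro closed_UN) (auto intro: closed_act_eq)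
    ultimately show ?thesis by (simp only:)
  qed
  have "V \<inter> - {g. act g x \<in> ?Y} = {}"
  proof (rule ccontr)
    assume "V \<inter> - {g. act g x \<in> ?Y} \<noteq> {}"
    then obtain d where "d \<in> D" "d \<in> V \<inter> - {g. act g x \<in> ?Y}"
      using dense_D[of "V \<inter> - {g. act g x \<in> ?Y}"] \<open>closed _\<close> assms(2) by blast
    then show False by auto
  qed
  then have "V \<subseteq> (\<Union>y\<in>?Y. {g. act g x = y})" by blast
  moreover have "V \<noteq> {}" using assms(3) by blast
  ultimately have "open (stab x)" by (intro open_stabI[OF countable_finite[OF fin] assms(2)])
  then show False using assms(1) by blast
qed

lemma ergodic_dichotomy:
  assumes "ergodic_action M act"
  shows "(AE x in M. open (stab x)) \<or> (AE x in M. \<not> open (stab x))"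
proof -
  have "prob {x. open (stab x)} = 0 \<or> prob {x. open (stab x)} = 1"
    using assms sets_open_stab open_stab_invariant unfolding ergodic_action_def by blast
  then show ?thesis
  proof
    assume "prob {x. open (stab x)} = 0"
    then have "{x. open (stab x)} \<in> null_sets M"
      using sets_open_stab unfolding sets_M by (intro null_setsI)
    from AE_not_in[OF this] show ?thesis by simp
  next
    assume "prob {x. open (stab x)} = 1"
    then show ?thesis using prob_eq_1[OF sets_open_stab] by simp
  qed
qed

end

section \<open>Small involutions\<close>

lemma add_nbhds:
  fixes a b :: "'g::topological_monoid_add"
  assumes "open U" "a + b \<in> U"
  shows "\<exists>A B. open A \<and> a \<in> A \<and> open B \<and> b \<in> B \<and> (\<forall>x\<in>A. \<forall>y\<in>B. x + y \<in> U)"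
proof -
  have "open ((\<lambda>(x, y). x + y) -` U)"
    using assms(1) by (intro open_vimage) (auto simp: case_prod_unfold intro!: continuous_intros)
  moreover have "(a, b) \<in> (\<lambda>(x, y). x + y) -` U" using assms(2) by simp
  ultimately obtain A B where "open A" "open B" "(a, b) \<in> A \<times> B" "A \<times> B \<subseteq> (\<lambda>(x, y). x + y) -` U"
    by (rule open_prod_elim)
  then show ?thesis by (intro exI[of _ A] exI[of _ B]) auto
qed

lemma zero_nbhd_add:
  fixes U :: "'g::topological_monoid_add set"
  assumes "open U" "0 \<in> U"
  shows "\<exists>W. open W \<and> 0 \<in> W \<and> (\<forall>x\<in>W. \<forall>y\<in>W. x + y \<in> U)"
proof -
  obtain A B where "open A" "0 \<in> A" "open B" "0 \<in> B" "\<forall>x\<in>A. \<forall>y\<in>B. x + y \<in> U"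
    using add_nbhds[of U 0 0] assms by auto
  then show ?thesis by (intro exI[of _ "A \<inter> B"]) auto
qed

lemma open_uminus:
  fixes U :: "'g::topological_group_add set"
  assumes "open U" shows "open {x. - x \<in> U}"
  using open_vimage[OF assms, of uminus] by (simp add: vimage_def continuous_intros)

lemma zero_nbhd_minus_add:
  fixes U :: "'g::topological_group_add set"
  assumes "open U" "0 \<in> U"
  shows "\<exists>W. open W \<and> 0 \<in> W \<and> (\<forall>x\<in>W. \<forall>y\<in>W. - x + y \<in> U)"
proof -
  obtain W where W: "open W" "0 \<in> W" "\<forall>x\<in>W. \<forall>y\<in>W. x + y \<in> U" using zero_nbhd_add[OF assms] by blast
  then show ?thesis using open_uminus[OF W(1)] by (intro exI[of _ "W \<inter> {x. - x \<in> W}"]) auto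
qed

context borel_pmp_system
begin

text \<open>
  The sets \<open>act (f j) ` K j\<close> below are pairwise disjoint translates, so the measures of the \<open>K j\<close> are
  summable; by Borel--Cantelli almost every point of \<open>R\<close> then has only finitely many images under
  the small elements of \<open>D\<close>.
\<close>

lemma null_sets_of_no_return:
  assumes free: "AE x in M. \<not> open (stab x)" and R: "R \<in> sets borel" and V: "open V" "0 \<in> V"
    and nr: "\<And>x d. x \<in> R \<Longrightarrow> d \<in> D \<Longrightarrow> d \<in> V \<Longrightarrow> act d x \<in> R \<Longrightarrow> act d x = x"
  shows "R \<in> null_sets M"
proof -
  obtain W where W: "open W" "0 \<in> W" "\<And>a b. a \<in> W \<Longrightarrow> b \<in> W \<Longrightarrow> - a + b \<in> V"
    using zero_nbhd_minus_add[OF V] by blast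
  have ne: "D \<inter> W \<noteq> {}" using W(2) D.zero by blast
  have "countable (D \<inter> W)" using countable_D by blast
  then have rf: "range (from_nat_into (D \<inter> W)) = D \<inter> W" using ne by (intro range_from_nat_into)
  define f where "f = from_nat_into (D \<inter> W)"
  note rf = rf[folded f_def]
  have f: "f n \<in> D" "f n \<in> W" for n using rf by blast+
  \<comment> \<open>\<open>x\<close> lies in \<open>K j\<close> when index \<open>j\<close> gives an
    image that no smaller index gives. A point in finitely many \<open>K j\<close> thus has finitely
    many images.\<close>
  define K where "K j = {x \<in> R. \<forall>l<j. act (f l) x \<noteq> act (f j) x}" for j
  have K[measurable]: "K j \<in> sets borel" for j
    unfolding K_def using R by measurable
  have Kdisj: "act (f i) ` K i \<inter> act (f j) ` K j = {}" if "i < j" for i j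
  proof (rule ccontr)
    assume "act (f i) ` K i \<inter> act (f j) ` K j \<noteq> {}"
    then obtain x x' where x: "x \<in> K i" "x' \<in> K j" "act (f i) x = act (f j) x'" by blast
    then have "x = act (- f i + f j) x'" by (metis act_add act_minus_act)
    \<comment> \<open>The difference \<open>- f i + f j\<close> lies in \<open>V\<close> and returns
      \<open>x'\<close> to \<open>R\<close>, so it fixes \<open>x'\<close>; then \<open>f i\<close>
      already gives the image that was to be new at \<open>j\<close>.\<close>
    moreover have "act (- f i + f j) x' = x'"
      using nr[of x' "- f i + f j"] x f W(3) D.add D.minus calculation by (auto simp: K_def)
    ultimately have "x = x'" by simp
    then show False using x that by (auto simp: K_def)
  qed
  then have "disjoint_family (\<lambda>j. act (f j) ` K j)"
    unfolding disjoint_family_on_def by (metis inf_commute nat_neq_iff)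
  moreover have "range (\<lambda>j. act (f j) ` K j) \<subseteq> sets M" by (auto simp: sets_M intro: sets_act_image)
  ultimately have "(\<lambda>j. prob (act (f j) ` K j)) sums prob (\<Union>j. act (f j) ` K j)"
    by (intro finite_measure_UNION)
  then have "summable (\<lambda>j. prob (K j))" by (auto simp: sums_iff measure_act_image)
  then have "AE x in M. \<forall>\<^sub>F j in sequentially. x \<in> space M - K j"
    by (intro borel_cantelli_AE1) (auto simp: sets_M emeasure_eq_measure)
  with free have "AE x in M. x \<notin> R"
  proof eventually_elim
    case (elim x)
    show ?case
    proof
      assume xR: "x \<in> R"
      obtain N where N: "\<And>j. j \<ge> N \<Longrightarrow> x \<notin> K j" using elim(2) by (auto simp: eventually_sequentially)
      have "act (f n) x \<in> (\<lambda>j. act (f j) x) ` {..<N}" for n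
      proof -
        define l where "l = (LEAST l. act (f l) x = act (f n) x)"
        have l: "act (f l) x = act (f n) x" unfolding l_def by (rule LeastI) simp
        have "x \<in> K l" unfolding K_def using xR not_less_Least[of _ "\<lambda>l. act (f l) x = act (f n) x"] l
          by (auto simp: l_def[symmetric])
        then have "l < N" using N by (meson not_le)
        then show ?thesis using l by (metis imageI lessThan_iff)
      qed
      then have "(\<lambda>d. act d x) ` (D \<inter> W) \<subseteq> (\<lambda>j. act (f j) x) ` {..<N}"
        unfolding rf[symmetric] by blast
      then have "finite ((\<lambda>d. act d x) ` (D \<inter> W))" by (rule finite_subset) simp
      then show False using infinite_D_orbit[OF elim(1) W(1,2)] by blast
    qed
  qed
  then show ?thesis using R by (simp add: AE_iff_null_sets sets_M)
qed

text \<open>On each of the countably many pieces where \<open>v\<close> is constant the map is a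
  single group element, which preserves Borel sets and measure; injectivity keeps the images of the
  pieces disjoint.\<close>

lemma countable_valued_image:
  assumes v: "v \<in> borel_measurable borel" "\<And>x. v x \<in> D"
    and A: "A \<in> sets borel" and inj: "inj_on (\<lambda>x. act (v x) x) A"
  shows "(\<lambda>x. act (v x) x) ` A \<in> sets borel" (is "?W ` A \<in> _")
    and "emeasure M ((\<lambda>x. act (v x) x) ` A) = emeasure M A"
proof -
  define P where "P d = A \<inter> {x. v x = d}" for d
  have P: "P d \<in> sets borel" for d
    unfolding P_def using A v(1) by measurable
  have AU: "A = (\<Union>d\<in>D. P d)" unfolding P_def using v(2) by auto
  have WU: "?W ` A = (\<Union>d\<in>D. act d ` P d)" unfolding P_def using v(2) by force
  show "?W ` A \<in> sets borel"
    unfolding WU by (intro sets.countable_UN'' countable_D sets_act_image P)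
  have "disjoint_family_on P D" unfolding disjoint_family_on_def P_def by auto
  then have 1: "emeasure M A = (\<integral>\<^sup>+d. emeasure M (P d) \<partial>count_space D)"
    unfolding AU by (intro emeasure_UN_countable) (use countable_D P in \<open>auto simp: sets_M\<close>)
  have "disjoint_family_on (\<lambda>d. act d ` P d) D"
    unfolding disjoint_family_on_def
  proof (intro ballI impI)
    fix d e :: 'g assume "d \<noteq> e"
    show "act d ` P d \<inter> act e ` P e = {}"
    proof (rule ccontr)
      assume "act d ` P d \<inter> act e ` P e \<noteq> {}"
      then obtain x y where xy: "x \<in> P d" "y \<in> P e" "act d x = act e y" by blast
      then have "x \<in> A" "y \<in> A" "?W x = ?W y" by (auto simp: P_def)
      then have "x = y" using inj by (auto dest: inj_onD)
      then show False using xy \<open>d \<noteq> e\<close> by (auto simp: P_def)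
    qed
  qed
  then have "emeasure M (?W ` A) = (\<integral>\<^sup>+d. emeasure M (act d ` P d) \<partial>count_space D)"
    unfolding WU by (intro emeasure_UN_countable) (use countable_D P in \<open>auto simp: sets_M sets_act_image\<close>)
  also have "\<dots> = (\<integral>\<^sup>+d. emeasure M (P d) \<partial>count_space D)"
    using P by (simp add: emeasure_eq_measure measure_act_image)
  finally show "emeasure M (?W ` A) = emeasure M A" using 1 by simp
qed

lemma pmp_bijI:
  assumes v: "v \<in> borel_measurable borel" "\<And>x. v x \<in> D" and bij: "bij (\<lambda>x. act (v x) x)"
  shows "pmp_bij M (\<lambda>x. act (v x) x)" (is "pmp_bij M ?W")
  unfolding pmp_bij_def
proof (intro conjI)
  have W: "?W \<in> borel_measurable borel" using v(1) by measurable
  have inj: "inj_on ?W A" for A using bij by (meson bij_is_inj inj_on_subset subset_UNIV)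
  show "bij ?W" by fact
  show "?W \<in> borel_measurable borel" by fact
  show "inv_into UNIV ?W \<in> borel_measurable borel"
  proof (rule measurableI)
    fix A :: "'x set" assume A: "A \<in> sets borel"
    have "inv_into UNIV ?W -` A \<inter> space borel = ?W ` A"
    proof (rule Set.set_eqI)
      fix y
      obtain x where y: "y = ?W x" using bij by (auto simp: bij_def surj_def)
      have "inv_into UNIV ?W y = x" unfolding y using bij by (intro inv_f_f) (rule bij_is_inj)
      then show "y \<in> inv_into UNIV ?W -` A \<inter> space borel \<longleftrightarrow> y \<in> ?W ` A"
        using inj_image_mem_iff[OF bij_is_inj[OF bij], of x A] by (simp add: y)
    qed
    then show "inv_into UNIV ?W -` A \<inter> space borel \<in> sets borel"
      using countable_valued_image(1)[OF v A inj] by simp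
  qed simp
  show "distr M M ?W = M"
  proof (rule measure_eqI)
    fix A assume "A \<in> sets (distr M M ?W)"
    then have A: "A \<in> sets borel" by (simp add: sets_M)
    have WA: "?W -` A \<in> sets borel" using measurable_sets[OF W A] by simp
    have WM: "?W \<in> measurable M M" using W by (simp add: measurable_M sets_M cong: measurable_cong_sets)
    have "emeasure (distr M M ?W) A = emeasure M (?W -` A)"
      using emeasure_distr[OF WM, of A] A by (simp add: sets_M space_M)
    also have "\<dots> = emeasure M (?W ` (?W -` A))" using countable_valued_image(2)[OF v WA inj] by simp
    also have "?W ` (?W -` A) = A" using bij by (simp add: bij_def surj_image_vimage_eq)
    finally show "emeasure (distr M M ?W) A = emeasure M A" .
  qed simp
qed

text \<open>A measure-preserving injection of a conull set has conull image. Deleting all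
  \<open>D\<close>-orbits that meet the null set or miss the image leaves an invariant set on which
  the map is bijective; elsewhere it is replaced by the identity.\<close>

lemma pmp_bij_completion:
  assumes u: "u \<in> borel_measurable borel" "\<And>x. u x \<in> D" and N: "N \<in> null_sets M"
    and inj: "inj_on (\<lambda>x. act (u x) x) (- N)"
  shows "\<exists>Y v. - Y \<in> null_sets M \<and> Y \<inter> N = {} \<and> (\<forall>x\<in>Y. \<forall>d\<in>D. act d x \<in> Y) \<and>
    v \<in> borel_measurable borel \<and> (\<forall>x. v x \<in> D) \<and> (\<forall>x\<in>Y. v x = u x) \<and> (\<forall>x. x \<notin> Y \<longrightarrow> v x = 0) \<and>
    pmp_bij M (\<lambda>x. act (v x) x)"
proof -
  let ?W = "\<lambda>x. act (u x) x"
  have Nb: "N \<in> sets borel" using N by (auto simp: null_sets_def sets_M)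
  then have cNb: "- N \<in> sets borel" using sets.compl_sets[of N borel] by (simp add: Compl_eq_Diff_UNIV)
  define I where "I = ?W ` (- N)"
  have I: "I \<in> sets borel" "emeasure M I = emeasure M (- N)"
    unfolding I_def using countable_valued_image[OF u cNb inj] by auto
  have "prob (- N) = 1" using prob_compl[of N] N by (simp add: null_sets_def space_M Compl_eq_Diff_UNIV measure_def)
  then have "prob I = 1" using I(2) by (simp add: measure_def)
  then have "prob (- I) = 0" using prob_compl[of I] I(1) by (simp add: sets_M space_M Compl_eq_Diff_UNIV)
  moreover have "- I \<in> sets borel" using I(1) sets.compl_sets[of I borel] by (simp add: Compl_eq_Diff_UNIV)
  ultimately have "- I \<in> null_sets M" by (intro null_setsI)
  then have NI: "N \<union> - I \<in> null_sets M" using N by (rule null_sets.Un[rotated])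
  \<comment> \<open>The whole \<open>D\<close>-orbit is constrained, so that the preimage of a point
    of \<open>Y\<close>, reached by an element of \<open>D\<close>, is again in
    \<open>Y\<close>.\<close>
  define Y where "Y = {x. \<forall>d\<in>D. act d x \<notin> N \<union> - I}"
  have cY: "- Y \<in> null_sets M"
  proof -
    have "- Y = {x. \<exists>d\<in>D. act d x \<in> N \<union> - I}" unfolding Y_def by auto
    then show ?thesis using null_sets_D_saturation[OF NI] by simp
  qed
  have Yinv: "act d x \<in> Y" if "x \<in> Y" "d \<in> D" for x d
    using that D.add unfolding Y_def by (auto simp flip: act_add)
  have YN: "x \<notin> N \<and> x \<in> I" if "x \<in> Y" for x
    using that D.zero unfolding Y_def by force
  define v where "v x = (if x \<in> Y then u x else 0)" for x
  have "- Y \<in> sets borel" using cY by (auto simp: null_sets_def sets_M)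
  then have "Y \<in> sets borel" using sets.compl_sets[of "- Y" borel] by (simp add: Compl_eq_Diff_UNIV[symmetric])
  then have v: "v \<in> borel_measurable borel" unfolding v_def using u(1) by measurable
  have vD: "v x \<in> D" for x unfolding v_def using u(2) D.zero by auto
  let ?U = "\<lambda>x. act (v x) x"
  have UY: "?U x \<in> Y \<longleftrightarrow> x \<in> Y" for x using Yinv[OF _ u(2)] by (cases "x \<in> Y") (auto simp: v_def)
  have "inj ?U"
  proof (rule injI)
    fix x y assume eq: "?U x = ?U y"
    show "x = y"
    proof (cases "x \<in> Y")
      case True
      then have y: "y \<in> Y" using eq UY by metis
      then show ?thesis using eq True YN inj_onD[OF inj, of x y] by (auto simp: v_def)
    next
      case False
      then have "y \<notin> Y" using eq UY by metis
      then show ?thesis using eq False by (simp add: v_def)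
    qed
  qed
  moreover have "\<exists>x. y = ?U x" for y
  proof (cases "y \<in> Y")
    case True
    then obtain x where x: "x \<notin> N" "y = ?W x" using YN unfolding I_def by blast
    then have "x = act (- u x) y" by simp
    then have "x \<in> Y" using Yinv[OF True D.minus[OF u(2)]] by metis
    then show ?thesis using x by (auto simp: v_def)
  next
    case False
    then show ?thesis by (intro exI[of _ y]) (simp add: v_def)
  qed
  ultimately have "bij ?U" unfolding bij_def surj_def by blast
  then have "pmp_bij M ?U" by (rule pmp_bijI[OF v vD])
  then show ?thesis
    using cY YN Yinv v vD by (intro exI[of _ Y] exI[of _ v]) (auto simp: v_def)
qed

text \<open>
  The involution is built greedily over all pairs of an element of \<open>D\<close> and a basic open set; the basic
  open set separates a point from its image, which makes the two halves disjoint.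
\<close>

lemma small_involution:
  assumes free: "AE x in M. \<not> open (stab x)" and A: "A \<in> sets borel"
    and c: "c \<in> measurable borel (count_space (UNIV :: nat set))" and V: "\<And>i. open (V i)" "\<And>i. 0 \<in> V i"
  shows "\<exists>s B. s \<in> borel_measurable borel \<and> (\<forall>x. s x \<in> D \<and> s x \<in> V (c x)) \<and>
    (\<forall>x. act (s (act (s x) x)) (act (s x) x) = x) \<and>
    (\<forall>x. x \<notin> A \<longrightarrow> s x = 0) \<and> (\<forall>x\<in>A. act (s x) x \<in> A) \<and> (\<forall>x. c (act (s x) x) = c x) \<and>
    B \<in> sets borel \<and> B \<subseteq> A \<and> (\<forall>x\<in>B. act (s x) x \<notin> B) \<and> {x \<in> A. x \<notin> B \<and> act (s x) x \<notin> B} \<in> null_sets M"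
proof -
  \<comment> \<open>One half of a matched pair moves by \<open>d n\<close>, the other by
    \<open>- d n\<close>, so the neighbourhoods are made symmetric.\<close>
  define V' where "V' i = V i \<inter> {x. - x \<in> V i}" for i
  have V': "open (V' i)" "0 \<in> V' i" for i unfolding V'_def using V open_uminus[OF V(1)] by auto
  obtain \<B> :: "'x set set" where \<B>: "countable \<B>" "topological_basis \<B>"
    using ex_countable_basis by blast
  have "\<B> \<noteq> {}" using topological_basisE[OF \<B>(2) open_UNIV, of undefined] by blast
  then have ne: "D \<times> \<B> \<noteq> {}" using D.zero by blast
  have "countable (D \<times> \<B>)" using countable_D \<B>(1) by (rule countable_SIGMA)
  then have re: "range (from_nat_into (D \<times> \<B>)) = D \<times> \<B>" by (intro range_from_nat_into ne)
  define d where "d n = fst (from_nat_into (D \<times> \<B>) n)" for n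
  define Q where "Q n = snd (from_nat_into (D \<times> \<B>) n)" for n
  have dQ: "(d n, Q n) \<in> D \<times> \<B>" for n unfolding d_def Q_def using re by (metis prod.collapse rangeI)
  have dQ_ex: "\<exists>n. d n = e \<and> Q n = U" if "e \<in> D" "U \<in> \<B>" for e U
  proof -
    have "(e, U) \<in> range (from_nat_into (D \<times> \<B>))" unfolding re using that by blast
    then obtain n where "from_nat_into (D \<times> \<B>) n = (e, U)" by (metis rangeE)
    then show ?thesis unfolding d_def Q_def by (intro exI[of _ n]) simp
  qed
  have oQ[measurable]: "Q n \<in> sets borel" for n
    using dQ[of n] topological_basis_open[OF \<B>(2)] by auto
  \<comment> \<open>\<open>R\<close> holds the points not matched so far. Partners must share their
    colour: then the involution preserves \<open>c\<close>, and one neighbourhood bounds both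
    displacements.\<close>
  define step where "step n R = {x \<in> R. act (d n) x \<in> R \<and> x \<in> Q n \<and> act (d n) x \<notin> Q n \<and>
      c (act (d n) x) = c x \<and> d n \<in> V' (c x)}" for n R
  define R where "R = rec_nat A (\<lambda>n R. {x \<in> R. x \<notin> step n R \<and> act (- d n) x \<notin> step n R})"
  define F where "F n = step n (R n)" for n
  define G where "G n = {x. act (- d n) x \<in> F n}" for n
  have R0: "R 0 = A" and RS: "R (Suc n) = {x \<in> R n. x \<notin> F n \<and> x \<notin> G n}" for n
    by (simp_all add: R_def F_def G_def)
  have FD: "x \<in> F n \<longleftrightarrow> x \<in> R n \<and> act (d n) x \<in> R n \<and> x \<in> Q n \<and> act (d n) x \<notin> Q n \<and>
      c (act (d n) x) = c x \<and> d n \<in> V' (c x)" for x n unfolding F_def step_def by auto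
  have cm: "{x. c (act g x) = c x \<and> g \<in> V' (c x)} \<in> sets borel" for g
  proof -
    note [measurable] = c
    have "(\<lambda>x. c (act g x)) \<in> measurable borel (count_space UNIV)"
      by (rule measurable_compose[OF _ c]) measurable
    note [measurable] = this
    have "{x. c (act g x) = c x \<and> g \<in> V' (c x)} = (\<Union>i\<in>{i. g \<in> V' i}. {x \<in> space borel. c x = i \<and> c (act g x) = i})"
      by auto
    also have "\<dots> \<in> sets borel" by measurable
    finally show ?thesis .
  qed
  have step_m: "step n X \<in> sets borel" if X: "X \<in> sets borel" for n X
  proof -
    have "step n X = X \<inter> {x. act (d n) x \<in> X} \<inter> Q n \<inter> {x. act (d n) x \<in> - Q n}
        \<inter> {x. c (act (d n) x) = c x \<and> d n \<in> V' (c x)}" unfolding step_def by auto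
    then show ?thesis using X cm sets_act_vimage oQ
      by (auto intro!: sets.Int simp del: Compl_iff simp: Compl_eq_Diff_UNIV)
  qed
  have Rm: "R n \<in> sets borel" for n
  proof (induction n)
    case (Suc n)
    have "R (Suc n) = R n - F n - G n" unfolding RS by auto
    then show ?case using Suc step_m[OF Suc, of n] sets_act_vimage[of "F n"] unfolding G_def F_def by auto
  qed (simp add: R0 A)
  have Fm[measurable]: "F n \<in> sets borel" for n unfolding F_def by (intro step_m Rm)
  have Gm[measurable]: "G n \<in> sets borel" for n unfolding G_def by (intro sets_act_vimage Fm)
  have GD: "act (d n) x \<in> G n" if "x \<in> F n" for x n using that by (simp add: G_def)
  have GR: "x \<in> R n" "x \<notin> F n" if "x \<in> G n" for x n
    using that FD[of "act (- d n) x" n] FD[of x n] unfolding G_def by auto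
  have Rmono: "R m \<subseteq> R n" if "n \<le> m" for n m
    using that by (induction m rule: dec_induct) (auto simp: RS)
  have RA: "R n \<subseteq> A" for n using Rmono[of 0 n] R0 by simp
  have later: "x \<notin> F n \<and> x \<notin> G n" if "x \<in> R m" "n < m" for x n m
    using Rmono[of "Suc n" m] that RS by (auto simp: Suc_le_eq)
  have FGR: "x \<in> R n" if "x \<in> F n \<or> x \<in> G n" for x n using that GR FD by blast
  have uniq: "n = m" if "x \<in> F n \<or> x \<in> G n" "x \<in> F m \<or> x \<in> G m" for x n m
    using that later FGR by (metis nat_neq_iff)
  \<comment> \<open>By \<open>uniq\<close> a point is matched at one stage at most, so
    \<open>LEAST\<close> just names that stage.\<close>
  define s where "s x = (if \<exists>n. x \<in> F n then d (LEAST n. x \<in> F n)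
      else if \<exists>n. x \<in> G n then - d (LEAST n. x \<in> G n) else 0)" for x
  have sF: "s x = d n" if "x \<in> F n" for x n
  proof -
    have "(LEAST n. x \<in> F n) = n" using that uniq by (intro Least_equality) (auto intro: eq_refl)
    then show ?thesis using that unfolding s_def by auto
  qed
  have sG: "s x = - d n" if "x \<in> G n" for x n
  proof -
    have "x \<notin> F m" for m using uniq[of x n m] that GR by blast
    moreover have "(LEAST n. x \<in> G n) = n" using that uniq by (intro Least_equality) (auto intro: eq_refl)
    ultimately show ?thesis using that unfolding s_def by auto
  qed
  have s0: "s x = 0" if "\<And>n. x \<notin> F n" "\<And>n. x \<notin> G n" for x using that unfolding s_def by auto
  have sm: "s \<in> borel_measurable borel"
  proof -
    have "(\<lambda>x. LEAST n. x \<in> F n) \<in> measurable borel (count_space UNIV)"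
      "(\<lambda>x. LEAST n. x \<in> G n) \<in> measurable borel (count_space UNIV)" by measurable
    then have [measurable]: "(\<lambda>x. d (LEAST n. x \<in> F n)) \<in> borel_measurable borel"
      "(\<lambda>x. - d (LEAST n. x \<in> G n)) \<in> borel_measurable borel"
      using measurable_compose[of _ borel "count_space UNIV" d borel]
        measurable_compose[of _ borel "count_space UNIV" "\<lambda>n. - d n" borel] by auto
    show ?thesis unfolding s_def by measurable
  qed
  have cases: "thesis" if "\<And>n. x \<in> F n \<Longrightarrow> thesis" "\<And>n. x \<in> G n \<Longrightarrow> thesis"
      "(\<And>n. x \<notin> F n) \<Longrightarrow> (\<And>n. x \<notin> G n) \<Longrightarrow> thesis" for x thesis using that by blast
  have props: "s x \<in> D \<and> s x \<in> V (c x) \<and> act (s (act (s x) x)) (act (s x) x) = x \<and>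
      (x \<notin> A \<longrightarrow> s x = 0) \<and> (x \<in> A \<longrightarrow> act (s x) x \<in> A) \<and> c (act (s x) x) = c x" for x
  proof (rule cases[of x])
    fix n assume F: "x \<in> F n"
    note f = F[unfolded FD]
    have s1: "s x = d n" by (rule sF) fact
    have s2: "s (act (d n) x) = - d n" by (rule sG) (rule GD, fact)
    have "x \<in> A" "act (d n) x \<in> A" using f RA by auto
    then show ?thesis using s1 s2 f dQ[of n] by (auto simp: V'_def)
  next
    fix n assume G: "x \<in> G n"
    have s1: "s x = - d n" by (rule sG) fact
    let ?y = "act (- d n) x"
    have y: "?y \<in> F n" using G by (simp add: G_def)
    have s2: "s ?y = d n" by (rule sF) fact
    note f = y[unfolded FD act_act_minus]
    have "x \<in> A" "?y \<in> A" using f RA by auto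
    then show ?thesis using s1 s2 f dQ[of n] D.minus by (auto simp: V'_def)
  next
    assume "\<And>n. x \<notin> F n" "\<And>n. x \<notin> G n"
    then have "s x = 0" by (rule s0)
    then show ?thesis using V D.zero by simp
  qed
  define B where "B = (\<Union>n. F n)"
  have Bm: "B \<in> sets borel" unfolding B_def by auto
  have BA: "B \<subseteq> A" unfolding B_def using FD RA by blast
  have Bs: "act (s x) x \<notin> B" if xB: "x \<in> B" for x
  proof -
    obtain n where n: "x \<in> F n" using xB unfolding B_def by blast
    then have "act (s x) x \<in> G n" using sF GD by simp
    then show ?thesis unfolding B_def using uniq[of "act (s x) x" n] GR by blast
  qed
  define Z where "Z = {x \<in> A. \<forall>n. x \<notin> F n \<and> x \<notin> G n}"
  have ZR: "x \<in> R n" if "x \<in> Z" for x n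
    using that by (induction n) (auto simp: R0 RS Z_def)
  have "Z = A - (\<Union>n. F n \<union> G n)" unfolding Z_def by auto
  then have Zm: "Z \<in> sets borel" using A by auto
  \<comment> \<open>If a small \<open>e\<close> moved an unmatched point to an unmatched point of
    the same colour, the pair would have been matched at the stage of \<open>e\<close> and a basic
    set separating them. Hence each colour class of \<open>Z\<close> has no returns.\<close>
  have "Z \<inter> c -` {i} \<in> null_sets M" for i
  proof (rule null_sets_of_no_return[OF free _ V'])
    show "Z \<inter> c -` {i} \<in> sets borel" using Zm measurable_sets[OF c, of "{i}"] by auto
    fix x e assume x: "x \<in> Z \<inter> c -` {i}" and e: "e \<in> D" "e \<in> V' i" and ex: "act e x \<in> Z \<inter> c -` {i}"
    show "act e x = x"
    proof (rule ccontr)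
      assume "act e x \<noteq> x"
      then obtain S where S: "open S" "x \<in> S" "act e x \<notin> S" by (metis separation_t1)
      then obtain U where U: "U \<in> \<B>" "x \<in> U" "act e x \<notin> U"
        using topological_basisE[OF \<B>(2) S(1,2)] by blast
      obtain n where n: "d n = e" "Q n = U" using dQ_ex e(1) U(1) by blast
      have "x \<in> F n" unfolding FD using x ex e U n ZR by auto
      then show False using x by (auto simp: Z_def)
    qed
  qed
  then have "(\<Union>i. Z \<inter> c -` {i}) \<in> null_sets M" by (intro null_sets_UN)
  moreover have "(\<Union>i. Z \<inter> c -` {i}) = Z" by auto
  ultimately have Zn: "Z \<in> null_sets M" by simp
  have eqZ: "{x \<in> A. x \<notin> B \<and> act (s x) x \<notin> B} \<subseteq> Z"
  proof
    fix x assume x: "x \<in> {x \<in> A. x \<notin> B \<and> act (s x) x \<notin> B}"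
    have "x \<notin> G n" for n
    proof
      assume "x \<in> G n"
      then have "act (s x) x \<in> F n" using sG[of x n] by (simp add: G_def)
      then show False using x by (auto simp: B_def)
    qed
    then show "x \<in> Z" using x by (auto simp: Z_def B_def)
  qed
  have "(\<lambda>x. act (s x) x) \<in> borel_measurable borel" using sm by measurable
  then have "{x \<in> A. x \<notin> B \<and> act (s x) x \<notin> B} \<in> sets borel"
    using A Bm by measurable
  then have "{x \<in> A. x \<notin> B \<and> act (s x) x \<notin> B} \<in> null_sets M"
    using null_sets_subset[OF Zn _ eqZ] by (simp add: sets_M)
  then show ?thesis using props sm Bm BA Bs by (intro exI[of _ s] exI[of _ B]) blast
qed

end

section \<open>The dyadic odometer\<close>

text \<open>
  The dyadic odometer on \<open>A 0\<close>: each \<open>S n\<close> is an involution of \<open>A n\<close> exchanging \<open>A (Suc n)\<close> with its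
  complement in \<open>A n\<close>, and \<open>odo n\<close> is the infinite product \<open>S n \<circ> S (Suc n) \<circ> \<dots>\<close>. On \<open>A (Suc n)\<close> the square of
  \<open>odo n\<close> is \<open>odo (Suc n)\<close>, so the period of a point would be divisible by every power of two.
\<close>

locale odometer =
  fixes A :: "nat \<Rightarrow> 'a set" and S :: "nat \<Rightarrow> 'a \<Rightarrow> 'a" and Y :: "'a set"
  assumes A_Suc: "A (Suc n) \<subseteq> A n"
    and S_S: "S n (S n x) = x"
    and S_outside: "x \<notin> A n \<Longrightarrow> S n x = x"
    and S_inside: "x \<in> A n \<Longrightarrow> S n x \<in> A n"
    and S_moves: "x \<in> A (Suc n) \<Longrightarrow> S n x \<notin> A (Suc n)"
    and S_Y: "x \<in> Y \<Longrightarrow> S n x \<in> Y"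
    and S_covers: "x \<in> Y \<Longrightarrow> x \<in> A n \<Longrightarrow> x \<notin> A (Suc n) \<Longrightarrow> S n x \<in> A (Suc n)"
    and A_vanishes: "x \<in> Y \<Longrightarrow> \<exists>n. x \<notin> A n"
begin

primrec comps :: "nat \<Rightarrow> nat \<Rightarrow> 'a \<Rightarrow> 'a" where
  "comps n 0 x = x"
| "comps n (Suc k) x = comps n k (S (n + k) x)"

text \<open>The factor with the largest index acts first, and once \<open>x\<close> has left the
  sets \<open>A\<close> all later factors fix it, so finitely many factors suffice. If
  \<open>x\<close> never leaves, the number of factors is unspecified, but the value is still one of
  the finite products.\<close>

definition odo :: "nat \<Rightarrow> 'a \<Rightarrow> 'a" where
  "odo n x = comps n (LEAST k. x \<notin> A (n + k)) x"

lemma A_mono: "n \<le> m \<Longrightarrow> A m \<subseteq> A n"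
  by (induction m rule: dec_induct) (use A_Suc in auto)

lemma comps_Suc_left: "comps n (Suc k) x = S n (comps (Suc n) k x)"
  by (induction k arbitrary: x) auto

lemma comps_stable:
  assumes "x \<notin> A (n + k)" "k \<le> l" shows "comps n l x = comps n k x"
  using assms(2)
proof (induction l rule: dec_induct)
  case (step l)
  have "x \<notin> A (n + l)" using assms(1) A_mono[of "n + k" "n + l"] step.hyps by auto
  then show ?case using step.IH by (simp add: S_outside)
qed simp

lemma odo_eq:
  assumes "x \<notin> A (n + k)" shows "odo n x = comps n k x"
proof -
  let ?l = "LEAST k. x \<notin> A (n + k)"
  have "x \<notin> A (n + ?l)" using assms by (rule LeastI)
  moreover have "?l \<le> k" using assms by (rule Least_le)
  ultimately show ?thesis unfolding odo_def by (rule comps_stable[symmetric])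
qed

lemma odo_outside: "x \<notin> A n \<Longrightarrow> odo n x = x"
  using odo_eq[of x n 0] by simp

lemma eventually_outside: "x \<in> Y \<Longrightarrow> \<exists>k0. \<forall>k\<ge>k0. x \<notin> A (n + k)"
proof -
  assume "x \<in> Y"
  then obtain m where m: "x \<notin> A m" using A_vanishes by blast
  have "x \<notin> A (n + k)" if "k \<ge> m" for k using m A_mono[of m "n + k"] that by auto
  then show ?thesis by blast
qed

lemma odo_unfold: assumes "x \<in> Y" shows "odo n x = S n (odo (Suc n) x)"
proof -
  obtain k where "x \<notin> A (n + Suc k)" using eventually_outside[OF assms, of n] by (metis le_Suc_eq le_refl)
  then show ?thesis using odo_eq[of x n "Suc k"] odo_eq[of x "Suc n" k] comps_Suc_left[of n k x] by simp
qed

lemma comps_Y: "x \<in> Y \<Longrightarrow> comps n k x \<in> Y"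
  by (induction k arbitrary: x) (auto simp: S_Y)

lemma odo_Y: "x \<in> Y \<Longrightarrow> odo n x \<in> Y"
  unfolding odo_def by (rule comps_Y)

lemma S_inside_le: "n \<le> m \<Longrightarrow> x \<in> A n \<Longrightarrow> S m x \<in> A n"
  using S_inside[of x m] S_outside[of x m] A_mono[of n m] by (cases "x \<in> A m") auto

lemma comps_inside: "x \<in> A n \<Longrightarrow> comps n k x \<in> A n"
  by (induction k arbitrary: x) (auto simp: S_inside_le)

lemma odo_inside: "x \<in> A n \<Longrightarrow> odo n x \<in> A n"
  unfolding odo_def by (rule comps_inside)

lemma inj_comps: "comps n k x = comps n k y \<Longrightarrow> x = y"
proof (induction k arbitrary: x y)
  case (Suc k)
  then have "S (n + k) x = S (n + k) y" by simp
  then show ?case by (metis S_S)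
qed simp

text \<open>Two points of \<open>Y\<close> are governed by one common, long enough finite product of
  involutions.\<close>

lemma inj_on_odo: "inj_on (odo n) Y"
proof (rule inj_onI)
  fix x y assume xy: "x \<in> Y" "y \<in> Y" "odo n x = odo n y"
  obtain k0 where k0: "\<forall>k\<ge>k0. x \<notin> A (n + k)" using eventually_outside[OF xy(1)] by blast
  obtain k1 where k1: "\<forall>k\<ge>k1. y \<notin> A (n + k)" using eventually_outside[OF xy(2)] by blast
  have "comps n (max k0 k1) x = comps n (max k0 k1) y"
    using xy(3) odo_eq[of x n "max k0 k1"] odo_eq[of y n "max k0 k1"] k0 k1 by simp
  then show "x = y" by (rule inj_comps)
qed

lemma odo_leaves:
  assumes "x \<in> Y" "x \<in> A (Suc n)"
  shows "odo n x \<notin> A (Suc n)" "odo n (odo n x) = odo (Suc n) x"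
proof -
  let ?y = "odo (Suc n) x"
  have y: "?y \<in> Y" "?y \<in> A (Suc n)" using assms odo_Y odo_inside by auto
  have e: "odo n x = S n ?y" by (rule odo_unfold[OF assms(1)])
  show out: "odo n x \<notin> A (Suc n)" unfolding e using y by (intro S_moves)
  have "odo n (odo n x) = S n (odo (Suc n) (odo n x))" by (intro odo_unfold odo_Y assms)
  also have "odo (Suc n) (odo n x) = odo n x" by (rule odo_outside[OF out])
  finally show "odo n (odo n x) = odo (Suc n) x" unfolding e by (simp add: S_S)
qed

lemma odo_returns:
  assumes "x \<in> Y" "x \<in> A n" "x \<notin> A (Suc n)"
  shows "odo n x \<in> A (Suc n)"
proof -
  have "odo n x = S n x" using odo_unfold[OF assms(1), of n] odo_outside[OF assms(3)] by (simp only:)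
  then show ?thesis using S_covers assms by simp
qed

text \<open>Starting in \<open>A (Suc n)\<close>, odd times are spent outside it, so a period is
  even, and its half is a period of \<open>odo (Suc n)\<close>; this drives the induction on
  \<open>k\<close>.\<close>

lemma odo_period:
  assumes "x \<in> Y" "x \<in> A n" "(odo n ^^ p) x = x"
  shows "2 ^ k dvd p"
  using assms
proof (induction k arbitrary: n x p)
  case (Suc k)
  have main: "2 ^ Suc k dvd p" if z: "z \<in> Y" "z \<in> A (Suc n)" "(odo n ^^ p) z = z" for z
  proof -
    have orb: "(odo n ^^ (2 * q)) z = (odo (Suc n) ^^ q) z \<and> (odo (Suc n) ^^ q) z \<in> Y \<inter> A (Suc n)" for q
    proof (induction q)
      case (Suc q)
      then show ?case using odo_leaves(2) odo_Y odo_inside by auto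
    qed (use z in simp)
    have "even p"
    proof (rule ccontr)
      assume "odd p"
      then obtain q where "p = Suc (2 * q)" by (auto elim: oddE)
      then have "z = odo n ((odo (Suc n) ^^ q) z)" using z(3) orb[of q] by simp
      then show False using odo_leaves(1)[of "(odo (Suc n) ^^ q) z" n] orb[of q] z(2) by auto
    qed
    then obtain q where q: "p = 2 * q" by blast
    then have "2 ^ k dvd q" using Suc.IH[of z "Suc n" q] z orb[of q] by auto
    then show ?thesis using q by simp
  qed
  show ?case
  proof (cases "x \<in> A (Suc n)")
    case True then show ?thesis using main Suc.prems by blast
  next
    case False
    \<comment> \<open>Outside \<open>A (Suc n)\<close> a single step leads into it without changing
      the period.\<close>
    have "(odo n ^^ p) (odo n x) = odo n ((odo n ^^ p) x)" by (simp add: funpow_swap1)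
    then show ?thesis using main[of "odo n x"] odo_returns[OF Suc.prems(1,2) False] odo_Y Suc.prems by simp
  qed
qed simp

lemma odo_aperiodic:
  assumes "x \<in> Y" "x \<in> A n" "p > 0"
  shows "(odo n ^^ p) x \<noteq> x"
proof
  assume "(odo n ^^ p) x = x"
  then have "2 ^ p dvd p" using odo_period assms by blast
  then have "2 ^ p \<le> p" using assms(3) by (intro dvd_imp_le)
  then show False using less_exp[of p] by simp
qed

end

context borel_pmp_system
begin

text \<open>The colour lets the allowed displacement vary over the space; later it records the cell
  of the group in which a given lift takes its value.\<close>

lemma small_aperiodic:
  assumes free: "AE x in M. \<not> open (stab x)" and A: "A \<in> sets borel"
    and c: "c \<in> measurable borel (count_space (UNIV :: nat set))" and V: "\<And>i. open (V i)" "\<And>i. 0 \<in> V i"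
  shows "\<exists>v. v \<in> borel_measurable borel \<and> pmp_bij M (\<lambda>x. act (v x) x) \<and> (\<forall>x. x \<notin> A \<longrightarrow> v x = 0) \<and>
    (\<forall>x\<in>A. act (v x) x \<in> A) \<and> (\<forall>x. c (act (v x) x) = c x \<and> v x \<in> V (c x)) \<and>
    (AE x in M. x \<in> A \<longrightarrow> (\<forall>p>0. ((\<lambda>x. act (v x) x) ^^ p) x \<noteq> x))"
proof -
  \<comment> \<open>Each neighbourhood contains the sums of two elements of the next, so any finite
    sum of displacements, the \<open>n\<close>-th one from \<open>Vs i (Suc n)\<close>, stays in
    \<open>V i\<close>.\<close>
  have "\<exists>Vs. \<forall>n. (open (Vs n) \<and> 0 \<in> Vs n \<and> (n = 0 \<longrightarrow> Vs n \<subseteq> V i)) \<and> (\<forall>a\<in>Vs (Suc n). \<forall>b\<in>Vs (Suc n). a + b \<in> Vs n)" for i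
    by (rule dependent_nat_choice) (use V zero_nbhd_add in \<open>auto 4 4\<close>)
  then obtain Vs where Vs: "\<And>i n. open (Vs i n)" "\<And>i n. 0 \<in> Vs i n" "\<And>i. Vs i 0 \<subseteq> V i"
    and Vs_add: "\<And>i n a b. a \<in> Vs i (Suc n) \<Longrightarrow> b \<in> Vs i (Suc n) \<Longrightarrow> a + b \<in> Vs i n"
    by metis
  define good where "good n A s B \<longleftrightarrow> s \<in> borel_measurable borel \<and> (\<forall>x. s x \<in> D \<and> s x \<in> Vs (c x) (Suc n)) \<and>
    (\<forall>x. act (s (act (s x) x)) (act (s x) x) = x) \<and>
    (\<forall>x. x \<notin> A \<longrightarrow> s x = 0) \<and> (\<forall>x\<in>A. act (s x) x \<in> A) \<and> (\<forall>x. c (act (s x) x) = c x) \<and>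
    B \<in> sets borel \<and> B \<subseteq> A \<and> (\<forall>x\<in>B. act (s x) x \<notin> B) \<and> {x \<in> A. x \<notin> B \<and> act (s x) x \<notin> B} \<in> null_sets M"
    for n A s B
  have "\<exists>s B. good n X s B" if "X \<in> sets borel" for n X
    unfolding good_def by (rule small_involution[OF free that c]) (rule Vs)+
  note ex = this
  define sB where "sB n X = (SOME p. good n X (fst p) (snd p))" for n X
  define sf where "sf n X = fst (sB n X)" for n X
  define Bf where "Bf n X = snd (sB n X)" for n X
  have sB: "good n X (sf n X) (Bf n X)" if "X \<in> sets borel" for n X
  proof -
    have "\<exists>p. good n X (fst p) (snd p)" using ex[OF that] by auto
    then show ?thesis unfolding sf_def Bf_def sB_def by (rule someI_ex)
  qed
  define AA where "AA = rec_nat A (\<lambda>n X. Bf n X)"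
  define s where "s n = sf n (AA n)" for n
  have AA_0: "AA 0 = A" and AA_Suc: "AA (Suc n) = Bf n (AA n)" for n by (simp_all add: AA_def)
  have AAm: "AA n \<in> sets borel" for n
  proof (induction n)
    case (Suc n) then show ?case using sB[of "AA n" n] unfolding AA_Suc good_def by blast
  qed (simp add: AA_0 A)
  have "good n (AA n) (s n) (AA (Suc n))" for n unfolding s_def AA_Suc by (rule sB[OF AAm])
  then have sm: "\<And>n. s n \<in> borel_measurable borel" and sD: "\<And>n x. s n x \<in> D"
    and sV: "\<And>n x. s n x \<in> Vs (c x) (Suc n)"
    and s_inv: "\<And>n x. act (s n (act (s n x) x)) (act (s n x) x) = x"
    and s_out: "\<And>n x. x \<notin> AA n \<Longrightarrow> s n x = 0"
    and s_in: "\<And>n x. x \<in> AA n \<Longrightarrow> act (s n x) x \<in> AA n"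
    and s_c: "\<And>n x. c (act (s n x) x) = c x"
    and A_dec: "\<And>n. AA (Suc n) \<subseteq> AA n"
    and s_mv: "\<And>n x. x \<in> AA (Suc n) \<Longrightarrow> act (s n x) x \<notin> AA (Suc n)"
    and s_null: "\<And>n. {x \<in> AA n. x \<notin> AA (Suc n) \<and> act (s n x) x \<notin> AA (Suc n)} \<in> null_sets M"
    unfolding good_def by blast+
  define S where "S n x = act (s n x) x" for n x
  \<comment> \<open>The involution maps \<open>AA (Suc n)\<close> to a disjoint copy inside
    \<open>AA n\<close>; hence the sets shrink to a null set.\<close>
  have half: "prob (AA (Suc n)) \<le> prob (AA n) / 2" for n
  proof -
    have "inj_on (\<lambda>x. act (s n x) x) (AA (Suc n))" by (rule inj_onI) (metis s_inv)
    note im = countable_valued_image[OF sm sD AAm this]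
    let ?I = "(\<lambda>x. act (s n x) x) ` AA (Suc n)"
    have "prob ?I = prob (AA (Suc n))" using im(2) by (simp add: measure_def)
    moreover have "prob (AA (Suc n) \<union> ?I) = prob (AA (Suc n)) + prob ?I"
      using im(1) AAm s_mv by (intro finite_measure_Union) (auto simp: sets_M)
    moreover have "prob (AA (Suc n) \<union> ?I) \<le> prob (AA n)"
      using A_dec s_in AAm by (intro finite_measure_mono) (auto simp: sets_M)
    ultimately show ?thesis by simp
  qed
  have "prob (AA n) \<le> (1 / 2) ^ n" for n
  proof (induction n)
    case (Suc n) then show ?case using half[of n] by simp
  qed simp
  then have le: "prob (\<Inter>n. AA n) \<le> (1 / 2) ^ n" for n
    using finite_measure_mono[of "\<Inter>n. AA n" "AA n"] AAm by (auto simp: sets_M intro: order_trans)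
  have "(\<lambda>n. (1 / 2 :: real) ^ n) \<longlonglongrightarrow> 0" by (rule LIMSEQ_realpow_zero) auto
  then have "prob (\<Inter>n. AA n) \<le> 0" by (rule LIMSEQ_le_const) (use le in auto)
  then have "prob (\<Inter>n. AA n) = 0" by (simp add: measure_le_0_iff)
  moreover have "(\<Inter>n. AA n) \<in> sets borel" using AAm by auto
  ultimately have n1: "(\<Inter>n. AA n) \<in> null_sets M" by (intro null_setsI)
  \<comment> \<open>Exceptional points: those in all the sets, and those whose pair was missed at
    some stage.\<close>
  define N where "N = (\<Inter>n. AA n) \<union> (\<Union>n. {x \<in> AA n. x \<notin> AA (Suc n) \<and> act (s n x) x \<notin> AA (Suc n)})"
  have N: "N \<in> null_sets M" unfolding N_def by (intro null_sets.Un n1 null_sets_UN s_null)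
  define Z where "Z = {x. \<exists>d\<in>D. act d x \<in> N}"
  have Z: "Z \<in> null_sets M" unfolding Z_def by (rule null_sets_D_saturation[OF N])
  have ZN: "x \<notin> N" if "x \<notin> Z" for x using that D.zero unfolding Z_def by force
  have ZD: "act d x \<notin> Z" if "x \<notin> Z" "d \<in> D" for x d
    using that D.add unfolding Z_def by (auto simp flip: act_add)
  interpret odometer AA S "- Z"
  proof
    fix x n assume x: "x \<in> - Z"
    show "S n x \<in> - Z" using ZD sD x unfolding S_def by auto
    have xN: "x \<notin> N" using ZN x by auto
    then show "\<exists>n. x \<notin> AA n" unfolding N_def by auto
    assume "x \<in> AA n" "x \<notin> AA (Suc n)"
    then show "S n x \<in> AA (Suc n)" using xN unfolding N_def S_def by blast
  qed (use A_dec s_inv s_out s_in s_mv in \<open>auto simp: S_def\<close>)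
  \<comment> \<open>The group element that realizes the finite product of involutions at
    \<open>x\<close>.\<close>
  define t where "t = rec_nat (\<lambda>x. 0) (\<lambda>k f x. f (S k x) + s k x)"
  have t_0: "t 0 x = 0" and t_Suc: "t (Suc k) x = t k (S k x) + s k x" for k x by (simp_all add: t_def)
  have t_comps: "act (t k x) x = comps 0 k x" for k x
    by (induction k arbitrary: x) (auto simp: t_0 t_Suc act_add S_def)
  have tD: "t k x \<in> D" for k x
    by (induction k arbitrary: x) (auto simp: t_0 t_Suc D.zero D.add sD)
  have Sm: "S n \<in> borel_measurable borel" for n
    unfolding S_def[abs_def] using sm by measurable
  have tm: "t k \<in> borel_measurable borel" for k
  proof (induction k)
    case 0
    have "t 0 = (\<lambda>x. 0)" by (rule ext) (rule t_0)
    then show ?case by simp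
  next
    case (Suc k)
    have "(\<lambda>x. t k (S k x)) \<in> borel_measurable borel" by (rule measurable_compose[OF Sm Suc])
    moreover have "t (Suc k) = (\<lambda>x. t k (S k x) + s k x)" by (rule ext) (rule t_Suc)
    ultimately show ?case using sm by simp
  qed
  \<comment> \<open>The extra summand \<open>a\<close> stands for the displacements already made;
    without it the induction would not close, since new terms are added on the right.\<close>
  have tV: "t k x + a \<in> Vs (c x) 0" if "a \<in> Vs (c x) k" for k x a
    using that
  proof (induction k arbitrary: x a)
    case (Suc k)
    have "s k x + a \<in> Vs (c x) k" using sV Suc.prems by (intro Vs_add)
    then have "s k x + a \<in> Vs (c (S k x)) k" by (simp add: S_def s_c)
    then have "t k (S k x) + (s k x + a) \<in> Vs (c (S k x)) 0" by (rule Suc.IH)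
    then show ?case by (simp add: t_Suc S_def s_c add.assoc)
  qed (simp add: t_0)
  have comps_c: "c (comps 0 k x) = c x" for k x
    by (induction k arbitrary: x) (auto simp: S_def s_c)
  define u where "u x = t (LEAST k. x \<notin> AA k) x" for x
  have u_odo: "act (u x) x = odo 0 x" for x unfolding u_def odo_def t_comps by simp
  have uD: "u x \<in> D" for x unfolding u_def by (rule tD)
  have um: "u \<in> borel_measurable borel"
  proof -
    have "(\<lambda>x. LEAST k. x \<notin> AA k) \<in> measurable borel (count_space UNIV)" using AAm by measurable
    then show ?thesis unfolding u_def[abs_def] by (rule measurable_compose_countable[OF tm])
  qed
  have "inj_on (\<lambda>x. act (u x) x) (- Z)" unfolding u_odo by (rule inj_on_odo)
  from pmp_bij_completion[OF um uD Z this] obtain Y v where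
    Y: "- Y \<in> null_sets M" "Y \<inter> Z = {}" "\<And>x d. x \<in> Y \<Longrightarrow> d \<in> D \<Longrightarrow> act d x \<in> Y"
    and v: "v \<in> borel_measurable borel" "\<And>x. v x \<in> D" "\<And>x. x \<in> Y \<Longrightarrow> v x = u x" "\<And>x. x \<notin> Y \<Longrightarrow> v x = 0"
    "pmp_bij M (\<lambda>x. act (v x) x)" by blast
  have vodo: "act (v x) x = odo 0 x" if "x \<in> Y" for x using v(3)[OF that] u_odo by simp
  have pw: "((\<lambda>x. act (v x) x) ^^ p) x = (odo 0 ^^ p) x \<and> (odo 0 ^^ p) x \<in> Y" if "x \<in> Y" for p x
  proof (induction p)
    case (Suc p)
    let ?z = "(odo 0 ^^ p) x"
    have z: "?z \<in> Y" and e: "((\<lambda>x. act (v x) x) ^^ p) x = ?z" using Suc by auto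
    have "act (v ?z) ?z \<in> Y" by (rule Y(3)[OF z v(2)])
    then show ?case using vodo[OF z] e by simp
  qed (use that in simp)
  have v_out: "v x = 0" if "x \<notin> A" for x
  proof (cases "x \<in> Y")
    case True
    have "(LEAST k. x \<notin> AA k) = 0" using that by (intro Least_equality) (auto simp: AA_0)
    then show ?thesis using v(3)[OF True] by (simp add: u_def t_0)
  qed (simp add: v(4))
  have v_in: "act (v x) x \<in> A" if "x \<in> A" for x
    using that odo_inside[of x 0] vodo[of x] v(4)[of x] by (cases "x \<in> Y") (auto simp: AA_0)
  have v_c: "c (act (v x) x) = c x" for x
    using comps_c vodo[of x] v(4)[of x] by (cases "x \<in> Y") (auto simp: odo_def)
  have v_V: "v x \<in> V (c x)" for x
  proof (cases "x \<in> Y")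
    case True
    have "u x + 0 \<in> Vs (c x) 0" unfolding u_def by (rule tV) (rule Vs)
    then show ?thesis using v(3)[OF True] Vs(3) by auto
  qed (simp add: v(4) V)
  have "AE x in M. x \<in> A \<longrightarrow> (\<forall>p>0. ((\<lambda>x. act (v x) x) ^^ p) x \<noteq> x)"
    using AE_not_in[OF Y(1)]
  proof eventually_elim
    case (elim x)
    then have xY: "x \<in> Y" "x \<in> - Z" using Y(2) by auto
    show ?case using pw[OF xY(1)] odo_aperiodic[OF xY(2), of 0] by (auto simp: AA_0)
  qed
  then show ?thesis using v(1,5) v_out v_in v_c v_V by (intro exI[of _ v]) blast
qed

end

section \<open>Aperiodic approximation\<close>

lemma infinite_orbitI:
  assumes "inj T" "\<And>p. p > 0 \<Longrightarrow> (T ^^ p) x \<noteq> x"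
  shows "infinite (range (\<lambda>n. (T ^^ n) x))"
proof (rule range_inj_infinite, rule injI, rule ccontr)
  have ne: "(T ^^ m) x \<noteq> (T ^^ n) x" if "m < n" for m n
  proof
    assume "(T ^^ m) x = (T ^^ n) x"
    also have "(T ^^ n) x = (T ^^ m) ((T ^^ (n - m)) x)"
      using that by (simp flip: funpow_add comp_apply[of "T ^^ m" "T ^^ (n - m)"])
    finally have "x = (T ^^ (n - m)) x" using inj_fn[OF assms(1), of m] by (auto dest: injD)
    then show False using assms(2)[of "n - m"] that by simp
  qed
  fix m n assume "(T ^^ m) x = (T ^^ n) x" "m \<noteq> n"
  then show False using ne[of m n] ne[of n m] by (cases "m < n") auto
qed

section \<open>Periodic points and their transversals\<close>

definition periodic_points :: "('a \<Rightarrow> 'a) \<Rightarrow> 'a set" where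
  "periodic_points T = {x. \<exists>p>0. (T ^^ p) x = x}"

lemma funpow_in_periodic_points:
  assumes "inj T"
  shows "(T ^^ n) x \<in> periodic_points T \<longleftrightarrow> x \<in> periodic_points T"
proof -
  have "(T ^^ p) ((T ^^ n) x) = (T ^^ n) x \<longleftrightarrow> (T ^^ p) x = x" for p
  proof -
    have "(T ^^ p) ((T ^^ n) x) = (T ^^ n) ((T ^^ p) x)"
      by (metis add.commute comp_apply funpow_add)
    then show ?thesis using inj_eq[OF inj_fn[OF assms, of n]] by simp
  qed
  then show ?thesis unfolding periodic_points_def by simp
qed

lemma funpow_mult_periodic: "(T ^^ p) x = x \<Longrightarrow> (T ^^ (p * k)) x = x"
  by (induction k) (simp_all add: funpow_add)

lemma measurable_funpow_borel:
  fixes T :: "'a::topological_space \<Rightarrow> 'a"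
  shows "T \<in> borel_measurable borel \<Longrightarrow> (T ^^ n) \<in> borel_measurable borel"
proof (induction n)
  case 0
  have "(T ^^ 0) = (\<lambda>x. x)" by (rule ext) simp
  then show ?case by simp
next
  case (Suc n)
  have "(T ^^ Suc n) = (\<lambda>x. T ((T ^^ n) x))" by (rule ext) simp
  then show ?case using measurable_compose[OF Suc.IH[OF Suc.prems] Suc.prems] by simp
qed

text \<open>In a finite orbit some basic open set contains exactly one point. For a given basic set
  at most one point of the orbit is isolated in this way, so the least index that isolates any point
  of the orbit selects a single one.\<close>

lemma periodic_transversal:
  fixes T :: "'x::{second_countable_topology, t2_space} \<Rightarrow> 'x"
  assumes T: "T \<in> borel_measurable borel"
  shows "\<exists>A\<in>sets borel. A \<subseteq> periodic_points T \<and> (\<forall>x\<in>periodic_points T. \<exists>k. (T ^^ k) x \<in> A) \<and>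
    (\<forall>x\<in>A. \<forall>k. (T ^^ k) x \<in> A \<longrightarrow> (T ^^ k) x = x)"
proof -
  note Tn = measurable_funpow_borel[OF T]
  obtain \<B> :: "'x set set" where \<B>: "countable \<B>" "topological_basis \<B>"
    using ex_countable_basis by blast
  have "\<B> \<noteq> {}" using topological_basisE[OF \<B>(2) open_UNIV, of undefined] by blast
  then have rb: "range (from_nat_into \<B>) = \<B>" using \<B>(1) by (intro range_from_nat_into)
  define b where "b = from_nat_into \<B>"
  note rb = rb[folded b_def]
  have ob: "open (b n)" for n using topological_basis_open[OF \<B>(2), of "b n"] rb by blast
  have bm[measurable]: "b n \<in> sets borel" for n using ob by auto
  let ?P = "periodic_points T"
  have eqm: "{x. (T ^^ k) x = x} \<in> sets borel" for k
    using Tn[of k] by measurable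
  have Pm[measurable]: "?P \<in> sets borel"
  proof -
    have "?P = (\<Union>p\<in>{0<..}. {x. (T ^^ p) x = x})" unfolding periodic_points_def by auto
    then show ?thesis using eqm by auto
  qed
  define Q where "Q i = {x \<in> ?P. x \<in> b i \<and> (\<forall>k. (T ^^ k) x \<in> b i \<longrightarrow> (T ^^ k) x = x)}" for i
  have Qm[measurable]: "Q i \<in> sets borel" for i
    unfolding Q_def using Tn by measurable
  define A where "A = {x. \<exists>i. x \<in> Q i \<and> (\<forall>j<i. \<forall>k. (T ^^ k) x \<notin> Q j)}"
  have "A \<in> sets borel" unfolding A_def using Tn by measurable
  moreover have "A \<subseteq> ?P" unfolding A_def Q_def by auto
  moreover have "\<exists>k. (T ^^ k) x \<in> A" if x: "x \<in> ?P" for x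
  proof -
    obtain p where p: "p > 0" "(T ^^ p) x = x" using x unfolding periodic_points_def by blast
    have orb: "(T ^^ k) x \<in> (\<lambda>k. (T ^^ k) x) ` {..<p}" for k
    proof -
      have "(T ^^ k) x = (T ^^ (k mod p)) x" using funpow_mod_eq[OF p(2)] by simp
      moreover have "k mod p \<in> {..<p}" using p(1) by simp
      ultimately show ?thesis by (rule image_eqI)
    qed
    let ?F = "(\<lambda>k. (T ^^ k) x) ` {..<p} - {x}"
    have "open (- ?F)" by (intro open_Compl finite_imp_closed) simp
    then obtain U where U: "U \<in> \<B>" "x \<in> U" "U \<subseteq> - ?F"
      using topological_basisE[OF \<B>(2), of "- ?F" x] by blast
    then obtain i where i: "b i = U" using rb by blast
    have "x \<in> Q i" unfolding Q_def i using U x orb by blast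
    then have ex: "\<exists>i k. (T ^^ k) x \<in> Q i" by (metis funpow_0)
    define i where "i = (LEAST i. \<exists>k. (T ^^ k) x \<in> Q i)"
    obtain k where k: "(T ^^ k) x \<in> Q i" using LeastI_ex[OF ex] unfolding i_def by blast
    have "(T ^^ l) ((T ^^ k) x) \<notin> Q j" if "j < i" for j l
    proof -
      have "(T ^^ (l + k)) x \<notin> Q j" using not_less_Least[of j "\<lambda>i. \<exists>k. (T ^^ k) x \<in> Q i"] that
        unfolding i_def by blast
      then show ?thesis by (simp add: funpow_add)
    qed
    then show ?thesis unfolding A_def using k by blast
  qed
  moreover have "(T ^^ k) x = x" if xA: "x \<in> A" and yA: "(T ^^ k) x \<in> A" for x k
  proof -
    obtain i where i: "x \<in> Q i" "\<And>j l. j < i \<Longrightarrow> (T ^^ l) x \<notin> Q j" using xA unfolding A_def by blast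
    obtain i' where i': "(T ^^ k) x \<in> Q i'" "\<And>j l. j < i' \<Longrightarrow> (T ^^ l) ((T ^^ k) x) \<notin> Q j"
      using yA unfolding A_def by blast
    obtain p where p: "p > 0" "(T ^^ p) x = x" using i(1) unfolding Q_def periodic_points_def by blast
    \<comment> \<open>Only forward iterates are used, so going back from \<open>(T ^^ k) x\<close>
      to \<open>x\<close> means going on to the multiple \<open>p * k\<close> of the period.\<close>
    have "(T ^^ (p * k - k)) ((T ^^ k) x) = (T ^^ (p * k - k + k)) x" by (simp add: funpow_add)
    also have "p * k - k + k = p * k" using p(1) by (cases p) auto
    also have "(T ^^ (p * k)) x = x" by (rule funpow_mult_periodic[OF p(2)])
    finally have "\<not> i < i'" using i'(2)[of i "p * k - k"] i(1) by auto
    moreover have "\<not> i' < i" using i(2)[of i' k] i'(1) by auto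
    ultimately have "i' = i" by simp
    then show ?thesis using i(1) i'(1) unfolding Q_def by blast
  qed
  ultimately show ?thesis by blast
qed

text \<open>
  The first return map of \<open>T \<circ> U\<close> to the transversal \<open>A\<close> of the periodic part is \<open>U\<close>.
\<close>

lemma infinite_orbit_comp_transversal:
  assumes T: "inj T" and U: "inj U" and U_out: "\<And>x. x \<notin> A \<Longrightarrow> U x = x" and U_in: "\<And>x. x \<in> A \<Longrightarrow> U x \<in> A"
    and A: "A \<subseteq> periodic_points T" "\<And>x. x \<in> periodic_points T \<Longrightarrow> \<exists>k. (T ^^ k) x \<in> A"
      "\<And>x k. x \<in> A \<Longrightarrow> (T ^^ k) x \<in> A \<Longrightarrow> (T ^^ k) x = x"
    and good: "\<And>k p. (T ^^ k) x \<in> A \<Longrightarrow> p > 0 \<Longrightarrow> (U ^^ p) ((T ^^ k) x) \<noteq> (T ^^ k) x"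
  shows "infinite (range (\<lambda>n. ((T \<circ> U) ^^ n) x))"
proof (cases "x \<in> periodic_points T")
  case False
  have eq: "((T \<circ> U) ^^ n) x = (T ^^ n) x" for n
  proof (induction n)
    case (Suc n)
    have "(T ^^ n) x \<notin> A" using A(1) funpow_in_periodic_points[OF T] False by blast
    then show ?case using Suc U_out by simp
  qed simp
  have "infinite (range (\<lambda>n. (T ^^ n) x))"
    by (rule infinite_orbitI[OF T]) (use False in \<open>unfold periodic_points_def, blast\<close>)
  then show ?thesis unfolding eq .
next
  case True
  \<comment> \<open>Until \<open>A\<close> is met, \<open>U\<close> does nothing and
    \<open>T \<circ> U\<close> follows \<open>T\<close>.\<close>
  have walk: "((T \<circ> U) ^^ j) z = (T ^^ j) z" if "\<And>i. i < j \<Longrightarrow> (T ^^ i) z \<notin> A" for z j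
    using that by (induction j) (auto simp: U_out)
  define k where "k = (LEAST k. (T ^^ k) x \<in> A)"
  define y where "y = (T ^^ k) x"
  have yA: "y \<in> A" unfolding y_def k_def by (rule LeastI_ex) (rule A(2)[OF True])
  have reach: "((T \<circ> U) ^^ k) x = y"
    unfolding y_def by (rule walk) (use not_less_Least in \<open>auto simp: k_def\<close>)
  have return: "\<exists>r. ((T \<circ> U) ^^ r) a = U a" if a: "a \<in> A" for a
  proof -
    have Ua: "U a \<in> A" by (rule U_in[OF a])
    then have "\<exists>p>0. (T ^^ p) (U a) = U a" using A(1) unfolding periodic_points_def by blast
    \<comment> \<open>The step from \<open>a\<close> already applies \<open>T\<close> after
      \<open>U\<close>, hence the shift by one: \<open>r\<close> counts the further steps from
      \<open>T (U a)\<close> back to \<open>U a\<close>.\<close>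
    then have ex: "\<exists>r. (T ^^ Suc r) (U a) = U a" by (metis Suc_pred)
    define r where "r = (LEAST r. (T ^^ Suc r) (U a) = U a)"
    have r: "(T ^^ Suc r) (U a) = U a" using LeastI_ex[OF ex] unfolding r_def .
    have "(T ^^ i) (T (U a)) \<notin> A" if "i < r" for i
    proof
      assume "(T ^^ i) (T (U a)) \<in> A"
      then have "(T ^^ Suc i) (U a) \<in> A" by (simp add: funpow_swap1)
      then have "(T ^^ Suc i) (U a) = U a" by (rule A(3)[OF Ua])
      then show False using not_less_Least[of i "\<lambda>r. (T ^^ Suc r) (U a) = U a"] that unfolding r_def by blast
    qed
    then have "((T \<circ> U) ^^ r) (T (U a)) = (T ^^ r) (T (U a))" by (rule walk)
    also have "\<dots> = U a" using r by (simp add: funpow_swap1)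
    finally have "((T \<circ> U) ^^ Suc r) a = U a" by (simp add: funpow_swap1)
    then show ?thesis by blast
  qed
  have reachU: "\<exists>r. ((T \<circ> U) ^^ r) x = (U ^^ q) y \<and> (U ^^ q) y \<in> A" for q
  proof (induction q)
    case 0
    show ?case unfolding funpow_0 using reach yA by (intro exI[of _ k] conjI)
  next
    case (Suc q)
    then obtain r where r: "((T \<circ> U) ^^ r) x = (U ^^ q) y" "(U ^^ q) y \<in> A" by blast
    obtain r' where r': "((T \<circ> U) ^^ r') ((U ^^ q) y) = U ((U ^^ q) y)" using return[OF r(2)] by blast
    have "((T \<circ> U) ^^ (r' + r)) x = (U ^^ Suc q) y" using r r' by (simp add: funpow_add)
    moreover have "(U ^^ Suc q) y \<in> A" using U_in[OF r(2)] by simp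
    ultimately show ?case by blast
  qed
  have "infinite (range (\<lambda>q. (U ^^ q) y))"
    using good[of k] yA by (intro infinite_orbitI[OF U]) (auto simp: y_def)
  moreover have "range (\<lambda>q. (U ^^ q) y) \<subseteq> range (\<lambda>n. ((T \<circ> U) ^^ n) x)"
  proof
    fix z assume "z \<in> range (\<lambda>q. (U ^^ q) y)"
    then obtain q where "z = (U ^^ q) y" by blast
    then show "z \<in> range (\<lambda>n. ((T \<circ> U) ^^ n) x)" using reachU[of q] by (metis rangeI)
  qed
  ultimately show ?thesis using finite_subset by blast
qed

text \<open>Continuity of addition at \<open>(g, 0)\<close> gives a cell around \<open>g\<close> and
  a neighbourhood of \<open>0\<close> whose sums stay within \<open>e / 2\<close> of
  \<open>g\<close>; both depend on \<open>g\<close>, and Lindelof leaves countably many.\<close>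

lemma additive_nbhd_cover:
  fixes e :: real
  assumes "0 < e"
  shows "\<exists>(P :: nat \<Rightarrow> 'g::{polish_space, topological_group_add} set) V. (\<Union>i. P i) = UNIV \<and>
    (\<forall>i. open (P i) \<and> open (V i) \<and> 0 \<in> V i \<and> (\<forall>a\<in>P i. \<forall>b\<in>P i. \<forall>v\<in>V i. dist a (b + v) < e))"
proof -
  have "\<exists>A B. open A \<and> g \<in> A \<and> open B \<and> 0 \<in> B \<and> (\<forall>x\<in>A. \<forall>y\<in>B. x + y \<in> ball g (e / 2))" for g :: 'g
    by (rule add_nbhds) (use assms in auto)
  then obtain A B where AB: "\<And>g :: 'g. open (A g)" "\<And>g. g \<in> A g" "\<And>g. open (B g)" "\<And>g. 0 \<in> B g"
    "\<And>g x y. x \<in> A g \<Longrightarrow> y \<in> B g \<Longrightarrow> x + y \<in> ball g (e / 2)" by metis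
  obtain F where F: "F \<subseteq> range A" "countable F" "\<Union>F = \<Union>(range A)"
    using Lindelof[of "range A"] AB(1) by blast
  have U: "\<Union>(range A) = UNIV" using AB(2) by blast
  then have "F \<noteq> {}" using F(3) by auto
  then have rF: "range (from_nat_into F) = F" using F(2) by (intro range_from_nat_into)
  have "\<forall>n. \<exists>g. from_nat_into F n = A g" using rF F(1) by blast
  from choice[OF this] obtain g where g: "\<And>n. from_nat_into F n = A (g n)" by blast
  have "(\<Union>i. A (g i)) = UNIV" using F(3) U unfolding g[symmetric] rF by simp
  moreover have "dist a (b + v) < e" if "a \<in> A (g i)" "b \<in> A (g i)" "v \<in> B (g i)" for i a b v
  proof -
    have "a + 0 \<in> ball (g i) (e / 2)" "b + v \<in> ball (g i) (e / 2)" using that AB(4,5) by blast+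
    then show ?thesis using dist_triangle3[of a "b + v" "g i"] by simp
  qed
  ultimately show ?thesis using AB by (intro exI[of _ "\<lambda>i. A (g i)"] exI[of _ "\<lambda>i. B (g i)"]) auto
qed

lemma pmp_bij_comp:
  assumes "sets M = sets borel" "pmp_bij M T" "pmp_bij M U"
  shows "pmp_bij M (T \<circ> U)"
proof -
  have T: "bij T" "T \<in> borel_measurable borel" "inv_into UNIV T \<in> borel_measurable borel" "distr M M T = M"
    and U: "bij U" "U \<in> borel_measurable borel" "inv_into UNIV U \<in> borel_measurable borel" "distr M M U = M"
    using assms unfolding pmp_bij_def by auto
  have m: "T \<in> measurable M M" "U \<in> measurable M M" using T U assms(1) by (simp_all cong: measurable_cong_sets)
  have "distr M M (T \<circ> U) = distr (distr M M U) M T" using m by (simp add: distr_distr)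
  then show ?thesis unfolding pmp_bij_def o_inv_distrib[OF T(1) U(1)]
    using T U by (auto intro: bij_comp measurable_comp)
qed

lemma AE_pmp_bij:
  assumes "sets M = sets borel" "pmp_bij M T" "AE x in M. P x"
  shows "AE x in M. P (T x)"
proof -
  have T: "T \<in> measurable M M" and d: "distr M M T = M"
    using assms(1,2) unfolding pmp_bij_def by (auto cong: measurable_cong_sets)
  have "AE x in distr M M T. P x" using assms(3) by (subst d)
  then show ?thesis by (rule AE_distrD[OF T])
qed

lemma AE_pmp_bij_funpow:
  assumes "sets M = sets borel" "pmp_bij M T" "AE x in M. P x"
  shows "AE x in M. P ((T ^^ n) x)"
proof (induction n)
  case (Suc n)
  then show ?case using AE_pmp_bij[OF assms(1,2) Suc] by (simp add: funpow_swap1)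
qed (use assms in simp)

context borel_pmp_system
begin

text \<open>\<open>T' = T \<circ> U\<close>, where \<open>U\<close> is a small aperiodic map of the
  transversal and \<open>f' x = f (U x) + v x\<close>. As \<open>U\<close> preserves the colour,
  \<open>f (U x)\<close> and \<open>f x\<close> share a cell, and \<open>v x\<close> is small enough
  for that cell.\<close>

lemma aperiodic_approximation:
  assumes free: "AE x in M. \<not> open (stab x)" and T: "pmp_bij M T"
    and f: "f \<in> borel_measurable M" "AE x in M. T x = act (f x) x" and e: "0 < e"
  shows "\<exists>T' f'. pmp_bij M T' \<and> f' \<in> borel_measurable M \<and> (AE x in M. T' x = act (f' x) x) \<and>
    (\<forall>x. dist (f x) (f' x) < e) \<and> (AE x in M. infinite (range (\<lambda>n. (T' ^^ n) x)))"
proof -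
  have Tb: "bij T" "T \<in> borel_measurable borel" using T unfolding pmp_bij_def by auto
  obtain A where A: "A \<in> sets borel" "A \<subseteq> periodic_points T"
      "\<And>x. x \<in> periodic_points T \<Longrightarrow> \<exists>k. (T ^^ k) x \<in> A"
      "\<And>x k. x \<in> A \<Longrightarrow> (T ^^ k) x \<in> A \<Longrightarrow> (T ^^ k) x = x"
    using periodic_transversal[OF Tb(2)] by blast
  obtain Q V :: "nat \<Rightarrow> 'g set" where "(\<Union>i. Q i) = UNIV \<and>
      (\<forall>i. open (Q i) \<and> open (V i) \<and> 0 \<in> V i \<and> (\<forall>a\<in>Q i. \<forall>b\<in>Q i. \<forall>v\<in>V i. dist a (b + v) < e))"
    using additive_nbhd_cover[OF e, where 'g = 'g] by (elim exE)
  then have QU: "(\<Union>i. Q i) = (UNIV :: 'g set)" and Q: "\<And>i. open (Q i)" and V: "\<And>i. open (V i)" "\<And>i. 0 \<in> V i"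
      and QV: "\<And>i a b v. a \<in> Q i \<Longrightarrow> b \<in> Q i \<Longrightarrow> v \<in> V i \<Longrightarrow> dist a (b + v) < e" by auto
  define c where "c x = (LEAST i. f x \<in> Q i)" for x
  have fb[measurable]: "f \<in> borel_measurable borel" using f(1) by (simp add: measurable_M)
  have Qc: "f x \<in> Q (c x)" for x
  proof -
    have "\<exists>i. f x \<in> Q i" using QU by blast
    then show ?thesis unfolding c_def by (rule LeastI_ex)
  qed
  have "c \<in> measurable borel (count_space UNIV)"
  proof -
    have [measurable]: "Q i \<in> sets borel" for i using Q by auto
    show ?thesis unfolding c_def by measurable
  qed
  from small_aperiodic[OF free A(1) this, of V, OF V] obtain v where
    v: "v \<in> borel_measurable borel" "pmp_bij M (\<lambda>x. act (v x) x)" "\<And>x. x \<notin> A \<Longrightarrow> v x = 0"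
      "\<And>x. x \<in> A \<Longrightarrow> act (v x) x \<in> A" "\<And>x. c (act (v x) x) = c x" "\<And>x. v x \<in> V (c x)"
      "AE x in M. x \<in> A \<longrightarrow> (\<forall>p>0. ((\<lambda>x. act (v x) x) ^^ p) x \<noteq> x)" by blast
  define U where "U x = act (v x) x" for x
  have Ufold: "(\<lambda>x. act (v x) x) = U" by (rule ext) (simp add: U_def)
  note v = v[unfolded Ufold]
  have Ub: "bij U" "U \<in> borel_measurable borel" using v(2) unfolding pmp_bij_def by auto
  define f' where "f' x = f (U x) + v x" for x
  have "pmp_bij M (T \<circ> U)" by (rule pmp_bij_comp[OF sets_M T v(2)])
  moreover have "f' \<in> borel_measurable M"
    unfolding measurable_M f'_def[abs_def]
    by (intro borel_measurable_add v(1) measurable_compose[OF Ub(2) fb])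
  moreover have "AE x in M. (T \<circ> U) x = act (f' x) x"
    using AE_pmp_bij[OF sets_M v(2) f(2)] by eventually_elim (simp add: f'_def act_add U_def)
  moreover have "dist (f x) (f' x) < e" for x
  proof -
    have "f (U x) \<in> Q (c x)" using Qc[of "U x"] v(5)[of x] by (simp add: U_def)
    then show ?thesis unfolding f'_def by (intro QV[of _ "c x"] Qc v(6))
  qed
  moreover have "AE x in M. infinite (range (\<lambda>n. ((T \<circ> U) ^^ n) x))"
  proof -
    \<comment> \<open>\<open>U\<close> is aperiodic only off a null set, while the argument needs
      this at every visit of the orbit to \<open>A\<close>; \<open>T\<close> preserves null sets, so
      almost every forward orbit avoids it.\<close>
    have "AE x in M. \<forall>k. (T ^^ k) x \<in> A \<longrightarrow> (\<forall>p>0. (U ^^ p) ((T ^^ k) x) \<noteq> (T ^^ k) x)"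
      unfolding AE_all_countable by (intro allI AE_pmp_bij_funpow[OF sets_M T v(7)])
    then show ?thesis
    proof eventually_elim
      case (elim x)
      show ?case
        by (rule infinite_orbit_comp_transversal[where A = A])
           (use Tb Ub A v(3,4) elim in \<open>auto simp: U_def bij_is_inj\<close>)
    qed
  qed
  ultimately show ?thesis by blast
qed

end

section \<open>The topology of the full group\<close>

definition L0_class :: "'x measure \<Rightarrow> ('x \<Rightarrow> 'y::topological_space) \<Rightarrow> ('x \<Rightarrow> 'y) set" where
  "L0_class M f = ae_eq M `` {f}"

lemma mem_L0_class:
  "f \<in> borel_measurable M \<Longrightarrow> g \<in> L0_class M f \<longleftrightarrow> g \<in> borel_measurable M \<and> (AE x in M. f x = g x)"
  unfolding L0_class_def ae_eq_def by auto

lemma L0_class_self: "f \<in> borel_measurable M \<Longrightarrow> f \<in> L0_class M f"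
  by (simp add: mem_L0_class)

lemma L0_class_in_L0: "f \<in> borel_measurable M \<Longrightarrow> L0_class M f \<in> L0 M"
  unfolding L0_class_def L0_def by (rule quotientI)

lemma L0_class_eqI:
  assumes "f \<in> borel_measurable M" "g \<in> borel_measurable M" "AE x in M. f x = g x"
  shows "L0_class M f = L0_class M g"
  unfolding L0_class_def by (rule equiv_class_eq[OF equiv_ae_eq]) (use assms in \<open>simp add: ae_eq_def\<close>)

lemma L0_eq_class:
  assumes "A \<in> L0 M" "f \<in> A" shows "f \<in> borel_measurable M" "A = L0_class M f"
proof -
  show f: "f \<in> borel_measurable M" using ae_eqD(1)[OF assms(1,2,2)] .
  obtain g where g: "g \<in> borel_measurable M" "A = L0_class M g"
    using assms(1) unfolding L0_def L0_class_def by (rule quotientE)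
  then have "AE x in M. g x = f x" using assms(2) by (simp add: mem_L0_class)
  then show "A = L0_class M f" unfolding g(2) by (rule L0_class_eqI[OF g(1) f])
qed

lemma L0_cases:
  assumes "A \<in> L0 M" obtains f where "f \<in> borel_measurable M" "A = L0_class M f"
  using assms unfolding L0_def L0_class_def by (rule quotientE)

lemma L0_dist_class:
  fixes f g :: "'x \<Rightarrow> 'y::{metric_space, second_countable_topology}"
  assumes "f \<in> borel_measurable M" "g \<in> borel_measurable M"
  shows "L0_dist M (L0_class M f) (L0_class M g) = (\<integral>x. min 1 (dist (f x) (g x)) \<partial>M)"
  by (intro L0_dist_eq L0_class_in_L0 L0_class_self assms)

context Metric_space
begin

lemma openin_subtopology_mtopology:
  "openin (subtopology mtopology S) W \<longleftrightarrow>
     W \<subseteq> M \<inter> S \<and> (\<forall>x\<in>W. \<exists>r>0. \<forall>y\<in>M \<inter> S. d x y < r \<longrightarrow> y \<in> W)"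
proof
  assume "openin (subtopology mtopology S) W"
  then obtain T where T: "openin mtopology T" "W = T \<inter> S" unfolding openin_subtopology by blast
  have "\<exists>r>0. \<forall>y\<in>M \<inter> S. d x y < r \<longrightarrow> y \<in> W" if xW: "x \<in> W" for x
  proof -
    obtain r where "r > 0" "mball x r \<subseteq> T" using T xW unfolding openin_mtopology by blast
    moreover have "x \<in> M" using T xW unfolding openin_mtopology by blast
    ultimately show ?thesis using T(2) by (intro exI[of _ r]) auto
  qed
  then show "W \<subseteq> M \<inter> S \<and> (\<forall>x\<in>W. \<exists>r>0. \<forall>y\<in>M \<inter> S. d x y < r \<longrightarrow> y \<in> W)"
    using T unfolding openin_mtopology by blast
next
  assume W: "W \<subseteq> M \<inter> S \<and> (\<forall>x\<in>W. \<exists>r>0. \<forall>y\<in>M \<inter> S. d x y < r \<longrightarrow> y \<in> W)"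
  then obtain r where r: "\<And>x. x \<in> W \<Longrightarrow> r x > 0" "\<And>x y. x \<in> W \<Longrightarrow> y \<in> M \<inter> S \<Longrightarrow> d x y < r x \<Longrightarrow> y \<in> W"
    by metis
  have "W = (\<Union>x\<in>W. mball x (r x)) \<inter> S" using W r by auto
  moreover have "openin mtopology (\<Union>x\<in>W. mball x (r x))" by (intro openin_Union) auto
  ultimately show "openin (subtopology mtopology S) W" unfolding openin_subtopology by blast
qed

end

context borel_pmp_system
begin

lemma measurable_act_self: "f \<in> borel_measurable M \<Longrightarrow> (\<lambda>x. act (f x) x) \<in> borel_measurable M"
  unfolding measurable_M by (intro measurable_act) auto

lemma Phi_class:
  assumes f: "f \<in> borel_measurable M"
  shows "Phi M act (L0_class M f) = L0_class M (\<lambda>x. act (f x) x)"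
proof -
  have "ae_eq M `` {\<lambda>x. act (g x) x} = L0_class M (\<lambda>x. act (f x) x)" if "g \<in> L0_class M f" for g
  proof -
    have g: "g \<in> borel_measurable M" "AE x in M. f x = g x" using that f by (auto simp: mem_L0_class)
    have "AE x in M. act (g x) x = act (f x) x" using g(2) by eventually_elim simp
    then have "L0_class M (\<lambda>x. act (g x) x) = L0_class M (\<lambda>x. act (f x) x)"
      by (intro L0_class_eqI measurable_act_self f g(1))
    then show ?thesis by (simp add: L0_class_def)
  qed
  then show ?thesis unfolding Phi_def using L0_class_self[OF f] by blast
qed

lemma pmp_bij_measurable: "pmp_bij M T \<Longrightarrow> T \<in> borel_measurable M"
  by (simp add: pmp_bij_def measurable_M)

lemma full_groupI:
  assumes T: "pmp_bij M T" and f: "f \<in> borel_measurable M" "AE x in M. T x = act (f x) x"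
  shows "L0_class M T \<in> full_group M act" "L0_class M f \<in> lifted_full_group M act"
    "Phi M act (L0_class M f) = L0_class M T"
proof -
  have Tm: "T \<in> borel_measurable M" by (rule pmp_bij_measurable[OF T])
  have A: "L0_class M T \<in> Aut M" unfolding Aut_def using L0_class_in_L0[OF Tm] L0_class_self[OF Tm] T by blast
  have "AE x in M. (x, T x) \<in> orbit_rel act"
    using f(2) by eventually_elim (auto simp: orbit_rel_def)
  then show "L0_class M T \<in> full_group M act" unfolding full_group_def using A L0_class_self[OF Tm] by blast
  have "AE x in M. act (f x) x = T x" using f(2) by eventually_elim simp
  then show P: "Phi M act (L0_class M f) = L0_class M T"
    unfolding Phi_class[OF f(1)] by (intro L0_class_eqI measurable_act_self f Tm)
  show "L0_class M f \<in> lifted_full_group M act"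
    unfolding lifted_full_group_def using L0_class_in_L0[OF f(1)] A P by simp
qed

text \<open>The class has one representative that is a bijection and another that follows orbits.
  They agree almost everywhere, so the set of pairs \<open>(x, g)\<close> with
  \<open>T x = act g x\<close> is Borel with almost all sections nonempty, and a measurable
  selection is a lift.\<close>

lemma full_group_lift:
  assumes "B \<in> full_group M act"
  obtains T f where "pmp_bij M T" "B = L0_class M T" "f \<in> borel_measurable M" "AE x in M. T x = act (f x) x"
proof -
  have B: "B \<in> L0 M" using assms unfolding full_group_def Aut_def by blast
  obtain T where T: "T \<in> B" "pmp_bij M T" using assms unfolding full_group_def Aut_def by blast
  obtain T1 where T1: "T1 \<in> B" "AE x in M. (x, T1 x) \<in> orbit_rel act" using assms unfolding full_group_def by blast
  have ex: "AE x in M. \<exists>g. T x = act g x"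
    using T1(2) ae_eqD(3)[OF B T(1) T1(1)] by eventually_elim (auto simp: orbit_rel_def)
  have Tb: "T \<in> borel_measurable borel" using T(2) by (simp add: pmp_bij_def)
  let ?P = "{p. T (fst p) = act (snd p) (fst p)}"
  have "(\<lambda>p :: 'x \<times> 'g. T (fst p)) \<in> borel_measurable borel"
    by (rule measurable_compose[OF borel_measurable_continuous_onI[OF continuous_on_fst[OF continuous_on_id]] Tb])
  moreover have "(\<lambda>p :: 'x \<times> 'g. act (snd p) (fst p)) \<in> borel_measurable borel"
    by (rule measurable_act) (intro borel_measurable_continuous_onI continuous_intros)+
  ultimately have "?P \<in> sets borel" by measurable
  from measurable_selection[OF prob_space_axioms sets_M this] ex obtain f
    where "f \<in> borel_measurable M" "AE x in M. (x, f x) \<in> ?P" by auto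
  then show ?thesis using that[of T f] T(2) L0_eq_class(2)[OF B T(1)] by auto
qed

lemma Phi_lifted_in_full_group:
  assumes "A \<in> lifted_full_group M act" shows "Phi M act A \<in> full_group M act"
proof -
  have A: "A \<in> L0 M" "Phi M act A \<in> Aut M" using assms unfolding lifted_full_group_def by auto
  obtain f where f: "f \<in> borel_measurable M" "A = L0_class M f" using L0_cases[OF A(1)] .
  have "(\<lambda>x. act (f x) x) \<in> Phi M act A"
    unfolding f(2) Phi_class[OF f(1)] by (rule L0_class_self[OF measurable_act_self[OF f(1)]])
  moreover have "AE x in M. (x, act (f x) x) \<in> orbit_rel act" by (auto simp: orbit_rel_def)
  ultimately show ?thesis
    unfolding full_group_def using A(2) by (intro CollectI conjI bexI[of _ "\<lambda>x. act (f x) x"])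
qed

lemma L0_metric: "Metric_space (L0 M :: ('x \<Rightarrow> 'g) set set) (L0_dist M)"
  by (rule Metric_space_L0) (rule prob_space_axioms)

lemma openin_full_group_iff:
  "openin (full_group_topology M act) U \<longleftrightarrow> U \<subseteq> full_group M act \<and>
     (\<forall>A\<in>lifted_full_group M act. Phi M act A \<in> U \<longrightarrow>
        (\<exists>r>0. \<forall>A'\<in>lifted_full_group M act. L0_dist M A A' < r \<longrightarrow> Phi M act A' \<in> U))"
proof -
  have "L0 M \<inter> lifted_full_group M act = lifted_full_group M act"
    unfolding lifted_full_group_def by blast
  then show ?thesis
    unfolding openin_full_group_topology L0_topology_def
      Metric_space.openin_subtopology_mtopology[OF L0_metric] by (simp add: Ball_def imp_conjL)
qed

lemma topspace_full_group_topology: "topspace (full_group_topology M act) = full_group M act"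
proof
  show "topspace (full_group_topology M act) \<subseteq> full_group M act"
    unfolding topspace_def openin_full_group_iff by blast
  have "openin (full_group_topology M act) (full_group M act)"
    unfolding openin_full_group_iff using Phi_lifted_in_full_group by (auto intro: exI[of _ 1])
  then show "full_group M act \<subseteq> topspace (full_group_topology M act)" by (rule openin_subset)
qed

text \<open>The preimage of an open set around \<open>B\<close> contains a ball around any one lift
  of \<open>B\<close>, so it is enough to perturb that lift; uniform closeness by
  \<open>r / 2\<close> bounds the integral metric strictly by \<open>r\<close>.\<close>

lemma aperiodic_dense:
  assumes free: "AE x in M. \<not> open (stab x)"
  shows "full_group_topology M act closure_of {A \<in> full_group M act. aperiodic M A} = full_group M act"
proof
  show "full_group_topology M act closure_of {A \<in> full_group M act. aperiodic M A} \<subseteq> full_group M act"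
    using closure_of_subset_topspace topspace_full_group_topology by metis
  show "full_group M act \<subseteq> full_group_topology M act closure_of {A \<in> full_group M act. aperiodic M A}"
  proof
    fix B assume B: "B \<in> full_group M act"
    obtain T f where T: "pmp_bij M T" and BT: "B = L0_class M T" and f: "f \<in> borel_measurable M"
      and Tf: "AE x in M. T x = act (f x) x" using full_group_lift[OF B] .
    show "B \<in> full_group_topology M act closure_of {A \<in> full_group M act. aperiodic M A}"
      unfolding in_closure_of topspace_full_group_topology
    proof (intro conjI allI impI B)
      fix U assume "B \<in> U \<and> openin (full_group_topology M act) U"
      then have U: "B \<in> U" "openin (full_group_topology M act) U" by auto
      have "Phi M act (L0_class M f) \<in> U" using full_groupI(3)[OF T f Tf] BT U(1) by simp
      then obtain r where r: "r > 0"
        "\<And>A'. A' \<in> lifted_full_group M act \<Longrightarrow> L0_dist M (L0_class M f) A' < r \<Longrightarrow> Phi M act A' \<in> U"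
        using U(2) full_groupI(2)[OF T f Tf] unfolding openin_full_group_iff by blast
      obtain T' f' where T': "pmp_bij M T'" and f': "f' \<in> borel_measurable M" "AE x in M. T' x = act (f' x) x"
        and d: "\<And>x. dist (f x) (f' x) < r / 2" and inf: "AE x in M. infinite (range (\<lambda>n. (T' ^^ n) x))"
        using aperiodic_approximation[OF free T f Tf, of "r / 2"] r(1) by auto
      have int: "integrable M (\<lambda>x. min 1 (dist (f x) (f' x)))"
        by (rule integrable_const_bound[of _ 1]) (use f f' in auto)
      have "L0_dist M (L0_class M f) (L0_class M f') = (\<integral>x. min 1 (dist (f x) (f' x)) \<partial>M)"
        by (rule L0_dist_class[OF f f'(1)])
      also have "\<dots> \<le> (\<integral>x. r / 2 \<partial>M)"
        by (rule integral_mono[OF int]) (use d in \<open>simp_all add: min.coboundedI2 less_imp_le del: less_divide_eq_numeral1 le_divide_eq_numeral1\<close>)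
      also have "\<dots> < r" using r(1) by (simp add: prob_space)
      finally have "Phi M act (L0_class M f') \<in> U" by (intro r(2) full_groupI(2)[OF T' f'])
      then have "L0_class M T' \<in> U" by (simp only: full_groupI(3)[OF T' f'])
      moreover have "aperiodic M (L0_class M T')"
        unfolding aperiodic_def
      proof (intro bexI[of _ T'] conjI T')
        show "AE x in M. infinite {y. \<exists>n. y = (T' ^^ n) x \<or> x = (T' ^^ n) y}"
          using inf
        proof eventually_elim
          case (elim x)
          have "range (\<lambda>n. (T' ^^ n) x) \<subseteq> {y. \<exists>n. y = (T' ^^ n) x \<or> x = (T' ^^ n) y}" by blast
          then show ?case using elim finite_subset by blast
        qed
        show "T' \<in> L0_class M T'" by (rule L0_class_self[OF pmp_bij_measurable[OF T']])
      qed
      ultimately show "\<exists>y. y \<in> {A \<in> full_group M act. aperiodic M A} \<and> y \<in> U"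
        using full_groupI(1)[OF T' f'] by blast
    qed
  qed
qed

section \<open>Open stabilizers, countable orbits and failure of density\<close>

lemma ae_countable_of_open_stab:
  assumes op: "AE x in M. open (stab x)"
  shows "ae_countable_pmp_equivalence M (orbit_rel act)"
proof -
  let ?e = "to_nat_on D" and ?d = "from_nat_into D"
  \<comment> \<open>\<open>D\<close> itself, with its elements renamed by their indices to obtain a
    carrier in \<open>nat\<close>.\<close>
  define \<Gamma> :: "nat monoid"
    where "\<Gamma> = \<lparr>carrier = ?e ` D, monoid.mult = (\<lambda>a b. ?e (?d a + ?d b)), one = ?e 0\<rparr>"
  have de: "?d (?e g) = g" if "g \<in> D" for g using that countable_D by simp
  have car: "carrier \<Gamma> = ?e ` D" and mult: "a \<otimes>\<^bsub>\<Gamma>\<^esub> b = ?e (?d a + ?d b)" and one: "\<one>\<^bsub>\<Gamma>\<^esub> = ?e 0" for a b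
    by (simp_all add: \<Gamma>_def)
  have grp: "group \<Gamma>"
  proof (rule groupI)
    fix x assume "x \<in> carrier \<Gamma>"
    then obtain g where g: "g \<in> D" "x = ?e g" unfolding car by blast
    show "\<one>\<^bsub>\<Gamma>\<^esub> \<otimes>\<^bsub>\<Gamma>\<^esub> x = x" unfolding mult one g(2) by (simp add: de g D.zero)
    show "\<exists>y\<in>carrier \<Gamma>. y \<otimes>\<^bsub>\<Gamma>\<^esub> x = \<one>\<^bsub>\<Gamma>\<^esub>"
      unfolding car mult one g(2) by (intro bexI[of _ "?e (- g)"]) (auto simp: de g D.minus)
  next
    fix x y z assume "x \<in> carrier \<Gamma>" "y \<in> carrier \<Gamma>" "z \<in> carrier \<Gamma>"
    then obtain g h k where g: "g \<in> D" "x = ?e g" "h \<in> D" "y = ?e h" "k \<in> D" "z = ?e k"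
      unfolding car by blast
    show "x \<otimes>\<^bsub>\<Gamma>\<^esub> y \<otimes>\<^bsub>\<Gamma>\<^esub> z = x \<otimes>\<^bsub>\<Gamma>\<^esub> (y \<otimes>\<^bsub>\<Gamma>\<^esub> z)"
      unfolding mult g by (simp add: de g D.add add.assoc)
  next
    fix x y assume "x \<in> carrier \<Gamma>" "y \<in> carrier \<Gamma>"
    then show "x \<otimes>\<^bsub>\<Gamma>\<^esub> y \<in> carrier \<Gamma>" unfolding car mult by (auto simp: de D.add)
  qed (auto simp: car one D.zero)
  let ?\<phi> = "\<lambda>n. act (?d n)"
  have Bij: "act g \<in> Bij UNIV" for g unfolding Bij_def using bij_act by auto
  have "group_hom \<Gamma> (BijGroup UNIV) ?\<phi>"
    unfolding group_hom_def group_hom_axioms_def hom_def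
  proof (intro conjI CollectI ballI grp group_BijGroup funcsetI)
    fix x assume "x \<in> carrier \<Gamma>" show "act (?d x) \<in> carrier (BijGroup UNIV)" using Bij by (simp add: BijGroup_def)
  next
    fix x y assume "x \<in> carrier \<Gamma>" "y \<in> carrier \<Gamma>"
    then obtain g h where g: "g \<in> D" "x = ?e g" "h \<in> D" "y = ?e h" unfolding car by blast
    show "act (?d (x \<otimes>\<^bsub>\<Gamma>\<^esub> y)) = act (?d x) \<otimes>\<^bsub>BijGroup UNIV\<^esub> act (?d y)"
      unfolding mult g using g Bij by (simp add: de D.add BijGroup_def compose_def fun_eq_iff act_add)
  qed
  then have ga: "group_action \<Gamma> UNIV ?\<phi>" by (rule group_action.intro)
  have pmp: "pmp_bij M (act g)" if "g \<in> D" for g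
    using pmp_bijI[of "\<lambda>_. g"] that bij_act by simp
  let ?S = "{(x, y). y \<in> orbit \<Gamma> ?\<phi> x}"
  have "countable_pmp_equivalence M ?S"
    unfolding countable_pmp_equivalence_def
    by (intro exI[of _ \<Gamma>] exI[of _ ?\<phi>] conjI ga refl) (auto simp: car de pmp)
  moreover have "AE x in M. orbit_rel act `` {x} = ?S `` {x}"
    using op
  proof eventually_elim
    case (elim x)
    have "\<exists>d\<in>D. act g x = act d x" for g
    proof -
      \<comment> \<open>The coset of all \<open>h\<close> with \<open>act h x = act g x\<close> is
        open and nonempty, so it contains an element of \<open>D\<close>.\<close>
      have "open {h. - g + h \<in> stab x}" by (rule open_translate_left[OF elim])
      moreover have "g \<in> {h. - g + h \<in> stab x}" by (simp add: stab_def)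
      ultimately obtain d where "d \<in> D" "- g + d \<in> stab x" using dense_D by blast
      then show ?thesis by (auto simp: act_eq_act_iff)
    qed
    then have 1: "orbit_rel act `` {x} = (\<lambda>d. act d x) ` D" unfolding orbit_rel_def by auto
    have "?S `` {x} = (\<lambda>n. act (?d n) x) ` ?e ` D" unfolding orbit_def car by blast
    also have "\<dots> = (\<lambda>d. act d x) ` D" unfolding image_image by (rule image_cong) (simp_all add: de)
    finally show ?case using 1 by simp
  qed
  ultimately show ?thesis unfolding ae_countable_pmp_equivalence_def by blast
qed

text \<open>A countable orbit splits the group into countably many closed cosets of the stabilizer,
  so by Baire one of them has interior.\<close>

lemma open_stab_of_ae_countable:
  assumes "ae_countable_pmp_equivalence M (orbit_rel act)"
  shows "AE x in M. open (stab x)"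
proof -
  obtain S where S: "countable_pmp_equivalence M S" "AE x in M. orbit_rel act `` {x} = S `` {x}"
    using assms unfolding ae_countable_pmp_equivalence_def by blast
  obtain \<Gamma> :: "nat monoid" and \<phi> where \<phi>: "S = {(x, y). y \<in> orbit \<Gamma> \<phi> x}"
    using S(1) unfolding countable_pmp_equivalence_def by blast
  have "countable (S `` {x})" for x
  proof -
    have "S `` {x} = (\<lambda>g. \<phi> g x) ` carrier \<Gamma>" unfolding \<phi> orbit_def by auto
    then show ?thesis by simp
  qed
  note cS = this
  from S(2) show ?thesis
  proof eventually_elim
    case (elim x)
    have "{act g x | g. True} = orbit_rel act `` {x}" unfolding orbit_rel_def by auto
    then show ?case using open_stab_of_countable_orbit[of x] cS[of x] elim by simp
  qed
qed

text \<open>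
  With open stabilizers \<open>act g x\<close> is locally constant in \<open>g\<close>, so the elements moving less than half of
  the space form an open neighbourhood of the identity in the full group.
\<close>

lemma aperiodic_not_dense:
  assumes op: "AE x in M. open (stab x)"
  shows "full_group_topology M act closure_of {A \<in> full_group M act. aperiodic M A} \<noteq> full_group M act"
proof
  assume dense: "full_group_topology M act closure_of {A \<in> full_group M act. aperiodic M A} = full_group M act"
  \<comment> \<open>The bound \<open>1 / 2\<close> separates the identity, which moves nothing, from
    aperiodic elements, which move almost everything. The moved measure is the same for all
    representatives.\<close>
  define W where "W = {A \<in> full_group M act. \<forall>T\<in>A. prob {x. T x \<noteq> x} < 1 / 2}"
  have mvm: "{x. T x \<noteq> x} \<in> sets M" if "T \<in> borel_measurable M" for T
    using that unfolding measurable_M sets_M by measurable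
  have mv_cong: "prob {x. T x \<noteq> x} = prob {x. T' x \<noteq> x}"
    if "T \<in> borel_measurable M" "T' \<in> borel_measurable M" "AE x in M. T x = T' x" for T T'
    using that(3) by (intro finite_measure_eq_AE mvm that) (auto elim: eventually_mono)
  have Wclass: "L0_class M T \<in> W \<longleftrightarrow> L0_class M T \<in> full_group M act \<and> prob {x. T x \<noteq> x} < 1 / 2"
    if "T \<in> borel_measurable M" for T
  proof -
    have "prob {x. T' x \<noteq> x} = prob {x. T x \<noteq> x}" if "T' \<in> L0_class M T" for T'
      using that mv_cong[OF \<open>T \<in> borel_measurable M\<close>, of T'] mem_L0_class[OF \<open>T \<in> borel_measurable M\<close>] by simp
    then have "(\<forall>T'\<in>L0_class M T. prob {x. T' x \<noteq> x} < 1 / 2) \<longleftrightarrow> prob {x. T x \<noteq> x} < 1 / 2"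
      using L0_class_self[OF that] by metis
    then show ?thesis unfolding W_def mem_Collect_eq by (rule arg_cong)
  qed
  have oW: "openin (full_group_topology M act) W"
    unfolding openin_full_group_iff
  proof (intro conjI ballI impI)
    show "W \<subseteq> full_group M act" unfolding W_def by blast
    fix A assume A: "A \<in> lifted_full_group M act" "Phi M act A \<in> W"
    have "A \<in> L0 M" using A(1) unfolding lifted_full_group_def by blast
    then obtain f where f: "f \<in> borel_measurable M" and Af: "A = L0_class M f" by (rule L0_cases)
    \<comment> \<open>The margin below \<open>1 / 2\<close>; one half of it is spent on
      \<open>Bad k\<close>, the other on points where the two lifts are far apart.\<close>
    define e where "e = 1 / 2 - prob {x. act (f x) x \<noteq> x}"
    have e: "e > 0"
      using A(2) unfolding Af Phi_class[OF f] Wclass[OF measurable_act_self[OF f]] e_def by simp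
    \<comment> \<open>Points at which \<open>act g x\<close> is not yet constant on the ball of
      radius \<open>1 / Suc k\<close> around \<open>f x\<close>. Testing only \<open>g\<close> in
      \<open>D\<close> makes the set measurable and, by \<open>closed_act_eq\<close>, loses
      nothing.\<close>
    define Bad where "Bad k = {x. \<exists>g\<in>D. dist g (f x) < 1 / Suc k \<and> act g x \<noteq> act (f x) x}" for k :: nat
    have Badm: "Bad k \<in> sets M" for k
    proof -
      have [measurable]: "f \<in> borel_measurable borel" using f by (simp add: measurable_M)
      have "{x. dist g (f x) < 1 / Suc k \<and> act g x \<noteq> act (f x) x} \<in> sets borel" for g
        by measurable
      moreover have "Bad k = (\<Union>g\<in>D. {x. dist g (f x) < 1 / Suc k \<and> act g x \<noteq> act (f x) x})"
        unfolding Bad_def by auto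
      ultimately show ?thesis using countable_D by (simp add: sets_M sets.countable_UN'')
    qed
    have near: "act h x = act (f x) x" if "x \<notin> Bad k" "dist h (f x) < 1 / Suc k" for h x k
    proof (rule ccontr)
      assume "act h x \<noteq> act (f x) x"
      then have "h \<in> ball (f x) (1 / Suc k) \<inter> - {g. act g x = act (f x) x}"
        using that(2) by (simp add: dist_commute)
      moreover have "open (ball (f x) (1 / Suc k) \<inter> - {g. act g x = act (f x) x})"
        using closed_act_eq by auto
      ultimately obtain g where "g \<in> D" "g \<in> ball (f x) (1 / Suc k) \<inter> - {g. act g x = act (f x) x}"
        using dense_D by blast
      then show False using that(1) by (auto simp: Bad_def dist_commute)
    qed
    have "(\<lambda>k. prob (Bad k)) \<longlonglongrightarrow> prob (\<Inter>k. Bad k)"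
    proof (rule finite_Lim_measure_decseq)
      show "range Bad \<subseteq> sets M" using Badm by auto
      show "decseq Bad"
      proof (rule decseq_SucI)
        fix k
        have "1 / real (Suc (Suc k)) \<le> 1 / real (Suc k)" by (simp add: frac_le)
        then show "Bad (Suc k) \<subseteq> Bad k" unfolding Bad_def by (auto intro: less_le_trans)
      qed
    qed
    moreover have "prob (\<Inter>k. Bad k) = 0"
    proof -
      have "AE x in M. x \<notin> (\<Inter>k. Bad k)"
        using op
      proof eventually_elim
        case (elim x)
        have "open {h. - f x + h \<in> stab x}" by (rule open_translate_left[OF elim])
        moreover have "f x \<in> {h. - f x + h \<in> stab x}" by (simp add: stab_def)
        ultimately obtain d where d: "d > 0" "ball (f x) d \<subseteq> {h. - f x + h \<in> stab x}"
          using open_contains_ball by blast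
        obtain k where k: "1 / Suc k < d" using nat_approx_posE[OF d(1)] by blast
        have "x \<notin> Bad k"
        proof
          assume "x \<in> Bad k"
          then obtain g where g: "dist g (f x) < 1 / Suc k" "act g x \<noteq> act (f x) x" unfolding Bad_def by blast
          then have "g \<in> ball (f x) d" using k by (simp add: dist_commute)
          then have "- f x + g \<in> stab x" using d(2) by blast
          then show False using g(2) by (simp flip: act_eq_act_iff)
        qed
        then show ?case by blast
      qed
      then show ?thesis using prob_eq_0[of "\<Inter>k. Bad k"] Badm by auto
    qed
    ultimately have "\<forall>\<^sub>F k in sequentially. prob (Bad k) < e / 2"
      using order_tendstoD(2)[of _ 0 sequentially "e / 2"] e by simp
    then obtain k where k: "prob (Bad k) < e / 2" by (auto simp: eventually_sequentially)
    show "\<exists>r>0. \<forall>A'\<in>lifted_full_group M act. L0_dist M A A' < r \<longrightarrow> Phi M act A' \<in> W"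
    proof (intro exI[of _ "e / (2 * Suc k)"] conjI ballI impI)
      show "0 < e / (2 * Suc k)" using e by simp
      fix A' assume A': "A' \<in> lifted_full_group M act" "L0_dist M A A' < e / (2 * Suc k)"
      have "A' \<in> L0 M" using A'(1) unfolding lifted_full_group_def by blast
      then obtain h where h: "h \<in> borel_measurable M" and Ah: "A' = L0_class M h" by (rule L0_cases)
      let ?m = "\<lambda>x. min 1 (dist (f x) (h x))"
      have mm: "?m \<in> borel_measurable M" using f h by measurable
      have int: "integrable M ?m" by (rule integrable_const_bound[of _ 1]) (use mm in auto)
      \<comment> \<open>Markov's inequality at level \<open>1 / Suc k\<close> multiplies the
        distance by \<open>Suc k\<close>, which explains the radius
        \<open>e / (2 * Suc k)\<close>.\<close>
      have "prob {x \<in> space M. ?m x \<ge> 1 / Suc k} \<le> (\<integral>x. ?m x \<partial>M) / (1 / Suc k)"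
        by (rule integral_Markov_inequality_measure[OF int, where A = "{}"]) auto
      also have "\<dots> = Suc k * L0_dist M A A'" unfolding Af Ah L0_dist_class[OF f h] by simp
      also have "\<dots> < e / 2" using A'(2) by (simp add: field_simps)
      finally have far: "prob {x. ?m x \<ge> 1 / Suc k} < e / 2" by (simp add: space_M)
      have farm: "{x. ?m x \<ge> 1 / Suc k} \<in> sets M" using mm unfolding measurable_M sets_M by measurable
      have sub: "{x. act (h x) x \<noteq> x} \<subseteq> {x. act (f x) x \<noteq> x} \<union> Bad k \<union> {x. ?m x \<ge> 1 / Suc k}"
      proof
        fix x assume x: "x \<in> {x. act (h x) x \<noteq> x}"
        show "x \<in> {x. act (f x) x \<noteq> x} \<union> Bad k \<union> {x. ?m x \<ge> 1 / Suc k}"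
        proof (rule ccontr)
          assume n: "\<not> ?thesis"
          then have "dist (h x) (f x) < 1 / Suc k" by (auto simp: dist_commute min_def split: if_splits)
          then have "act (h x) x = act (f x) x" using near[of x k "h x"] n by blast
          then show False using n x by simp
        qed
      qed
      have fm: "{x. act (f x) x \<noteq> x} \<in> sets M" by (rule mvm[OF measurable_act_self[OF f]])
      have "prob {x. act (h x) x \<noteq> x} \<le> prob ({x. act (f x) x \<noteq> x} \<union> Bad k \<union> {x. ?m x \<ge> 1 / Suc k})"
        by (rule finite_measure_mono[OF sub]) (use fm Badm farm in auto)
      also have "\<dots> \<le> prob ({x. act (f x) x \<noteq> x} \<union> Bad k) + prob {x. ?m x \<ge> 1 / Suc k}"
        by (rule measure_Un_le) (use fm Badm farm in auto)
      also have "\<dots> \<le> prob {x. act (f x) x \<noteq> x} + prob (Bad k) + prob {x. ?m x \<ge> 1 / Suc k}"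
        using measure_Un_le[OF fm Badm[of k]] by simp
      also have "\<dots> < 1 / 2" using k far by (simp add: e_def)
      finally have "prob {x. act (h x) x \<noteq> x} < 1 / 2" .
      then show "Phi M act A' \<in> W"
        using Phi_lifted_in_full_group[OF A'(1)]
        unfolding Ah Phi_class[OF h] Wclass[OF measurable_act_self[OF h]] by simp
    qed
  qed
  have idW: "L0_class M (\<lambda>x. x) \<in> full_group M act" "L0_class M (\<lambda>x. x) \<in> W"
  proof -
    have "pmp_bij M (\<lambda>x. x)" using pmp_bijI[of "\<lambda>_. 0"] D.zero bij_id by (simp add: id_def)
    then have "L0_class M (\<lambda>x. x) \<in> full_group M act" by (rule full_groupI(1)[of _ "\<lambda>_. 0"]) auto
    moreover have "(\<lambda>x. x) \<in> borel_measurable M" by (simp add: measurable_M)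
    ultimately show "L0_class M (\<lambda>x. x) \<in> full_group M act" "L0_class M (\<lambda>x. x) \<in> W"
      by (simp_all add: Wclass)
  qed
  have "L0_class M (\<lambda>x. x) \<in> full_group_topology M act closure_of {A \<in> full_group M act. aperiodic M A}"
    by (subst dense) (rule idW(1))
  then have "\<exists>B. B \<in> {A \<in> full_group M act. aperiodic M A} \<and> B \<in> W"
    unfolding in_closure_of using idW(2) oW by blast
  then obtain B where B: "aperiodic M B" "B \<in> W" by blast
  obtain T where T: "T \<in> B" "AE x in M. infinite {y. \<exists>n. y = (T ^^ n) x \<or> x = (T ^^ n) y}"
    and Tpmp: "pmp_bij M T"
    using B(1) unfolding aperiodic_def by blast
  have "AE x in M. T x \<noteq> x"
    using T(2)
  proof eventually_elim
    case (elim x)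
    show ?case
    proof
      assume fixed: "T x = x"
      have fx: "(T ^^ n) x = x" for n by (induction n) (auto simp: fixed)
      \<comment> \<open>Orbits in \<open>aperiodic\<close> are two-sided, so preimages of a fixed
        point have to be excluded as well; injectivity does this.\<close>
      have "y = x" if "(T ^^ n) y = x" for n y
        using that inj_fn[OF bij_is_inj, of T n] Tpmp fx[of n] by (metis injD pmp_bij_def)
      then have "{y. \<exists>n. y = (T ^^ n) x \<or> x = (T ^^ n) y} \<subseteq> {x}" using fx by auto
      then show False using elim finite_subset by blast
    qed
  qed
  moreover have "{x. T x \<noteq> x} \<in> sets M" by (rule mvm[OF pmp_bij_measurable[OF Tpmp]])
  ultimately have "prob {x. T x \<noteq> x} = 1" using prob_eq_1[of "{x. T x \<noteq> x}"] by simp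
  moreover have "prob {x. T x \<noteq> x} < 1 / 2" using B(2) T(1) unfolding W_def by blast
  ultimately show False by simp
qed

end

theorem corollary4p5:
  fixes M :: "'x::polish_space measure"
    and act :: "'g::{polish_space, topological_group_add} \<Rightarrow> 'x \<Rightarrow> 'x"
  assumes "standard_probability_space M"
    and "locally_compact_space (euclidean :: 'g topology)"
    and "borel_pmp_action M act"
    and "ergodic_action M act"
  shows "(ae_countable_pmp_equivalence M (orbit_rel act) \<or>
            full_group_topology M act closure_of {A \<in> full_group M act. aperiodic M A}
              = full_group M act) \<and>
         \<not> (ae_countable_pmp_equivalence M (orbit_rel act) \<and>
            full_group_topology M act closure_of {A \<in> full_group M act. aperiodic M A}
              = full_group M act)"
proof -
  have M: "prob_space M" "sets M = sets borel" using assms(1) unfolding standard_probability_space_def by auto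
  obtain D :: "'g set" where D: "countable D" "add_subgroup D" "\<And>U. open U \<Longrightarrow> U \<noteq> {} \<Longrightarrow> \<exists>d\<in>D. d \<in> U"
    using countable_dense_subgroup by blast
  interpret borel_pmp_system M D act
    unfolding borel_pmp_system_def borel_pmp_system_axioms_def using M D assms(3) by blast
  consider "AE x in M. open (stab x)" | "AE x in M. \<not> open (stab x)"
    using ergodic_dichotomy[OF assms(4)] by blast
  then show ?thesis
  proof cases
    case 1
    then show ?thesis using ae_countable_of_open_stab aperiodic_not_dense by blast
  next
    case 2
    have "\<not> ae_countable_pmp_equivalence M (orbit_rel act)"
    proof
      assume "ae_countable_pmp_equivalence M (orbit_rel act)"
      then have "AE x in M. open (stab x)" by (rule open_stab_of_ae_countable)
      with 2 have "AE x in M. False" by eventually_elim simp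
      then show False by simp
    qed
    then show ?thesis using aperiodic_dense[OF 2] by blast
  qed
qed

end
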